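(* Let $d\ge1$ be any dimension, and let $c$ be a strictly positive local flip-rate function satisfying the attractiveness and high-temperature hypotheses stated in the context. Then the spectral gap $\mathrm{gap}$ of the Glauber-Exclusion process on $\Lambda_L^d$ satisfies $$\liminf_{L\to\infty}\ \mathrm{gap}\;\ge\;|R'(\rho_* )| .$$
   Context: Setting. Fix $d\ge 1$. $\Lambda_L^d=(\mathbb Z/L\mathbb Z)^d$ is the torus of side length $L$ (nearest-neighbour graph), and $\mathcal X=\{-1,1\}^{\Lambda_L^d}$. For $x\in\mathcal X$, $x^{u\leftrightarrow u'}$ is $x$ with the values at $u,u'$ exchanged, and $x^{u,\pm1}$ is $x$ with the value at $u$ replaced by $\pm1$. Fix a nonnegative integer $m$, let $B(0,m)\subset\mathbb Z^d$ be the set of sites at (graph) distance at most $m$ from $0$, and fix a local flip-rate function $c:\{-1,1\}^{B(0,m)}\to(0,\infty)$ (both $m$ and $c$ independent of $L$). For $L$ large, identify $B(0,m)$ with a subset of $\Lambda_L^d$ and set $\hat c(u,x)=c\big((x(u+v))_{v\in B(0,m)}\big)$ for $u\in\Lambda_L^d$, $x\in\mathcal X$. The Glauber-Exclusion process is the continuous-time Markov process $(X_t)_{t\ge0}$ on $\mathcal X$ with generator $\mathcal L_{GE}=L^2\mathcal L_E+\mathcal L_G$, where $$\mathcal L_E\varphi(x)=\sum_{u\sim u'}\big(\varphi(x^{u\leftrightarrow u'})-\varphi(x)\big),\qquad \mathcal L_G\varphi(x)=\sum_{u\in\Lambda_L^d}\hat c(u,x)\big(\varphi(x^{u,-x(u)})-\varphi(x)\big),$$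 the first sum being over unordered pairs of neighbouring sites. It is irreducible with unique invariant distribution $\pi$. Attractiveness: for all $x\le y$ (coordinatewise) in $\{-1,1\}^{B(0,m)}$, $c(x)\ge c(y)$ if $x(0)=y(0)=1$, and $c(x)\le c(y)$ if $x(0)=y(0)=-1$. Reaction function: for $\rho\in[-1,1]$ let $\nu_\rho$ be the product measure on $\{-1,1\}^{B(0,m)}$ whose marginals give mass $(1+\rho)/2$ to $1$ and $(1-\rho)/2$ to $-1$; set $R(\rho)=\mathbb E_{\nu_\rho}[-2\xi_0c(\xi)]$, where $\xi\sim\nu_\rho$. High temperature: $R$ has a unique root $\rho_*$ in $[-1,1]$, and $R'(\rho_* )<0$. Spectral gap: $\mathrm{gap}$ is the smallest real part of the non-zero eigenvalues of $-\mathcal L_{GE}$; equivalently $\mathrm{gap}=\lim_{t\to\infty}-\frac1t\log\max_{x\in\mathcal X}d_{TV}(\mathbb P_x[X_t\in\cdot],\pi)$, with $d_{TV}$ the total variation distance and $\mathbb P_x$ the law of the process started at $x$. *)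

theory Defs
  imports "HOL-Probability.Probability"
begin

text \<open>
  The dimension \<open>d \<ge> 1\<close> is the cardinality of the finite index type \<open>'d\<close>.
  Sites of \<open>\<int>\<^sup>d\<close> are vectors of type \<open>int ^ 'd\<close>; sites of the torus are represented by the
  vectors with all coordinates in \<open>{0..<L}\<close>.
\<close>

definition lattice_adj :: "((int ^ 'd) \<times> (int ^ 'd)) set" where
  "lattice_adj = {(u, v). \<exists>i. v = u + axis i 1 \<or> u = v + axis i 1}"

text \<open>The ball for the graph distance: sites joined to \<open>0\<close> by a walk of length at most \<open>m\<close>.\<close>

definition ball0 :: "nat \<Rightarrow> (int ^ 'd) set" where
  "ball0 m = {v. \<exists>k\<le>m. (0, v) \<in> lattice_adj ^^ k}"

definition torus :: "nat \<Rightarrow> (int ^ 'd) set" where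
  "torus L = {u. \<forall>i. 0 \<le> u $ i \<and> u $ i < int L}"

definition wrap :: "nat \<Rightarrow> int ^ 'd \<Rightarrow> int ^ 'd" where
  "wrap L u = (\<chi> i. u $ i mod int L)"

definition torus_adj :: "nat \<Rightarrow> ((int ^ 'd) \<times> (int ^ 'd)) set" where
  "torus_adj L = {(u, v). u \<in> torus L \<and> v \<in> torus L \<and> u \<noteq> v \<and>
     (\<exists>i. v = wrap L (u + axis i 1) \<or> u = wrap L (v + axis i 1))}"

type_synonym 'd config = "int ^ 'd \<Rightarrow> int"

text \<open>\<open>{-1, 1}\<^sup>A\<close>; a configuration is \<open>undefined\<close> outside \<open>A\<close>.\<close>

definition configs :: "(int ^ 'd) set \<Rightarrow> ('d::finite) config set" where
  "configs A = A \<rightarrow>\<^sub>E {-1, 1}"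

text \<open>The flip rate at \<open>u\<close>. For \<open>L > 2 * m\<close> the map \<open>v \<mapsto> wrap L (u + v)\<close> is injective on the ball.\<close>

definition flip_rate :: "nat \<Rightarrow> (('d::finite) config \<Rightarrow> real) \<Rightarrow> nat \<Rightarrow> int ^ 'd \<Rightarrow> 'd config \<Rightarrow> real" where
  "flip_rate m c L u x = c (restrict (\<lambda>v. x (wrap L (u + v))) (ball0 m))"

text \<open>
  The generators act on complex-valued functions, since the eigenvalues may be non-real; only the
  values at configurations in \<open>configs (torus L)\<close> matter. The factor \<open>1/2\<close> accounts for
  \<open>torus_adj\<close> containing every unordered pair of neighbours in both orders.
\<close>

definition exclusion_gen :: "nat \<Rightarrow> (('d::finite) config \<Rightarrow> complex) \<Rightarrow> 'd config \<Rightarrow> complex" where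
  "exclusion_gen L \<phi> x = 1 / 2 * (\<Sum>(u, u')\<in>torus_adj L. (\<phi> (x(u := x u', u' := x u)) - \<phi> x))"

definition glauber_gen ::
  "nat \<Rightarrow> (('d::finite) config \<Rightarrow> real) \<Rightarrow> nat \<Rightarrow> ('d config \<Rightarrow> complex) \<Rightarrow> 'd config \<Rightarrow> complex" where
  "glauber_gen m c L \<phi> x =
     (\<Sum>u\<in>torus L. complex_of_real (flip_rate m c L u x) * (\<phi> (x(u := - x u)) - \<phi> x))"

definition ge_gen ::
  "nat \<Rightarrow> (('d::finite) config \<Rightarrow> real) \<Rightarrow> nat \<Rightarrow> ('d config \<Rightarrow> complex) \<Rightarrow> 'd config \<Rightarrow> complex" where
  "ge_gen m c L \<phi> x = of_nat L ^ 2 * exclusion_gen L \<phi> x + glauber_gen m c L \<phi> x"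

definition neg_gen_eigenvalue :: "nat \<Rightarrow> (('d::finite) config \<Rightarrow> real) \<Rightarrow> nat \<Rightarrow> complex \<Rightarrow> bool" where
  "neg_gen_eigenvalue m c L z \<longleftrightarrow>
     (\<exists>\<phi>. (\<exists>x\<in>configs (torus L). \<phi> x \<noteq> 0) \<and>
          (\<forall>x\<in>configs (torus L). - ge_gen m c L \<phi> x = z * \<phi> x))"

definition spectral_gap :: "nat \<Rightarrow> (('d::finite) config \<Rightarrow> real) \<Rightarrow> nat \<Rightarrow> real" where
  "spectral_gap m c L = Min {Re z |z. neg_gen_eigenvalue m c L z \<and> z \<noteq> 0}"

definition attractive :: "nat \<Rightarrow> (('d::finite) config \<Rightarrow> real) \<Rightarrow> bool" where
  "attractive m c \<longleftrightarrow>
     (\<forall>x\<in>configs (ball0 m). \<forall>y\<in>configs (ball0 m). (\<forall>v\<in>ball0 m. x v \<le> y v) \<longrightarrow>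
        (x 0 = 1 \<and> y 0 = 1 \<longrightarrow> c x \<ge> c y) \<and>
        (x 0 = -1 \<and> y 0 = -1 \<longrightarrow> c x \<le> c y))"

definition spin_pmf :: "real \<Rightarrow> int pmf" where
  "spin_pmf \<rho> = map_pmf (\<lambda>b. if b then 1 else -1) (bernoulli_pmf ((1 + \<rho>) / 2))"

definition product_measure :: "nat \<Rightarrow> real \<Rightarrow> ('d::finite) config pmf" where
  "product_measure m \<rho> = Pi_pmf (ball0 m) undefined (\<lambda>_. spin_pmf \<rho>)"

text \<open>
  Only \<open>\<rho> \<in> {-1..1}\<close> is meaningful. For positive \<open>c\<close> the roots of the reaction function in
  this interval are interior, so its two-sided derivative there depends on these values only.
\<close>

definition reaction :: "nat \<Rightarrow> (('d::finite) config \<Rightarrow> real) \<Rightarrow> real \<Rightarrow> real" where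
  "reaction m c \<rho> =
     measure_pmf.expectation (product_measure m \<rho>) (\<lambda>\<xi>. -2 * of_int (\<xi> 0) * c \<xi>)"

definition high_temperature :: "nat \<Rightarrow> (('d::finite) config \<Rightarrow> real) \<Rightarrow> real \<Rightarrow> bool" where
  "high_temperature m c \<rho> \<longleftrightarrow>
     {r \<in> {-1..1}. reaction m c r = 0} = {\<rho>} \<and> deriv (reaction m c) \<rho> < 0"

end

theory Submission
  imports Defs "Jordan_Normal_Form.Spectral_Radius"
begin

text \<open>
  The process is realised by random maps that act monotonically on all configurations at once. Let
  \<open>x \<le> y\<close> evolve under the same maps as two copies started from all plus and all minus. The sites where
  \<open>x\<close> and \<open>y\<close> differ perform a branching motion, and their expected number bounds the decay of
  \<open>\<phi> y - \<phi> x\<close> for every eigenfunction \<open>\<phi>\<close>; it suffices that over one fixed, long time \<open>t\<close> it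
  shrinks by a factor \<open>C * exp (- (\<bar>R'\<bar> - \<epsilon>) * t)\<close>, where \<open>C\<close> depends on neither \<open>t\<close> nor \<open>L\<close>.

  Averaged over translations, the law of a discrepancy together with finitely many spins of an
  extremal copy stays close to the product of its marginals with a Bernoulli measure whose density
  solves the ODE \<open>\<rho>' = R \<rho>\<close>: Bernoulli measures are invariant under exchanges, and the flips propagate
  the product structure exactly unless two of the observed sites interact. The exchanges, sped up by
  \<open>L\<^sup>2\<close>, make such encounters rare, which is expressed by a superharmonic function of size \<open>O(1 / L)\<close>. After
  a burn-in both densities are near \<open>\<rho>\<^sub>*\<close>, so the discrepancies multiply at rate close to \<open>R'(\<rho>\<^sub>*)\<close>.

  Time is discretised, with the step tending to zero for fixed \<open>L\<close>.
\<close>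

section \<open>Product measures\<close>

text \<open>Every error is kept proportional to the number of discrepancies
  (\<open>pair_observable\<close> functions vanish where the pair agrees), because the final
  estimate must be linear in the initial distance: it is applied to an ordered pair maximising
  \<open>|\<phi> y - \<phi> x|\<close> per unit of distance, so that the maximal ratio cancels.
  Correlations are followed backwards along the set of sites an observable depends on. That set
  grows, so the function controlling encounters has to survive growth; this is why
  \<open>barrier\<close> carries extra powers of the cardinality. The product structure is exact at
  time 0, since the extremal copies start constant, i.e. Bernoulli of density 1 and -1. Later the
  bound on the correlation error grows like \<open>exp (decor_rate * t) * \<psi>m\<close>; hence
  \<open>t\<close> is fixed first and only then \<open>L\<close> tends to infinity. One coordinate
  of the torus suffices in every dimension: the difference of two sites in that coordinate walks on
  a cycle of length \<open>L\<close> at speed \<open>L^2\<close> and spends a fraction of order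
  \<open>1 / L\<close> of its time near 0.\<close>

definition depends_on :: "'a set \<Rightarrow> (('a \<Rightarrow> 'b) \<Rightarrow> 'c) \<Rightarrow> bool" where
  "depends_on A g \<longleftrightarrow> (\<forall>x y. (\<forall>u\<in>A. x u = y u) \<longrightarrow> g x = g y)"

text \<open>A polynomial in \<open>\<rho>\<close>, hence differentiable on all of the reals. The
  total mass is 1 for every \<open>\<rho>\<close>, but nonnegativity relies on \<open>\<rho>\<close>
  in [-1,1].\<close>

definition spin_weight :: "'a set \<Rightarrow> real \<Rightarrow> ('a \<Rightarrow> int) \<Rightarrow> real" where
  "spin_weight \<Lambda> \<rho> x = (\<Prod>u\<in>\<Lambda>. (1 + \<rho> * of_int (x u)) / 2)"

definition spin_mean :: "'a set \<Rightarrow> real \<Rightarrow> (('a \<Rightarrow> int) \<Rightarrow> real) \<Rightarrow> real" where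
  "spin_mean \<Lambda> \<rho> g = (\<Sum>x\<in>\<Lambda> \<rightarrow>\<^sub>E {-1, 1}. spin_weight \<Lambda> \<rho> x * g x)"

text \<open>On spins, \<open>g\<close> is affine in the value at \<open>u\<close>, and this is its
  slope: the increment is divided by the distance 2 between the two spin values.\<close>

definition half_diff :: "'a \<Rightarrow> (('a \<Rightarrow> int) \<Rightarrow> real) \<Rightarrow> ('a \<Rightarrow> int) \<Rightarrow> real" where
  "half_diff u g x = (g (x(u := 1)) - g (x(u := -1))) / 2"

lemma depends_onD: "depends_on A g \<Longrightarrow> (\<And>u. u \<in> A \<Longrightarrow> x u = y u) \<Longrightarrow> g x = g y"
  by (auto simp: depends_on_def)

lemma depends_on_half_diff: "depends_on A g \<Longrightarrow> depends_on (A - {u}) (half_diff u g)"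
  unfolding depends_on_def half_diff_def
proof (intro allI impI)
  fix x y :: "'a \<Rightarrow> int"
  assume g: "\<forall>x y. (\<forall>u\<in>A. x u = y u) \<longrightarrow> g x = g y" and xy: "\<forall>v\<in>A - {u}. x v = y v"
  have "g (x(u := 1)) = g (y(u := 1))" "g (x(u := -1)) = g (y(u := -1))"
    using g xy by auto
  thus "(g (x(u := 1)) - g (x(u := -1))) / 2 = (g (y(u := 1)) - g (y(u := -1))) / 2" by simp
qed

lemma half_diff_eq_0: "depends_on A g \<Longrightarrow> u \<notin> A \<Longrightarrow> half_diff u g x = 0"
proof -
  assume "depends_on A g" "u \<notin> A"
  then have "g (x(u := 1)) = g (x(u := -1))" using depends_onD[of A g "x(u := 1)" "x(u := -1)"] by force
  thus ?thesis by (simp add: half_diff_def)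
qed

lemma finite_spins: "finite \<Lambda> \<Longrightarrow> finite (\<Lambda> \<rightarrow>\<^sub>E {-1, 1::int})"
  by (rule finite_PiE) auto

lemma PiE_spin_cases: "x \<in> \<Lambda> \<rightarrow>\<^sub>E {-1, 1::int} \<Longrightarrow> u \<in> \<Lambda> \<Longrightarrow> x u = -1 \<or> x u = 1"
  by (auto simp: PiE_iff)

lemma spin_upd: "x \<in> \<Lambda> \<rightarrow>\<^sub>E {-1, 1::int} \<Longrightarrow> u \<in> \<Lambda> \<Longrightarrow> b = -1 \<or> b = 1 \<Longrightarrow> x(u := b) \<in> \<Lambda> \<rightarrow>\<^sub>E {-1, 1}"
  by (auto simp: PiE_iff extensional_def)

lemma half_diff_bound:
  assumes "\<And>x. x \<in> \<Lambda> \<rightarrow>\<^sub>E {-1, 1} \<Longrightarrow> \<bar>g x\<bar> \<le> K" "u \<in> \<Lambda>" "x \<in> \<Lambda> \<rightarrow>\<^sub>E {-1, 1}"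
  shows "\<bar>half_diff u g x\<bar> \<le> K"
  using assms(1)[OF spin_upd[OF assms(3,2), of 1]] assms(1)[OF spin_upd[OF assms(3,2), of "-1"]]
  by (simp add: half_diff_def abs_le_iff)

lemma spin_weight_nonneg:
  assumes "x \<in> \<Lambda> \<rightarrow>\<^sub>E {-1, 1}" "\<rho> \<in> {-1..1}"
  shows "spin_weight \<Lambda> \<rho> x \<ge> 0"
  unfolding spin_weight_def
proof (rule prod_nonneg)
  fix u assume "u \<in> \<Lambda>"
  then have "x u = -1 \<or> x u = 1" using assms(1) by (rule PiE_spin_cases[rotated])
  thus "0 \<le> (1 + \<rho> * real_of_int (x u)) / 2" using assms(2) by auto
qed

lemma sum_spin_weight: "finite \<Lambda> \<Longrightarrow> (\<Sum>x\<in>\<Lambda> \<rightarrow>\<^sub>E {-1, 1}. spin_weight \<Lambda> \<rho> x) = 1"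
proof -
  assume "finite \<Lambda>"
  have "(\<Prod>u\<in>\<Lambda>. \<Sum>b\<in>{-1, 1::int}. (1 + \<rho> * of_int b) / 2) =
      (\<Sum>x\<in>\<Lambda> \<rightarrow>\<^sub>E {-1, 1}. \<Prod>u\<in>\<Lambda>. (1 + \<rho> * of_int (x u)) / 2)"
    by (rule prod_sum_PiE) (use \<open>finite \<Lambda>\<close> in auto)
  moreover have "(\<Sum>b\<in>{-1, 1::int}. (1 + \<rho> * of_int b) / 2) = 1" by (simp add: field_simps)
  ultimately show ?thesis by (simp add: spin_weight_def)
qed

lemma spin_mean_const: "finite \<Lambda> \<Longrightarrow> spin_mean \<Lambda> \<rho> (\<lambda>_. a) = a"
  unfolding spin_mean_def by (simp flip: sum_distrib_right add: sum_spin_weight)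

lemma spin_mean_cong:
  "(\<And>x. x \<in> \<Lambda> \<rightarrow>\<^sub>E {-1, 1} \<Longrightarrow> g x = g' x) \<Longrightarrow> spin_mean \<Lambda> \<rho> g = spin_mean \<Lambda> \<rho> g'"
  unfolding spin_mean_def by (auto intro: sum.cong)

lemma spin_mean_add: "spin_mean \<Lambda> \<rho> (\<lambda>x. f x + g x) = spin_mean \<Lambda> \<rho> f + spin_mean \<Lambda> \<rho> g"
  unfolding spin_mean_def by (simp add: algebra_simps sum.distrib)

lemma spin_mean_diff: "spin_mean \<Lambda> \<rho> (\<lambda>x. f x - g x) = spin_mean \<Lambda> \<rho> f - spin_mean \<Lambda> \<rho> g"
  unfolding spin_mean_def by (simp add: algebra_simps sum_subtractf)

lemma spin_mean_cmult: "spin_mean \<Lambda> \<rho> (\<lambda>x. a * g x) = a * spin_mean \<Lambda> \<rho> g"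
  unfolding spin_mean_def by (simp add: algebra_simps sum_distrib_left)

lemma spin_mean_sum: "spin_mean \<Lambda> \<rho> (\<lambda>x. \<Sum>i\<in>I. g i x) = (\<Sum>i\<in>I. spin_mean \<Lambda> \<rho> (g i))"
  unfolding spin_mean_def sum_distrib_left by (rule sum.swap)

lemma spin_mean_mono:
  assumes "\<rho> \<in> {-1..1}" "\<And>x. x \<in> \<Lambda> \<rightarrow>\<^sub>E {-1, 1} \<Longrightarrow> f x \<le> g x"
  shows "spin_mean \<Lambda> \<rho> f \<le> spin_mean \<Lambda> \<rho> g"
  unfolding spin_mean_def
  by (intro sum_mono mult_left_mono assms spin_weight_nonneg)

lemma spin_mean_abs_le:
  assumes "finite \<Lambda>" "\<rho> \<in> {-1..1}" "\<And>x. x \<in> \<Lambda> \<rightarrow>\<^sub>E {-1, 1} \<Longrightarrow> \<bar>g x\<bar> \<le> a"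
  shows "\<bar>spin_mean \<Lambda> \<rho> g\<bar> \<le> a"
proof -
  have "g x \<le> a" "- a \<le> g x" if "x \<in> \<Lambda> \<rightarrow>\<^sub>E {-1, 1}" for x
    using assms(3)[OF that] by linarith+
  hence "spin_mean \<Lambda> \<rho> g \<le> spin_mean \<Lambda> \<rho> (\<lambda>_. a)" "spin_mean \<Lambda> \<rho> (\<lambda>_. - a) \<le> spin_mean \<Lambda> \<rho> g"
    by (auto intro!: spin_mean_mono[OF assms(2)])
  thus ?thesis using assms(1) by (auto simp: spin_mean_const abs_le_iff)
qed

text \<open>Relabelling the sites preserves a product of equal marginals. Used for exchanges
  (\<open>h\<close> a transposition) and for moving the ball to a translate on the torus.\<close>

lemma spin_mean_bij:
  assumes h: "bij_betw h A B" and "finite A"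
  shows "spin_mean A \<rho> f = spin_mean B \<rho> (\<lambda>y. f (restrict (y \<circ> h) A))"
proof -
  define k where "k = the_inv_into A h"
  have k: "bij_betw k B A" unfolding k_def by (rule bij_betw_the_inv_into[OF h])
  have hk: "h (k v) = v" if "v \<in> B" for v
    unfolding k_def using h that by (metis bij_betw_def f_the_inv_into_f)
  have kh: "k (h u) = u" if "u \<in> A" for u
    unfolding k_def using h that by (simp add: bij_betw_def the_inv_into_f_f)
  have hB: "h u \<in> B" if "u \<in> A" for u using h that by (auto simp: bij_betw_def)
  have kA: "k v \<in> A" if "v \<in> B" for v using k that by (auto simp: bij_betw_def)
  show ?thesis unfolding spin_mean_def
  proof (rule sum.reindex_bij_witness[where i = "\<lambda>y. restrict (y \<circ> h) A" and j = "\<lambda>x. restrict (x \<circ> k) B"])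
    fix x assume x: "x \<in> A \<rightarrow>\<^sub>E {-1, 1::int}"
    show "restrict (x \<circ> k) B \<in> B \<rightarrow>\<^sub>E {-1, 1}" using x kA by (fastforce simp: PiE_iff)
    show e: "restrict (restrict (x \<circ> k) B \<circ> h) A = x"
      using x by (auto simp: fun_eq_iff hB kh PiE_iff extensional_def restrict_def)
    have "spin_weight B \<rho> (restrict (x \<circ> k) B) = (\<Prod>v\<in>B. (1 + \<rho> * of_int (x (k v))) / 2)"
      unfolding spin_weight_def by (rule prod.cong) auto
    also have "\<dots> = spin_weight A \<rho> x" unfolding spin_weight_def
      using prod.reindex_bij_betw[OF k, of "\<lambda>u. (1 + \<rho> * of_int (x u)) / 2"] by simp
    finally show "spin_weight B \<rho> (restrict (x \<circ> k) B) * f (restrict (restrict (x \<circ> k) B \<circ> h) A) =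
        spin_weight A \<rho> x * f x" unfolding e by simp
  next
    fix y assume y: "y \<in> B \<rightarrow>\<^sub>E {-1, 1::int}"
    show "restrict (y \<circ> h) A \<in> A \<rightarrow>\<^sub>E {-1, 1}" using y hB by (fastforce simp: PiE_iff)
    show "restrict (restrict (y \<circ> h) A \<circ> k) B = y"
      using y by (auto simp: fun_eq_iff kA hk PiE_iff extensional_def restrict_def)
  qed
qed

text \<open>Fubini: a configuration on the disjoint union is a pair of restrictions, and the weight
  factorises accordingly.\<close>

lemma spin_mean_Un:
  assumes "finite A" "finite B" "A \<inter> B = {}" "depends_on A f" "depends_on B g"
  shows "spin_mean (A \<union> B) \<rho> (\<lambda>x. f x * g x) = spin_mean A \<rho> f * spin_mean B \<rho> g"
proof -
  let ?S = "\<lambda>A. A \<rightarrow>\<^sub>E {-1, 1::int}"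
  let ?m = "\<lambda>(a, b). \<lambda>u. if u \<in> A then a u else b u"
  have "spin_mean (A \<union> B) \<rho> (\<lambda>x. f x * g x) =
      (\<Sum>(a, b)\<in>?S A \<times> ?S B. (spin_weight A \<rho> a * f a) * (spin_weight B \<rho> b * g b))"
    unfolding spin_mean_def
  proof (rule sum.reindex_bij_witness[where i = ?m and j = "\<lambda>x. (restrict x A, restrict x B)"])
    fix x assume x: "x \<in> ?S (A \<union> B)"
    show "?m (restrict x A, restrict x B) = x"
      using x by (auto simp: fun_eq_iff PiE_iff extensional_def)
    show "(restrict x A, restrict x B) \<in> ?S A \<times> ?S B" using x by (auto simp: PiE_iff)
    have "f (restrict x A) = f x" "g (restrict x B) = g x"
      using depends_onD[OF assms(4), of "restrict x A" x] depends_onD[OF assms(5), of "restrict x B" x]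
      by auto
    moreover have "spin_weight (A \<union> B) \<rho> x = spin_weight A \<rho> (restrict x A) * spin_weight B \<rho> (restrict x B)"
      unfolding spin_weight_def using assms(1-3) by (subst prod.union_disjoint) auto
    ultimately show "(case (restrict x A, restrict x B) of (a, b) \<Rightarrow>
        (spin_weight A \<rho> a * f a) * (spin_weight B \<rho> b * g b)) = spin_weight (A \<union> B) \<rho> x * (f x * g x)"
      by simp
  next
    fix p assume p: "p \<in> ?S A \<times> ?S B"
    then obtain a b where ab: "p = (a, b)" "a \<in> ?S A" "b \<in> ?S B" by auto
    show "?m p \<in> ?S (A \<union> B)" using ab by (auto simp: PiE_iff extensional_def)
    show "(restrict (?m p) A, restrict (?m p) B) = p"
      using ab assms(3) by (auto simp: fun_eq_iff PiE_iff extensional_def restrict_def)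
  qed
  also have "\<dots> = spin_mean A \<rho> f * spin_mean B \<rho> g"
    unfolding spin_mean_def sum_product sum.cartesian_product ..
  finally show ?thesis .
qed

lemma spin_mean_restrict:
  assumes "finite \<Lambda>" "A \<subseteq> \<Lambda>" "depends_on A f"
  shows "spin_mean \<Lambda> \<rho> f = spin_mean A \<rho> f"
proof -
  have "finite A" using assms finite_subset by blast
  have "spin_mean (A \<union> (\<Lambda> - A)) \<rho> (\<lambda>x. f x * (\<lambda>_. 1) x) = spin_mean A \<rho> f * spin_mean (\<Lambda> - A) \<rho> (\<lambda>_. 1)"
    using assms \<open>finite A\<close> by (intro spin_mean_Un) (auto simp: depends_on_def)
  moreover have "A \<union> (\<Lambda> - A) = \<Lambda>" using assms by blast
  ultimately show ?thesis using assms by (simp add: spin_mean_const)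
qed

lemma spin_mean_indep:
  assumes "finite \<Lambda>" "A \<subseteq> \<Lambda>" "B \<subseteq> \<Lambda>" "A \<inter> B = {}" "depends_on A f" "depends_on B g"
  shows "spin_mean \<Lambda> \<rho> (\<lambda>x. f x * g x) = spin_mean \<Lambda> \<rho> f * spin_mean \<Lambda> \<rho> g"
proof -
  have fin: "finite A" "finite B" using assms finite_subset by blast+
  have "depends_on (A \<union> B) (\<lambda>x. f x * g x)"
    using assms(5,6) unfolding depends_on_def by (metis UnI1 UnI2)
  then have "spin_mean \<Lambda> \<rho> (\<lambda>x. f x * g x) = spin_mean (A \<union> B) \<rho> (\<lambda>x. f x * g x)"
    using assms by (intro spin_mean_restrict) auto
  also have "\<dots> = spin_mean A \<rho> f * spin_mean B \<rho> g"
    using assms fin by (intro spin_mean_Un)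
  also have "\<dots> = spin_mean \<Lambda> \<rho> f * spin_mean \<Lambda> \<rho> g"
    using assms by (metis spin_mean_restrict)
  finally show ?thesis .
qed

text \<open>At density 1 or -1 every configuration with a wrong spin has a vanishing factor, so the
  measure is a point mass. This makes the product structure exact at time 0 and gives the sign of
  the reaction function at both endpoints.\<close>

lemma spin_mean_extreme:
  assumes "finite \<Lambda>" "b = -1 \<or> b = 1"
  shows "spin_mean \<Lambda> (of_int b) g = g (\<lambda>u\<in>\<Lambda>. b)"
proof -
  have "spin_mean \<Lambda> (of_int b) g = (\<Sum>x\<in>{\<lambda>u\<in>\<Lambda>. b}. spin_weight \<Lambda> (of_int b) x * g x)"
    unfolding spin_mean_def
  proof (rule sum.mono_neutral_right)
    show "\<forall>x\<in>(\<Lambda> \<rightarrow>\<^sub>E {-1, 1}) - {\<lambda>u\<in>\<Lambda>. b}. spin_weight \<Lambda> (of_int b) x * g x = 0"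
    proof
      fix x assume x: "x \<in> (\<Lambda> \<rightarrow>\<^sub>E {-1, 1}) - {\<lambda>u\<in>\<Lambda>. b}"
      have "\<exists>u\<in>\<Lambda>. x u \<noteq> b" using x by (force simp: fun_eq_iff PiE_iff extensional_def)
      then obtain u where "u \<in> \<Lambda>" "x u \<noteq> b" by blast
      moreover have "x u = -1 \<or> x u = 1" using x \<open>u \<in> \<Lambda>\<close> by (auto simp: PiE_iff)
      ultimately have "(1 + of_int b * real_of_int (x u)) / 2 = 0" using assms(2) by auto
      hence "spin_weight \<Lambda> (of_int b) x = 0" using \<open>u \<in> \<Lambda>\<close> assms(1)
        unfolding spin_weight_def by (subst prod_zero_iff) blast+
      thus "spin_weight \<Lambda> (of_int b) x * g x = 0" by simp
    qed
  qed (use assms finite_spins in auto)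
  moreover have "spin_weight \<Lambda> (of_int b) (\<lambda>u\<in>\<Lambda>. b) = 1"
    unfolding spin_weight_def by (rule prod.neutral) (use assms(2) in auto)
  ultimately show ?thesis by simp
qed

lemma spin_mean_component:
  assumes "finite \<Lambda>" "u \<in> \<Lambda>"
  shows "spin_mean \<Lambda> \<rho> (\<lambda>x. of_int (x u)) = \<rho>"
proof -
  have "spin_mean \<Lambda> \<rho> (\<lambda>x. of_int (x u)) = spin_mean {u} \<rho> (\<lambda>x. of_int (x u))"
    using assms by (intro spin_mean_restrict) (auto simp: depends_on_def)
  also have "\<dots> = (\<Sum>x\<in>{u} \<rightarrow>\<^sub>E {-1, 1}. (\<Prod>v\<in>{u}. (1 + \<rho> * of_int (x v)) / 2 * of_int (x v)))"
    unfolding spin_mean_def spin_weight_def by simp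
  also have "\<dots> = (\<Prod>v\<in>{u}. \<Sum>b\<in>{-1, 1::int}. (1 + \<rho> * of_int b) / 2 * of_int b)"
    by (rule prod_sum_PiE[symmetric]) auto
  also have "\<dots> = \<rho>" by (simp add: field_simps)
  finally show ?thesis .
qed

text \<open>Russo's formula.\<close>

lemma spin_mean_deriv:
  assumes "finite \<Lambda>"
  shows "((\<lambda>\<rho>. spin_mean \<Lambda> \<rho> g) has_real_derivative (\<Sum>u\<in>\<Lambda>. spin_mean \<Lambda> \<rho> (half_diff u g))) (at \<rho>)"
proof -
  let ?S = "\<Lambda> \<rightarrow>\<^sub>E {-1, 1::int}"
  define W where "W u x = (\<Prod>v\<in>\<Lambda> - {u}. (1 + \<rho> * of_int (x v)) / 2)" for u and x :: "'a \<Rightarrow> int"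
  have "((\<lambda>\<rho>. spin_mean \<Lambda> \<rho> g) has_real_derivative
      (\<Sum>x\<in>?S. (\<Sum>u\<in>\<Lambda>. of_int (x u) / 2 * W u x) * g x)) (at \<rho>)"
    unfolding spin_mean_def spin_weight_def W_def
  proof (intro DERIV_sum)
    fix x :: "'a \<Rightarrow> int" assume "x \<in> ?S"
    have "((\<lambda>\<rho>. \<Prod>u\<in>\<Lambda>. (1 + \<rho> * of_int (x u)) / 2) has_real_derivative
        (\<Sum>u\<in>\<Lambda>. of_int (x u) / 2 * (\<Prod>v\<in>\<Lambda> - {u}. (1 + \<rho> * of_int (x v)) / 2))) (at \<rho>)"
      by (rule has_field_derivative_prod) (auto intro!: derivative_eq_intros)
    thus "((\<lambda>\<rho>. (\<Prod>u\<in>\<Lambda>. (1 + \<rho> * of_int (x u)) / 2) * g x) has_real_derivative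
        (\<Sum>u\<in>\<Lambda>. of_int (x u) / 2 * (\<Prod>v\<in>\<Lambda> - {u}. (1 + \<rho> * of_int (x v)) / 2)) * g x) (at \<rho>)"
      by (rule DERIV_cmult_right)
  qed
  moreover have "(\<Sum>x\<in>?S. (\<Sum>u\<in>\<Lambda>. of_int (x u) / 2 * W u x) * g x) =
      (\<Sum>u\<in>\<Lambda>. \<Sum>x\<in>?S. of_int (x u) / 2 * W u x * g x)"
    by (subst sum.swap) (simp add: sum_distrib_right)
  moreover have "(\<Sum>x\<in>?S. of_int (x u) / 2 * W u x * g x) = spin_mean \<Lambda> \<rho> (half_diff u g)"
    if u: "u \<in> \<Lambda>" for u
  proof -
    \<comment> \<open>Both sums are symmetrised under the flip at \<open>u\<close>:
      \<open>W u\<close> and the half difference ignore that spin, so the two sides agree orbit by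
      orbit.\<close>
    let ?f = "\<lambda>x. x(u := - x u)"
    let ?l = "\<lambda>x. of_int (x u) / 2 * W u x * g x" and ?r = "\<lambda>x. spin_weight \<Lambda> \<rho> x * half_diff u g x"
    have fS: "?f x \<in> ?S" if "x \<in> ?S" for x
      using that u PiE_spin_cases[OF that u] by (intro spin_upd) auto
    have flp: "sum F ?S = (\<Sum>x\<in>?S. F (?f x))" for F :: "('a \<Rightarrow> int) \<Rightarrow> real"
      by (rule sum.reindex_bij_witness[where i = ?f and j = ?f]) (use fS in auto)
    have "2 * sum ?l ?S = (\<Sum>x\<in>?S. ?l x + ?l (?f x))"
      unfolding sum.distrib flp[of ?l, symmetric] by (rule mult_2)
    also have "\<dots> = (\<Sum>x\<in>?S. ?r x + ?r (?f x))"
    proof (rule sum.cong)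
      fix x assume x: "x \<in> ?S"
      have W: "W u (?f x) = W u x" unfolding W_def by (rule prod.cong) auto
      have sw: "spin_weight \<Lambda> \<rho> y = (1 + \<rho> * of_int (y u)) / 2 * W u y" for y
        unfolding spin_weight_def W_def by (rule prod.remove[OF assms u])
      have hd: "half_diff u g (?f x) = half_diff u g x" by (simp add: half_diff_def)
      have xu: "x u = -1 \<or> x u = 1" using PiE_spin_cases[OF x u] .
      have "of_int (x u) / 2 * g x + of_int (?f x u) / 2 * g (?f x) = half_diff u g x"
      proof (cases "x u = 1")
        case True
        hence "x(u := 1) = x" by auto
        thus ?thesis using True by (simp add: half_diff_def diff_divide_distrib)
      next
        case False
        hence "x u = -1" using xu by auto
        moreover hence "x(u := -1) = x" by auto
        ultimately show ?thesis by (simp add: half_diff_def diff_divide_distrib)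
      qed
      moreover have "?l x + ?l (?f x) = W u x * (of_int (x u) / 2 * g x + of_int (?f x u) / 2 * g (?f x))"
        unfolding W by (simp add: algebra_simps)
      ultimately have "?l x + ?l (?f x) = W u x * half_diff u g x" by simp
      moreover have "?r x + ?r (?f x) = W u x * half_diff u g x"
        unfolding sw hd W by (simp add: field_simps)
      ultimately show "?l x + ?l (?f x) = ?r x + ?r (?f x)" by simp
    qed auto
    also have "\<dots> = 2 * sum ?r ?S"
      unfolding sum.distrib flp[of ?r, symmetric] by (rule mult_2[symmetric])
    finally show ?thesis by (simp add: spin_mean_def)
  qed
  ultimately show ?thesis by simp
qed

section \<open>Monotone coupling by random maps\<close>

definition sw :: "'a \<Rightarrow> 'a \<Rightarrow> 'a \<Rightarrow> 'a" where
  "sw p q u = (if u = p then q else if u = q then p else u)"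

lemma sw_sw [simp]: "sw p q (sw p q u) = u"
  by (auto simp: sw_def)

lemma inj_sw: "inj (sw p q)"
  by (metis injI sw_sw)

lemma sw_in: "p \<in> A \<Longrightarrow> q \<in> A \<Longrightarrow> sw p q u \<in> A \<longleftrightarrow> u \<in> A"
  by (auto simp: sw_def)

type_synonym 'a event = "('a \<times> 'a) + ('a \<times> bool \<times> real)"

text \<open>The process reduced to what the estimates use: \<open>E\<close> holds ordered pairs,
  each exchanged at rate \<open>\<kappa>\<close>; \<open>nb u\<close> is the dependence set of the
  rate at \<open>u\<close>; \<open>V\<close> and \<open>wt\<close> cut the rates into layers;
  \<open>G\<close> indexes translations, exactly one taking a given site to another.
  \<open>\<psi>\<close> is superharmonic, up to \<open>16 * \<psi>m\<close>, for the exchange motion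
  of two distinct sites, with a unit loss while one lies in the dependence set of the other; 16 is
  the ratio between the constant part of the Laplacian and the supremum bound in the construction on
  the torus.\<close>

locale glauber_exclusion =
  fixes \<Lambda> :: "'a set" and E :: "('a \<times> 'a) set" and \<kappa> :: real
    and nb :: "'a \<Rightarrow> 'a set" and c :: "'a \<Rightarrow> ('a \<Rightarrow> int) \<Rightarrow> real" and R :: "real \<Rightarrow> real"
    and V :: "real set" and wt :: "real \<Rightarrow> real" and cm :: real and b :: nat
    and \<psi> :: "'a \<Rightarrow> 'a \<Rightarrow> real" and \<psi>m :: real
    and G :: "'g set" and tr :: "'g \<Rightarrow> 'a \<Rightarrow> 'a"
  assumes finite_\<Lambda>: "finite \<Lambda>" and \<Lambda>_nonempty: "\<Lambda> \<noteq> {}"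
    and E_sub: "E \<subseteq> \<Lambda> \<times> \<Lambda>" and \<kappa>_nonneg: "\<kappa> \<ge> 0"
    and nb_sub: "u \<in> \<Lambda> \<Longrightarrow> nb u \<subseteq> \<Lambda>" and nb_self: "u \<in> \<Lambda> \<Longrightarrow> u \<in> nb u"
    and card_nb: "u \<in> \<Lambda> \<Longrightarrow> card (nb u) \<le> b"
    and c_local: "u \<in> \<Lambda> \<Longrightarrow> depends_on (nb u) (c u)"
    and finite_V: "finite V" and wt_nonneg: "\<theta> \<in> V \<Longrightarrow> wt \<theta> \<ge> 0" and sum_wt: "sum wt V = cm"
    and c_layers: "u \<in> \<Lambda> \<Longrightarrow> x \<in> \<Lambda> \<rightarrow>\<^sub>E {-1, 1} \<Longrightarrow> (\<Sum>\<theta>\<in>V. if \<theta> \<le> c u x then wt \<theta> else 0) = c u x"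
    and c_attractive: "u \<in> \<Lambda> \<Longrightarrow> x \<in> \<Lambda> \<rightarrow>\<^sub>E {-1, 1} \<Longrightarrow> y \<in> \<Lambda> \<rightarrow>\<^sub>E {-1, 1} \<Longrightarrow>
      (\<And>v. v \<in> \<Lambda> \<Longrightarrow> x v \<le> y v) \<Longrightarrow>
      (x u = 1 \<and> y u = 1 \<longrightarrow> c u x \<ge> c u y) \<and> (x u = -1 \<and> y u = -1 \<longrightarrow> c u x \<le> c u y)"
    and R: "u \<in> \<Lambda> \<Longrightarrow> spin_mean \<Lambda> \<rho> (\<lambda>x. - 2 * of_int (x u) * c u x) = R \<rho>"
    and \<psi>_bounds: "u \<in> \<Lambda> \<Longrightarrow> v \<in> \<Lambda> \<Longrightarrow> 0 \<le> \<psi> u v \<and> \<psi> u v \<le> \<psi>m" and \<psi>m_pos: "\<psi>m > 0"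
    and \<psi>_super: "u \<in> \<Lambda> \<Longrightarrow> v \<in> \<Lambda> \<Longrightarrow> u \<noteq> v \<Longrightarrow>
      \<kappa> * (\<Sum>(p, q)\<in>E. \<psi> (sw p q u) (sw p q v) - \<psi> u v) \<le> 16 * \<psi>m - (if v \<in> nb u then 1 else 0)"
    and tr_bij: "g \<in> G \<Longrightarrow> bij_betw (tr g) \<Lambda> \<Lambda>"
    and tr_transitive: "a \<in> \<Lambda> \<Longrightarrow> bij_betw (\<lambda>g. tr g a) G \<Lambda>"
    and tr_E: "g \<in> G \<Longrightarrow> (u, v) \<in> E \<Longrightarrow> (tr g u, tr g v) \<in> E"
    and tr_c: "g \<in> G \<Longrightarrow> u \<in> \<Lambda> \<Longrightarrow> c (tr g u) x = c u (x \<circ> tr g)"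
begin

abbreviation spins :: "('a \<Rightarrow> int) set" where "spins \<equiv> \<Lambda> \<rightarrow>\<^sub>E {-1, 1}"

definition events :: "'a event set" where
  "events = E <+> (\<Lambda> \<times> (UNIV \<times> V))"

fun rate :: "'a event \<Rightarrow> real" where
  "rate (Inl _) = \<kappa>"
| "rate (Inr (u, up, \<theta>)) = wt \<theta>"

text \<open>
  The flip rate is split into layers \<open>wt \<theta>\<close>, one for each threshold \<open>\<theta> \<le> c u x\<close>; letting all copies of
  the process read the same event then couples them monotonically.
\<close>

fun act :: "'a event \<Rightarrow> ('a \<Rightarrow> int) \<Rightarrow> 'a \<Rightarrow> int" where
  "act (Inl (p, q)) x = x \<circ> sw p q"
| "act (Inr (u, up, \<theta>)) x =
    (if \<theta> \<le> c u x \<and> x u = (if up then -1 else 1) then x(u := - x u) else x)"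

definition total_rate :: real where "total_rate = sum rate events"

definition net_rate :: "'a \<Rightarrow> ('a \<Rightarrow> int) \<Rightarrow> real" where
  "net_rate u x = - 2 * of_int (x u) * c u x"

lemma rate_Inr: "rate (Inr (u, i)) = wt (snd i)"
  by (cases i) simp

lemma finite_E: "finite E" using finite_\<Lambda> E_sub by (meson finite_SigmaI finite_subset)
lemma finite_events: "finite events" unfolding events_def using finite_E finite_\<Lambda> finite_V by auto
lemma finite_nb: "u \<in> \<Lambda> \<Longrightarrow> finite (nb u)" using nb_sub finite_\<Lambda> finite_subset by blast

lemma sum_events:
  "(\<Sum>e\<in>events. f e) = (\<Sum>pq\<in>E. f (Inl pq)) + (\<Sum>u\<in>\<Lambda>. \<Sum>i\<in>UNIV \<times> V. f (Inr (u, i)))"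
  unfolding events_def using finite_E finite_\<Lambda> finite_V
  by (subst sum.Plus) (auto simp: sum.cartesian_product o_def)

lemma rate_nonneg: "e \<in> events \<Longrightarrow> rate e \<ge> 0"
  unfolding events_def using \<kappa>_nonneg wt_nonneg by (auto split: prod.splits)

lemma total_rate_nonneg: "total_rate \<ge> 0"
  unfolding total_rate_def by (intro sum_nonneg rate_nonneg)

lemma cm_nonneg: "cm \<ge> 0"
  using sum_nonneg[of V wt] wt_nonneg sum_wt by simp

lemma c_bounds: "u \<in> \<Lambda> \<Longrightarrow> x \<in> spins \<Longrightarrow> 0 \<le> c u x \<and> c u x \<le> cm"
proof -
  assume ux: "u \<in> \<Lambda>" "x \<in> spins"
  have "0 \<le> (\<Sum>\<theta>\<in>V. if \<theta> \<le> c u x then wt \<theta> else 0)"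
    using wt_nonneg by (intro sum_nonneg) simp
  moreover have "(\<Sum>\<theta>\<in>V. if \<theta> \<le> c u x then wt \<theta> else 0) \<le> sum wt V"
    using wt_nonneg by (intro sum_mono) simp
  ultimately show ?thesis unfolding c_layers[OF ux] sum_wt by (rule conjI)
qed

lemma net_rate_bound: "u \<in> \<Lambda> \<Longrightarrow> x \<in> spins \<Longrightarrow> \<bar>net_rate u x\<bar> \<le> 2 * cm"
  using c_bounds[of u x] PiE_spin_cases[of x \<Lambda> u] by (auto simp: net_rate_def)

lemma net_rate_local: "u \<in> \<Lambda> \<Longrightarrow> depends_on (nb u) (net_rate u)"
  using c_local nb_self unfolding depends_on_def net_rate_def by metis

lemma act_spins:
  assumes "e \<in> events" "x \<in> spins"
  shows "act e x \<in> spins"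
proof (cases e)
  case (Inl pq)
  obtain p q where pq: "pq = (p, q)" by force
  then have "p \<in> \<Lambda>" "q \<in> \<Lambda>" using assms(1) Inl E_sub by (auto simp: events_def)
  then show ?thesis using assms(2) sw_in[of p \<Lambda> q] by (auto simp: Inl pq PiE_iff extensional_def)
next
  case (Inr t)
  obtain u up \<theta> where t: "t = (u, up, \<theta>)" by (metis prod.exhaust)
  then have "u \<in> \<Lambda>" using assms(1) Inr by (auto simp: events_def)
  then have "x(u := - x u) \<in> spins"
    using PiE_spin_cases[OF assms(2), of u] by (intro spin_upd[OF assms(2)]) auto
  then show ?thesis using assms(2)
    by (cases "\<theta> \<le> c u x \<and> x u = (if up then -1 else 1)") (simp_all only: Inr t act.simps if_True if_False simp_thms)
qed

text \<open>Each flip event has a fixed direction \<open>up\<close>, so at a site where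
  \<open>x\<close> is -1 and \<open>y\<close> is 1 it can only close the gap, never cross it. Where
  the spins agree, attractiveness nests the layers: at a common 1 the lower copy flips whenever the
  upper one does, at a common -1 the upper whenever the lower does.\<close>

lemma act_mono:
  assumes e: "e \<in> events" and x: "x \<in> spins" and y: "y \<in> spins"
    and le: "\<And>v. v \<in> \<Lambda> \<Longrightarrow> x v \<le> y v" and v: "v \<in> \<Lambda>"
  shows "act e x v \<le> act e y v"
proof (cases e)
  case (Inl pq)
  obtain p q where pq: "pq = (p, q)" by force
  then have "p \<in> \<Lambda>" "q \<in> \<Lambda>" using e Inl E_sub by (auto simp: events_def)
  then show ?thesis using le v sw_in[of p \<Lambda> q] by (auto simp: Inl pq)
next
  case (Inr t)
  obtain u up \<theta> where t: "t = (u, up, \<theta>)" by (metis prod.exhaust)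
  then have u: "u \<in> \<Lambda>" using e Inr by (auto simp: events_def)
  have att: "x u = 1 \<and> y u = 1 \<longrightarrow> c u x \<ge> c u y" "x u = -1 \<and> y u = -1 \<longrightarrow> c u x \<le> c u y"
    using c_attractive[OF u x y] le by auto
  show ?thesis
  proof (cases "v = u")
    case True
    show ?thesis
      using att le[OF u] PiE_spin_cases[OF x u] PiE_spin_cases[OF y u] by (auto simp: Inr t True)
  next
    case False
    then show ?thesis using le[OF v] by (simp add: Inr t)
  qed
qed

text \<open>For given \<open>x u\<close> only one direction acts, and the layers up to
  \<open>c u x\<close> have total weight \<open>c u x\<close>, so the flip rate is recovered. Stated
  in a real vector space to serve both real observables and complex eigenfunctions.\<close>

lemma act_update_sum:
  fixes f :: "('a \<Rightarrow> int) \<Rightarrow> 'b::real_vector"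
  assumes u: "u \<in> \<Lambda>" and x: "x \<in> spins"
  shows "(\<Sum>i\<in>UNIV \<times> V. rate (Inr (u, i)) *\<^sub>R (f (act (Inr (u, i)) x) - f x)) =
    c u x *\<^sub>R (f (x(u := - x u)) - f x)"
proof -
  define D where "D = f (x(u := - x u)) - f x"
  have "(\<Sum>i\<in>UNIV \<times> V. rate (Inr (u, i)) *\<^sub>R (f (act (Inr (u, i)) x) - f x)) =
      (\<Sum>up\<in>UNIV. \<Sum>\<theta>\<in>V. if \<theta> \<le> c u x \<and> x u = (if up then -1 else 1) then wt \<theta> *\<^sub>R D else 0)"
    unfolding sum.cartesian_product by (intro sum.cong) (auto simp: D_def)
  also have "\<dots> = (\<Sum>\<theta>\<in>V. if \<theta> \<le> c u x then wt \<theta> *\<^sub>R D else 0)"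
    using PiE_spin_cases[OF x u] by (auto simp: UNIV_bool)
  also have "\<dots> = (\<Sum>\<theta>\<in>V. (if \<theta> \<le> c u x then wt \<theta> else 0) *\<^sub>R D)"
    by (intro sum.cong) auto
  also have "\<dots> = c u x *\<^sub>R D" unfolding scaleR_left.sum[symmetric] c_layers[OF u x] ..
  finally show ?thesis unfolding D_def .
qed

lemma rate_update_sum: "(\<Sum>i\<in>UNIV \<times> V. rate (Inr (u, i))) = 2 * cm"
proof -
  have "(\<Sum>i\<in>UNIV \<times> V. rate (Inr (u, i))) = (\<Sum>up\<in>(UNIV :: bool set). \<Sum>\<theta>\<in>V. wt \<theta>)"
    unfolding sum.cartesian_product by (intro sum.cong) auto
  thus ?thesis by (simp add: sum_wt)
qed

text \<open>
  A state carries copies of the process indexed by \<open>nat\<close>: the copies \<open>0\<close> and \<open>1\<close> form the discrepant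
  pair, and the copies \<open>3\<close> and \<open>2\<close> sandwich them.
\<close>

definition good :: "(nat \<Rightarrow> 'a \<Rightarrow> int) \<Rightarrow> bool" where
  "good s \<longleftrightarrow> (\<forall>i. s i \<in> spins) \<and> (\<forall>u\<in>\<Lambda>. s 3 u \<le> s 0 u \<and> s 0 u \<le> s 1 u \<and> s 1 u \<le> s 2 u)"

definition acts :: "'a event \<Rightarrow> (nat \<Rightarrow> 'a \<Rightarrow> int) \<Rightarrow> nat \<Rightarrow> 'a \<Rightarrow> int" where
  "acts e s = (\<lambda>i. act e (s i))"

lemma acts_good: "e \<in> events \<Longrightarrow> good s \<Longrightarrow> good (acts e s)"
  unfolding good_def acts_def using act_spins act_mono by simp

definition shift :: "'g \<Rightarrow> (nat \<Rightarrow> 'a \<Rightarrow> int) \<Rightarrow> nat \<Rightarrow> 'a \<Rightarrow> int" where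
  "shift g s = (\<lambda>i. restrict (s i \<circ> tr g) \<Lambda>)"

lemma tr_in: "g \<in> G \<Longrightarrow> u \<in> \<Lambda> \<Longrightarrow> tr g u \<in> \<Lambda>"
  using tr_bij by (auto simp: bij_betw_def)

lemma shift_good: "g \<in> G \<Longrightarrow> good s \<Longrightarrow> good (shift g s)"
  unfolding good_def shift_def using tr_in by (fastforce simp: PiE_iff)

fun shift_event :: "'g \<Rightarrow> 'a event \<Rightarrow> 'a event" where
  "shift_event g (Inl (p, q)) = Inl (tr g p, tr g q)"
| "shift_event g (Inr (u, i)) = Inr (tr g u, i)"

text \<open>The rates are translation covariant (\<open>tr_c\<close>), so moving the state and
  moving the event amount to the same; with \<open>sum_shift_event\<close> the dynamics commute with
  translations.\<close>

lemma acts_shift: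
  assumes g: "g \<in> G" and e: "e \<in> events" 
  shows "acts e (shift g s) = shift g (acts (shift_event g e) s)"
proof -
  have inj: "inj_on (tr g) \<Lambda>" using tr_bij[OF g] by (simp add: bij_betw_def)
  have "act e (restrict (x \<circ> tr g) \<Lambda>) = restrict (act (shift_event g e) x \<circ> tr g) \<Lambda>" for x
  proof (cases e)
    case (Inl pq)
    obtain p q where pq: "pq = (p, q)" by force
    then have pq': "p \<in> \<Lambda>" "q \<in> \<Lambda>" using e Inl E_sub by (auto simp: events_def)
    have "sw (tr g p) (tr g q) (tr g u) = tr g (sw p q u)" if "u \<in> \<Lambda>" for u
      using inj pq' that by (auto simp: sw_def inj_on_def)
    then show ?thesis using sw_in[OF pq'] by (auto simp: Inl pq fun_eq_iff restrict_def)
  next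
    case (Inr t)
    obtain u up \<theta> where t: "t = (u, up, \<theta>)" by (metis prod.exhaust)
    then have u: "u \<in> \<Lambda>" using e Inr by (auto simp: events_def)
    have "c u (restrict (x \<circ> tr g) \<Lambda>) = c u (x \<circ> tr g)"
      using depends_onD[OF c_local[OF u], of "restrict (x \<circ> tr g) \<Lambda>" "x \<circ> tr g"] nb_sub[OF u]
      by (simp add: subset_iff)
    then have "c u (restrict (x \<circ> tr g) \<Lambda>) = c (tr g u) x" using tr_c[OF g u] by simp
    moreover have "(restrict (x \<circ> tr g) \<Lambda>)(u := - x (tr g u)) = restrict (x(tr g u := - x (tr g u)) \<circ> tr g) \<Lambda>"
      using inj u by (auto simp: fun_eq_iff restrict_def inj_on_def)
    ultimately show ?thesis using u
      by (cases "\<theta> \<le> c (tr g u) x \<and> x (tr g u) = (if up then -1 else 1)")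
        (simp_all only: Inr t act.simps shift_event.simps if_True if_False simp_thms restrict_apply' o_apply)
  qed
  then show ?thesis by (simp add: acts_def shift_def)
qed

lemma sum_shift_event:
  assumes g: "g \<in> G"
  shows "(\<Sum>e\<in>events. rate e * f (shift_event g e)) = (\<Sum>e\<in>events. rate e * f e)"
proof -
  have inj: "inj_on (tr g) \<Lambda>" using tr_bij[OF g] by (simp add: bij_betw_def)
  let ?m = "map_prod (tr g) (tr g)"
  have "inj_on ?m E" using map_prod_inj_on[OF inj inj] E_sub by (rule inj_on_subset)
  moreover have "?m ` E \<subseteq> E" using tr_E[OF g] by auto
  ultimately have m: "bij_betw ?m E E"
    using finite_E by (simp add: bij_betw_def endo_inj_surj)
  have 1: "(\<Sum>pq\<in>E. rate (Inl pq) * f (shift_event g (Inl pq))) = (\<Sum>pq\<in>E. rate (Inl pq) * f (Inl pq))"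
    using sum.reindex_bij_betw[OF m, of "\<lambda>pq. rate (Inl pq) * f (Inl pq)"]
    by (simp add: map_prod_def split_def)
      (metis (no_types, lifting) prod.collapse shift_event.simps(1) sum.cong)
  have 2: "(\<Sum>u\<in>\<Lambda>. \<Sum>i\<in>UNIV \<times> V. rate (Inr (u, i)) * f (shift_event g (Inr (u, i)))) =
      (\<Sum>u\<in>\<Lambda>. \<Sum>i\<in>UNIV \<times> V. rate (Inr (u, i)) * f (Inr (u, i)))"
    using sum.reindex_bij_betw[OF tr_bij[OF g], of "\<lambda>u. \<Sum>i\<in>UNIV \<times> V. rate (Inr (u, i)) * f (Inr (u, i))"]
    by (simp add: rate_Inr)
  show ?thesis unfolding sum_events 1 2 ..
qed

end

section \<open>The discretised coupled chain and its sums over translations\<close>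

locale glauber_exclusion_chain = glauber_exclusion +
  fixes h :: real and s0 :: "nat \<Rightarrow> 'a \<Rightarrow> int"
  assumes h_pos: "h > 0" and h_rate: "h * total_rate \<le> 1"
    and s0_good: "good s0"
    and s0_top: "s0 2 = (\<lambda>u\<in>\<Lambda>. 1)" and s0_bot: "s0 3 = (\<lambda>u\<in>\<Lambda>. -1)"
begin

text \<open>One time step, the identity plus \<open>h\<close> times the generator. The condition
  \<open>h * total_rate \<le> 1\<close> makes it a convex combination, hence monotone.\<close>

definition T :: "((nat \<Rightarrow> 'a \<Rightarrow> int) \<Rightarrow> real) \<Rightarrow> (nat \<Rightarrow> 'a \<Rightarrow> int) \<Rightarrow> real" where
  "T F s = F s + h * (\<Sum>e\<in>events. rate e * (F (acts e s) - F s))"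

text \<open>Summed instead of averaged over translations: \<open>S n (disc a)\<close> is then the
  expected total number of discrepancies, the same for all sites \<open>a\<close>.\<close>

definition S :: "nat \<Rightarrow> ((nat \<Rightarrow> 'a \<Rightarrow> int) \<Rightarrow> real) \<Rightarrow> real" where
  "S n F = (\<Sum>g\<in>G. (T ^^ n) F (shift g s0))"

definition disc :: "'a \<Rightarrow> (nat \<Rightarrow> 'a \<Rightarrow> int) \<Rightarrow> real" where
  "disc a s = (of_int (s 1 a) - of_int (s 0 a)) / 2"

definition discs :: "nat \<Rightarrow> real" where
  "discs n = (\<Sum>a\<in>\<Lambda>. (T ^^ n) (disc a) s0)"

lemma T_eq: "T F s = (1 - h * total_rate) * F s + h * (\<Sum>e\<in>events. rate e * F (acts e s))"
  unfolding T_def total_rate_def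
  by (simp add: right_diff_distrib sum_subtractf sum_distrib_right[symmetric] left_diff_distrib mult.assoc)

lemma T_mono: "(\<And>s. good s \<Longrightarrow> F s \<le> F' s) \<Longrightarrow> good s \<Longrightarrow> T F s \<le> T F' s"
  unfolding T_eq using h_pos h_rate acts_good
  by (intro add_mono mult_left_mono sum_mono rate_nonneg) auto

lemma T_add: "T (\<lambda>s. F s + F' s) = (\<lambda>s. T F s + T F' s)"
  unfolding T_eq by (simp add: fun_eq_iff algebra_simps sum.distrib)

lemma T_cmult: "T (\<lambda>s. a * F s) = (\<lambda>s. a * T F s)"
  unfolding T_eq by (simp add: fun_eq_iff algebra_simps sum_distrib_left)

lemma T_funpow_mono: "(\<And>s. good s \<Longrightarrow> F s \<le> F' s) \<Longrightarrow> good s \<Longrightarrow> (T ^^ n) F s \<le> (T ^^ n) F' s"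
  by (induction n arbitrary: s) (auto intro: T_mono)

lemma T_funpow_add: "(T ^^ n) (\<lambda>s. F s + F' s) = (\<lambda>s. (T ^^ n) F s + (T ^^ n) F' s)"
  by (induction n) (auto simp: T_add)

lemma T_funpow_cmult: "(T ^^ n) (\<lambda>s. a * F s) = (\<lambda>s. a * (T ^^ n) F s)"
  by (induction n) (auto simp: T_cmult)

lemma T_shift:
  assumes "g \<in> G"
  shows "T F (shift g s) = T (\<lambda>s. F (shift g s)) s"
proof -
  have "(\<Sum>e\<in>events. rate e * F (acts e (shift g s))) =
      (\<Sum>e\<in>events. rate e * F (shift g (acts (shift_event g e) s)))"
    using acts_shift[OF assms] by (intro sum.cong) auto
  also have "\<dots> = (\<Sum>e\<in>events. rate e * F (shift g (acts e s)))"
    by (rule sum_shift_event[OF assms, of "\<lambda>e. F (shift g (acts e s))"])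
  finally show ?thesis by (simp add: T_eq)
qed

lemma T_funpow_shift:
  "g \<in> G \<Longrightarrow> (T ^^ n) F (shift g s) = (T ^^ n) (\<lambda>s. F (shift g s)) s"
proof (induction n arbitrary: F)
  case (Suc n)
  have "(\<lambda>s. T F (shift g s)) = T (\<lambda>s. F (shift g s))"
    using T_shift[OF Suc.prems] by (rule ext)
  then show ?case using Suc.IH[OF Suc.prems, of "T F"] by (simp add: funpow_swap1)
qed simp

lemma S_add: "S n (\<lambda>s. F s + F' s) = S n F + S n F'"
  unfolding S_def by (simp add: T_funpow_add sum.distrib)

lemma S_cmult: "S n (\<lambda>s. a * F s) = a * S n F"
  unfolding S_def by (simp add: T_funpow_cmult sum_distrib_left)

lemma S_diff: "S n (\<lambda>s. F s - F' s) = S n F - S n F'"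
  using S_add[of n F "\<lambda>s. -1 * F' s"] S_cmult[of n "-1" F'] by simp

lemma S_zero: "S n (\<lambda>s. 0) = 0"
  using S_cmult[of n 0 "\<lambda>s. 0"] by simp

lemma S_sum: "finite I \<Longrightarrow> S n (\<lambda>s. \<Sum>i\<in>I. F i s) = (\<Sum>i\<in>I. S n (F i))"
  by (induction I rule: finite_induct) (auto simp: S_zero S_add)

lemma S_mono: "(\<And>s. good s \<Longrightarrow> F s \<le> F' s) \<Longrightarrow> S n F \<le> S n F'"
  unfolding S_def by (intro sum_mono T_funpow_mono shift_good s0_good)

lemma S_cong: "(\<And>s. good s \<Longrightarrow> F s = F' s) \<Longrightarrow> S n F = S n F'"
  by (intro antisym S_mono) auto

lemma S_abs_le:
  assumes "\<And>s. good s \<Longrightarrow> \<bar>F s\<bar> \<le> F' s"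
  shows "\<bar>S n F\<bar> \<le> S n F'"
proof -
  have "F s \<le> F' s" "- 1 * F s \<le> F' s" if "good s" for s using assms[OF that] by linarith+
  then have "S n F \<le> S n F'" "S n (\<lambda>s. -1 * F s) \<le> S n F'" by (auto intro!: S_mono)
  thus ?thesis unfolding S_cmult by linarith
qed

lemma S_Suc: "S (Suc n) F = S n (T F)"
  unfolding S_def by (simp add: funpow_swap1)

lemma S_T:
  "S n (T F) = (1 - h * total_rate) * S n F + h * (\<Sum>e\<in>events. rate e * S n (\<lambda>s. F (acts e s)))"
proof -
  have "S n (T F) = S n (\<lambda>s. (1 - h * total_rate) * F s + h * (\<Sum>e\<in>events. rate e * F (acts e s)))"
    by (simp add: T_eq[abs_def])
  thus ?thesis by (simp only: S_add S_cmult S_sum[OF finite_events])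
qed

lemma S_T':
  "S n (T F) = S n F + h * (\<Sum>e\<in>events. rate e * (S n (\<lambda>s. F (acts e s)) - S n F))"
  unfolding S_T total_rate_def
  by (simp add: right_diff_distrib sum_subtractf sum_distrib_right[symmetric] left_diff_distrib mult.assoc)

lemma S_disc:
  assumes "a \<in> \<Lambda>"
  shows "S n (disc a) = discs n"
proof -
  have "S n (disc a) = (\<Sum>g\<in>G. (T ^^ n) (disc (tr g a)) s0)"
  proof -
    have "(\<lambda>s. disc a (shift g s)) = disc (tr g a)" for g
      using assms by (simp add: fun_eq_iff disc_def shift_def)
    thus ?thesis unfolding S_def using T_funpow_shift by simp
  qed
  also have "\<dots> = discs n" unfolding discs_def
    using sum.reindex_bij_betw[OF tr_transitive[OF assms], of "\<lambda>u. (T ^^ n) (disc u) s0"] .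
  finally show ?thesis .
qed

lemma disc_bounds: "good s \<Longrightarrow> a \<in> \<Lambda> \<Longrightarrow> 0 \<le> disc a s \<and> disc a s \<le> 1"
  unfolding good_def disc_def using PiE_spin_cases[of "s 0" \<Lambda> a] PiE_spin_cases[of "s 1" \<Lambda> a] by force

lemma disc_eq_1: "good s \<Longrightarrow> a \<in> \<Lambda> \<Longrightarrow> s 0 a \<noteq> s 1 a \<Longrightarrow> disc a s = 1"
  unfolding good_def disc_def using PiE_spin_cases[of "s 0" \<Lambda> a] PiE_spin_cases[of "s 1" \<Lambda> a] by force

lemma discs_nonneg: "discs n \<ge> 0"
proof -
  obtain a where a: "a \<in> \<Lambda>" using \<Lambda>_nonempty by blast
  have "S n (\<lambda>s. 0) \<le> S n (disc a)" by (rule S_mono) (use disc_bounds a in auto)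
  thus ?thesis using S_disc[OF a] S_zero by simp
qed

lemma S_disc_bound:
  assumes "A \<subseteq> \<Lambda>" "\<And>s. good s \<Longrightarrow> \<bar>F s\<bar> \<le> K * (\<Sum>a\<in>A. disc a s)"
  shows "\<bar>S n F\<bar> \<le> K * card A * discs n"
proof -
  have "finite A" using assms(1) finite_\<Lambda> finite_subset by blast
  have "\<bar>S n F\<bar> \<le> S n (\<lambda>s. K * (\<Sum>a\<in>A. disc a s))" by (rule S_abs_le) (use assms in auto)
  also have "\<dots> = K * card A * discs n"
    using assms(1) by (simp add: S_cmult S_sum[OF \<open>finite A\<close>] S_disc subset_iff)
  finally show ?thesis .
qed

text \<open>Either the pair agrees on \<open>nb u\<close> and the rates coincide, or at least one
  discrepancy is present and twice the crude bound \<open>2 * cm\<close> is paid.\<close>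

lemma net_rate_lipschitz:
  assumes s: "good s" and u: "u \<in> \<Lambda>"
  shows "\<bar>net_rate u (s 1) - net_rate u (s 0)\<bar> \<le> 4 * cm * (\<Sum>a\<in>nb u. disc a s)"
proof (cases "\<forall>a\<in>nb u. s 0 a = s 1 a")
  case True
  then have "net_rate u (s 1) = net_rate u (s 0)"
    by (intro depends_onD[OF net_rate_local[OF u], of "s 1" "s 0"]) auto
  moreover have "(\<Sum>a\<in>nb u. disc a s) \<ge> 0"
    using disc_bounds[OF s] nb_sub[OF u] by (intro sum_nonneg) auto
  ultimately show ?thesis using cm_nonneg by simp
next
  case False
  then obtain a where a: "a \<in> nb u" "s 0 a \<noteq> s 1 a" by blast
  then have "disc a s = 1" using disc_eq_1[OF s, of a] nb_sub[OF u] by blast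
  then have "1 \<le> (\<Sum>a\<in>nb u. disc a s)"
    using member_le_sum[OF a(1), of "\<lambda>a. disc a s"] disc_bounds[OF s] nb_sub[OF u] finite_nb[OF u] by auto
  then have "4 * cm * 1 \<le> 4 * cm * (\<Sum>a\<in>nb u. disc a s)"
    using cm_nonneg by (intro mult_left_mono) auto
  moreover have "\<bar>net_rate u (s 1)\<bar> \<le> 2 * cm" "\<bar>net_rate u (s 0)\<bar> \<le> 2 * cm"
    using s net_rate_bound[OF u] by (auto simp: good_def)
  ultimately show ?thesis by linarith
qed

text \<open>Exchanges only move discrepancies, and the sum over translations does not see where they
  are. So only flips at \<open>a\<close> contribute, through the drift \<open>net_rate\<close> of
  the spin at \<open>a\<close> in the two copies.\<close>

lemma discs_Suc:
  assumes a: "a \<in> \<Lambda>"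
  shows "discs (Suc n) = discs n + h * S n (\<lambda>s. (net_rate a (s 1) - net_rate a (s 0)) / 2)"
proof -
  have swap: "S n (\<lambda>s. disc a (acts (Inl pq) s)) = S n (disc a)" if "pq \<in> E" for pq
  proof -
    obtain p q where "pq = (p, q)" by force
    moreover from this have "p \<in> \<Lambda>" "q \<in> \<Lambda>" using that E_sub by auto
    ultimately have pq: "pq = (p, q)" "p \<in> \<Lambda>" "q \<in> \<Lambda>" by auto
    have "(\<lambda>s. disc a (acts (Inl pq) s)) = disc (sw p q a)"
      by (simp add: fun_eq_iff disc_def acts_def pq)
    thus ?thesis using S_disc a sw_in[OF pq(2,3)] by simp
  qed
  have other: "S n (\<lambda>s. disc a (acts (Inr (u, i)) s)) = S n (disc a)" if "u \<noteq> a" for u i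
  proof -
    have "(\<lambda>s. disc a (acts (Inr (u, i)) s)) = disc a"
      using that by (cases i) (auto simp: fun_eq_iff disc_def acts_def)
    thus ?thesis by simp
  qed
  have fin: "finite (UNIV \<times> V :: (bool \<times> real) set)" using finite_V by simp
  have "(\<Sum>i\<in>UNIV \<times> V. rate (Inr (a, i)) * (S n (\<lambda>s. disc a (acts (Inr (a, i)) s)) - S n (disc a))) =
      S n (\<lambda>s. \<Sum>i\<in>UNIV \<times> V. rate (Inr (a, i)) * (disc a (acts (Inr (a, i)) s) - disc a s))"
    unfolding S_sum[OF fin] S_cmult S_diff ..
  also have "\<dots> = S n (\<lambda>s. (net_rate a (s 1) - net_rate a (s 0)) / 2)"
  proof (rule S_cong)
    fix s assume "good s"
    then have s: "s 0 \<in> spins" "s 1 \<in> spins" by (auto simp: good_def)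
    let ?f = "\<lambda>x. of_int (x a) / 2 :: real"
    have "(\<Sum>i\<in>UNIV \<times> V. rate (Inr (a, i)) * (disc a (acts (Inr (a, i)) s) - disc a s)) =
        (\<Sum>i\<in>UNIV \<times> V. rate (Inr (a, i)) *\<^sub>R (?f (act (Inr (a, i)) (s 1)) - ?f (s 1))) -
        (\<Sum>i\<in>UNIV \<times> V. rate (Inr (a, i)) *\<^sub>R (?f (act (Inr (a, i)) (s 0)) - ?f (s 0)))"
      unfolding sum_subtractf[symmetric] disc_def acts_def
      by (intro sum.cong) (auto simp: field_simps)
    also have "\<dots> = (net_rate a (s 1) - net_rate a (s 0)) / 2"
      unfolding act_update_sum[OF a s(1), of ?f] act_update_sum[OF a s(2), of ?f] net_rate_def
      by (simp add: field_simps)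
    finally show "(\<Sum>i\<in>UNIV \<times> V. rate (Inr (a, i)) * (disc a (acts (Inr (a, i)) s) - disc a s)) =
        (net_rate a (s 1) - net_rate a (s 0)) / 2" .
  qed
  finally have upd: "(\<Sum>i\<in>UNIV \<times> V. rate (Inr (a, i)) *
      (S n (\<lambda>s. disc a (acts (Inr (a, i)) s)) - S n (disc a))) =
      S n (\<lambda>s. (net_rate a (s 1) - net_rate a (s 0)) / 2)" .
  have "(\<Sum>e\<in>events. rate e * (S n (\<lambda>s. disc a (acts e s)) - S n (disc a))) =
      (\<Sum>u\<in>\<Lambda>. if u = a then S n (\<lambda>s. (net_rate a (s 1) - net_rate a (s 0)) / 2) else 0)"
  proof -
    have "(\<Sum>pq\<in>E. rate (Inl pq) * (S n (\<lambda>s. disc a (acts (Inl pq) s)) - S n (disc a))) = 0"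
      by (rule sum.neutral) (simp add: swap)
    moreover have "(\<Sum>i\<in>UNIV \<times> V. rate (Inr (u, i)) * (S n (\<lambda>s. disc a (acts (Inr (u, i)) s)) - S n (disc a))) =
        (if u = a then S n (\<lambda>s. (net_rate a (s 1) - net_rate a (s 0)) / 2) else 0)" for u
      using upd by (cases "u = a") (simp_all only: other if_True if_False simp_thms, simp)
    ultimately show ?thesis unfolding sum_events by simp
  qed
  also have "\<dots> = S n (\<lambda>s. (net_rate a (s 1) - net_rate a (s 0)) / 2)"
    using a finite_\<Lambda> by simp
  finally show ?thesis unfolding S_disc[OF a, symmetric] S_Suc S_T' by simp
qed

text \<open>A priori branching bound: a site responds only to discrepancies in its dependence set,
  of size at most \<open>b\<close>. It serves the burn-in, where no contraction is available, and
  the comparison with \<open>decor\<close>.\<close>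

lemma discs_growth: "discs n \<le> (1 + h * (2 * cm * b)) ^ n * discs 0"
proof (induction n)
  case (Suc n)
  obtain a where a: "a \<in> \<Lambda>" using \<Lambda>_nonempty by blast
  have "\<bar>S n (\<lambda>s. (net_rate a (s 1) - net_rate a (s 0)) / 2)\<bar> \<le> 2 * cm * card (nb a) * discs n"
  proof (rule S_disc_bound[OF nb_sub[OF a]])
    fix s assume "good s"
    from net_rate_lipschitz[OF this a]
    show "\<bar>(net_rate a (s 1) - net_rate a (s 0)) / 2\<bar> \<le> 2 * cm * (\<Sum>a\<in>nb a. disc a s)"
      by (simp add: abs_divide)
  qed
  also have "\<dots> \<le> 2 * cm * b * discs n"
    using card_nb[OF a] cm_nonneg discs_nonneg by (intro mult_right_mono mult_left_mono) auto
  finally have "S n (\<lambda>s. (net_rate a (s 1) - net_rate a (s 0)) / 2) \<le> 2 * cm * b * discs n" by linarith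
  then have "discs (Suc n) \<le> discs n + h * (2 * cm * b * discs n)"
    unfolding discs_Suc[OF a] using h_pos by (intro add_left_mono mult_left_mono) auto
  also have "\<dots> = (1 + h * (2 * cm * b)) * discs n" by (simp add: algebra_simps)
  also have "\<dots> \<le> (1 + h * (2 * cm * b)) * ((1 + h * (2 * cm * b)) ^ n * discs 0)"
    using h_pos cm_nonneg by (intro mult_left_mono Suc.IH) auto
  finally show ?case by (simp add: mult.assoc)
qed simp

end

section \<open>A superharmonic function for nearby sites\<close>

lemma spin_mean_lipschitz:
  fixes \<rho> \<rho>' :: real
  assumes "finite \<Lambda>" "\<rho> \<in> {-1..1}" "\<rho>' \<in> {-1..1}"
    and "\<And>x. x \<in> \<Lambda> \<rightarrow>\<^sub>E {-1, 1} \<Longrightarrow> \<bar>g x\<bar> \<le> 1"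
  shows "\<bar>spin_mean \<Lambda> \<rho>' g - spin_mean \<Lambda> \<rho> g\<bar> \<le> card \<Lambda> * \<bar>\<rho>' - \<rho>\<bar>"
proof -
  have hd: "\<bar>half_diff u g x\<bar> \<le> 1" if "x \<in> \<Lambda> \<rightarrow>\<^sub>E {-1, 1}" "u \<in> \<Lambda>" for u x
    by (rule half_diff_bound[OF assms(4) that(2,1)])
  have "norm (spin_mean \<Lambda> \<rho>' g - spin_mean \<Lambda> \<rho> g) \<le> card \<Lambda> * norm (\<rho>' - \<rho>)"
  proof (rule field_differentiable_bound[where S = "{-1..1::real}"])
    show "((\<lambda>\<rho>. spin_mean \<Lambda> \<rho> g) has_field_derivative (\<Sum>u\<in>\<Lambda>. spin_mean \<Lambda> z (half_diff u g)))
        (at z within {-1..1})" for z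
      using spin_mean_deriv[OF assms(1)] by (rule has_field_derivative_at_within)
    show "norm (\<Sum>u\<in>\<Lambda>. spin_mean \<Lambda> z (half_diff u g)) \<le> card \<Lambda>" if "z \<in> {-1..1}" for z
    proof -
      have "norm (\<Sum>u\<in>\<Lambda>. spin_mean \<Lambda> z (half_diff u g)) \<le> (\<Sum>u\<in>\<Lambda>. 1)"
        by (rule sum_norm_le) (use spin_mean_abs_le[OF assms(1) that] hd in auto)
      thus ?thesis by simp
    qed
  qed (use assms in auto)
  thus ?thesis by simp
qed

text \<open>The Lipschitz bound is applied to every half difference in Russo's formula. The powers
  of \<open>card \<Lambda>\<close> are harmless, since the time step tends to 0 while the torus is
  fixed.\<close>

lemma spin_mean_taylor:
  fixes \<rho> \<rho>' :: real
  assumes "finite \<Lambda>" "\<rho> \<in> {-1..1}" "\<rho>' \<in> {-1..1}"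
    and g: "\<And>x. x \<in> \<Lambda> \<rightarrow>\<^sub>E {-1, 1} \<Longrightarrow> \<bar>g x\<bar> \<le> 1"
  shows "\<bar>spin_mean \<Lambda> \<rho>' g - spin_mean \<Lambda> \<rho> g - (\<rho>' - \<rho>) * (\<Sum>u\<in>\<Lambda>. spin_mean \<Lambda> \<rho> (half_diff u g))\<bar>
    \<le> (card \<Lambda>)\<^sup>2 * (\<rho>' - \<rho>)\<^sup>2"
proof -
  define f where "f z = spin_mean \<Lambda> z g - (z - \<rho>) * (\<Sum>u\<in>\<Lambda>. spin_mean \<Lambda> \<rho> (half_diff u g))" for z
  define I where "I = {min \<rho> \<rho>'..max \<rho> \<rho>'}"
  have hd: "\<bar>half_diff u g x\<bar> \<le> 1" if "x \<in> \<Lambda> \<rightarrow>\<^sub>E {-1, 1}" "u \<in> \<Lambda>" for u x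
    by (rule half_diff_bound[OF g that(2,1)])
  have "norm (f \<rho>' - f \<rho>) \<le> ((card \<Lambda>)\<^sup>2 * \<bar>\<rho>' - \<rho>\<bar>) * norm (\<rho>' - \<rho>)"
  proof (rule field_differentiable_bound[where S = I])
    show "(f has_field_derivative ((\<Sum>u\<in>\<Lambda>. spin_mean \<Lambda> z (half_diff u g)) -
        (\<Sum>u\<in>\<Lambda>. spin_mean \<Lambda> \<rho> (half_diff u g)))) (at z within I)" for z
      unfolding f_def
      by (auto intro!: derivative_eq_intros has_field_derivative_at_within[OF spin_mean_deriv[OF assms(1)]])
    show "norm ((\<Sum>u\<in>\<Lambda>. spin_mean \<Lambda> z (half_diff u g)) - (\<Sum>u\<in>\<Lambda>. spin_mean \<Lambda> \<rho> (half_diff u g)))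
        \<le> (card \<Lambda>)\<^sup>2 * \<bar>\<rho>' - \<rho>\<bar>" if z: "z \<in> I" for z
    proof -
      have zI: "z \<in> {-1..1}" "\<bar>z - \<rho>\<bar> \<le> \<bar>\<rho>' - \<rho>\<bar>" using z assms by (auto simp: I_def)
      have "norm (\<Sum>u\<in>\<Lambda>. spin_mean \<Lambda> z (half_diff u g) - spin_mean \<Lambda> \<rho> (half_diff u g))
          \<le> (\<Sum>u\<in>\<Lambda>. card \<Lambda> * \<bar>\<rho>' - \<rho>\<bar>)"
      proof (rule sum_norm_le)
        fix u assume "u \<in> \<Lambda>"
        then have "\<bar>spin_mean \<Lambda> z (half_diff u g) - spin_mean \<Lambda> \<rho> (half_diff u g)\<bar> \<le> card \<Lambda> * \<bar>z - \<rho>\<bar>"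
          using zI(1) hd by (intro spin_mean_lipschitz assms) auto
        also have "\<dots> \<le> card \<Lambda> * \<bar>\<rho>' - \<rho>\<bar>" using zI(2) by (intro mult_left_mono) auto
        finally show "norm (spin_mean \<Lambda> z (half_diff u g) - spin_mean \<Lambda> \<rho> (half_diff u g)) \<le> card \<Lambda> * \<bar>\<rho>' - \<rho>\<bar>"
          by simp
      qed
      thus ?thesis by (simp add: sum_subtractf power2_eq_square mult.assoc)
    qed
  qed (auto simp: I_def)
  moreover have "f \<rho>' - f \<rho> = spin_mean \<Lambda> \<rho>' g - spin_mean \<Lambda> \<rho> g -
      (\<rho>' - \<rho>) * (\<Sum>u\<in>\<Lambda>. spin_mean \<Lambda> \<rho> (half_diff u g))" by (simp add: f_def)
  ultimately show ?thesis by (simp add: power2_eq_square abs_mult_self_eq mult.assoc)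
qed

section \<open>A barrier for growing dependence sets\<close>

context glauber_exclusion
begin

definition near :: "'a set \<Rightarrow> real" where
  "near C = (\<Sum>u\<in>C. \<Sum>v\<in>C - {u}. if v \<in> nb u then 1 else 0)"

definition pair_sum :: "'a set \<Rightarrow> real" where
  "pair_sum C = (\<Sum>u\<in>C. \<Sum>v\<in>C - {u}. \<psi> u v)"

text \<open>The leading factor matches the factor \<open>card C\<close> in the cost of an encounter.
  The term with \<open>\<psi>m\<close> pays for the pairs created when \<open>C\<close> grows, each
  worth at most \<open>\<psi>m\<close>, and bounds the whole from below.\<close>

definition barrier :: "'a set \<Rightarrow> real" where
  "barrier C = card C * (pair_sum C + \<psi>m * (card C)\<^sup>2)"

text \<open>The backward dual: sites whose spins before the event determine the spins on
  \<open>C\<close> after it.\<close>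

fun grow :: "'a event \<Rightarrow> 'a set \<Rightarrow> 'a set" where
  "grow (Inl (p, q)) C = sw p q ` C"
| "grow (Inr (u, i)) C = (if u \<in> C then C \<union> nb u else C)"

text \<open>With \<open>\<beta> = 2 * b + b^2\<close>, the coefficient of \<open>1 / k\<close> in
  \<open>(1 + b / k) * (1 + 2 * \<beta> / k)\<close> once \<open>1 / k^2\<close> is replaced by
  \<open>1 / k\<close>.\<close>

definition growth_const :: real where
  "growth_const = b + 2 * (2 * b + b\<^sup>2) + 2 * b * (2 * b + b\<^sup>2)"

lemma grow_subset: "e \<in> events \<Longrightarrow> C \<subseteq> \<Lambda> \<Longrightarrow> grow e C \<subseteq> \<Lambda>"
proof (induction e C rule: grow.induct)
  case (1 p q C)
  then have "p \<in> \<Lambda>" "q \<in> \<Lambda>" using E_sub by (auto simp: events_def)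
  then show ?case using 1 sw_in[of p \<Lambda> q] by auto
next
  case (2 u i C)
  then show ?case using nb_sub[of u] by auto
qed

lemma pair_sum_nonneg: "C \<subseteq> \<Lambda> \<Longrightarrow> pair_sum C \<ge> 0"
  unfolding pair_sum_def using \<psi>_bounds by (intro sum_nonneg) auto

lemma barrier_nonneg: "C \<subseteq> \<Lambda> \<Longrightarrow> barrier C \<ge> 0"
  unfolding barrier_def using pair_sum_nonneg \<psi>m_pos by auto

lemma barrier_ge:
  assumes "C \<subseteq> \<Lambda>" "C \<noteq> {}"
  shows "barrier C \<ge> \<psi>m"
proof -
  have "finite C" using assms finite_\<Lambda> finite_subset by blast
  then have k: "real (card C) \<ge> 1" using assms(2) by (simp add: Suc_le_eq card_gt_0_iff)
  have "1 * (0 + \<psi>m * 1) \<le> card C * (pair_sum C + \<psi>m * (card C)\<^sup>2)"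
    using k pair_sum_nonneg[OF assms(1)] \<psi>m_pos by (intro mult_mono add_mono) auto
  thus ?thesis by (simp add: barrier_def)
qed

lemma barrier_le:
  assumes "C \<subseteq> \<Lambda>"
  shows "barrier C \<le> 2 * \<psi>m * real (card C) ^ 3"
proof -
  have "finite C" using assms finite_\<Lambda> finite_subset by blast
  have "pair_sum C \<le> (\<Sum>u\<in>C. \<Sum>v\<in>C. \<psi>m)" unfolding pair_sum_def
  proof (rule sum_mono)
    fix u assume u: "u \<in> C"
    have "(\<Sum>v\<in>C - {u}. \<psi> u v) \<le> (\<Sum>v\<in>C - {u}. \<psi>m)"
      using assms u \<psi>_bounds by (intro sum_mono) auto
    also have "\<dots> \<le> (\<Sum>v\<in>C. \<psi>m)"
      using \<psi>m_pos \<open>finite C\<close> by (intro sum_mono2) auto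
    finally show "(\<Sum>v\<in>C - {u}. \<psi> u v) \<le> (\<Sum>v\<in>C. \<psi>m)" .
  qed
  then have "pair_sum C \<le> \<psi>m * (card C)\<^sup>2" by (simp add: power2_eq_square mult_ac)
  then have "barrier C \<le> card C * (\<psi>m * (card C)\<^sup>2 + \<psi>m * (card C)\<^sup>2)"
    unfolding barrier_def by (intro mult_left_mono add_right_mono) auto
  thus ?thesis by (simp add: power2_eq_square power3_eq_cube algebra_simps)
qed

text \<open>Each ordered pair of \<open>D\<close> that is not a pair of \<open>C\<close> adds at
  most \<open>\<psi>m\<close>.\<close>

lemma pair_sum_union_le:
  assumes "C \<subseteq> D" "D \<subseteq> \<Lambda>"
  shows "pair_sum D \<le> pair_sum C + \<psi>m * ((real (card D))\<^sup>2 - (real (card C))\<^sup>2)"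
proof -
  have fin: "finite D" "finite C"
    using finite_subset[OF assms(2) finite_\<Lambda>] finite_subset[OF assms(1)] by auto
  have sig: "pair_sum X = (\<Sum>(u, v)\<in>X \<times> X. if v = u then 0 else \<psi> u v)" if "finite X" for X
    unfolding pair_sum_def sum.cartesian_product[symmetric]
  proof (rule sum.cong)
    fix u assume "u \<in> X"
    have "(\<Sum>v\<in>X. if v = u then 0 else \<psi> u v) = (\<Sum>v\<in>X. if v \<noteq> u then \<psi> u v else 0)"
      by (intro sum.cong) auto
    also have "\<dots> = (\<Sum>v\<in>X - {u}. \<psi> u v)"
      unfolding sum.inter_filter[OF that, symmetric] by (rule sum.cong) auto
    finally show "(\<Sum>v\<in>X - {u}. \<psi> u v) = (\<Sum>v\<in>X. if v = u then 0 else \<psi> u v)" ..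
  qed simp
  let ?f = "\<lambda>(u, v). if v = u then 0 else \<psi> u v"
  have "sum ?f (D \<times> D) = sum ?f (C \<times> C) + sum ?f (D \<times> D - C \<times> C)"
    using fin assms by (subst sum.subset_diff[of "C \<times> C"]) auto
  also have "sum ?f (D \<times> D - C \<times> C) \<le> (\<Sum>_\<in>D \<times> D - C \<times> C. \<psi>m)"
  proof (rule sum_mono)
    fix x assume "x \<in> D \<times> D - C \<times> C"
    then obtain u v where "x = (u, v)" "u \<in> \<Lambda>" "v \<in> \<Lambda>" using assms(2) by auto
    then show "?f x \<le> \<psi>m" using \<psi>_bounds[of u v] \<psi>m_pos by auto
  qed
  also have "\<dots> = \<psi>m * ((real (card D))\<^sup>2 - (real (card C))\<^sup>2)"
  proof -
    have "card C \<le> card D" using assms(1) fin(1) by (simp add: card_mono)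
    then have "card C * card C \<le> card D * card D" by (intro mult_le_mono)
    moreover have "card (D \<times> D - C \<times> C) = card D * card D - card C * card C"
      using assms fin by (subst card_Diff_subset) (auto simp: card_cartesian_product)
    ultimately show ?thesis by (simp add: power2_eq_square of_nat_diff mult.commute)
  qed
  finally show ?thesis unfolding sig[OF fin(1)] sig[OF fin(2)] by linarith
qed

text \<open>Adding at most \<open>b\<close> sites to \<open>k\<close> changes a cubic quantity by a
  relative amount of order \<open>1 / k\<close>. Since only the \<open>k\<close> sites of
  \<open>C\<close> trigger growth, the total growth rate is bounded independently of
  \<open>C\<close>.\<close>

lemma barrier_nb:
  assumes C: "C \<subseteq> \<Lambda>" "C \<noteq> {}" and u: "u \<in> \<Lambda>"
  shows "barrier (C \<union> nb u) \<le> barrier C * (1 + growth_const / card C)"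
proof -
  have fin: "finite C" "finite (nb u)"
    using finite_subset[OF C(1) finite_\<Lambda>] finite_nb[OF u] by auto
  define k where "k = real (card C)"
  define k' where "k' = real (card (C \<union> nb u))"
  define X where "X = pair_sum C + \<psi>m * k\<^sup>2"
  define \<beta> where "\<beta> = real (2 * b + b\<^sup>2)"
  have k: "k \<ge> 1" unfolding k_def using C fin by (simp add: Suc_le_eq card_gt_0_iff)
  have kk: "k \<le> k'" unfolding k_def k'_def using fin by (auto intro!: card_mono)
  have "card (C \<union> nb u) \<le> card C + b" using card_Un_le[of C "nb u"] card_nb[OF u] by linarith
  then have k': "k' \<le> k + b" unfolding k_def k'_def by simp
  have "k' * k' \<le> (k + b) * (k + b)" using k k' kk by (intro mult_mono) auto
  also have "\<dots> = k * k + k * (2 * b) + 1 * (real b)\<^sup>2" by (simp add: algebra_simps power2_eq_square)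
  also have "\<dots> \<le> k * k + k * (2 * b) + k * (real b)\<^sup>2"
    using k by (intro add_left_mono mult_right_mono) auto
  finally have d: "k'\<^sup>2 - k\<^sup>2 \<le> k * \<beta>" by (simp add: \<beta>_def power2_eq_square algebra_simps)
  have X0: "\<psi>m * k\<^sup>2 \<le> X" using pair_sum_nonneg[OF C(1)] by (simp add: X_def)
  have "pair_sum (C \<union> nb u) \<le> pair_sum C + \<psi>m * (k'\<^sup>2 - k\<^sup>2)"
    using pair_sum_union_le[of C "C \<union> nb u"] C nb_sub[OF u] by (simp add: k_def k'_def)
  \<comment> \<open>The increment of the square enters twice, once through the new pairs and once
    through the explicit \<open>\<psi>m\<close> term.\<close>
  then have "pair_sum (C \<union> nb u) + \<psi>m * k'\<^sup>2 \<le> X + 2 * \<psi>m * (k'\<^sup>2 - k\<^sup>2)"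
    by (simp add: X_def algebra_simps)
  also have "\<dots> \<le> X + 2 * \<psi>m * (k * \<beta>)"
    using d \<psi>m_pos by (intro add_left_mono mult_left_mono) auto
  also have "\<dots> = X + 2 * (\<psi>m * k\<^sup>2) * (\<beta> / k)" using k by (simp add: power2_eq_square)
  also have "\<dots> \<le> X + 2 * X * (\<beta> / k)"
    using X0 k by (intro add_left_mono mult_right_mono mult_left_mono) (auto simp: \<beta>_def)
  finally have Y: "pair_sum (C \<union> nb u) + \<psi>m * k'\<^sup>2 \<le> X * (1 + 2 * \<beta> / k)" by (simp add: algebra_simps)
  have "X \<ge> 0" using X0 \<psi>m_pos by (meson order.trans mult_nonneg_nonneg less_imp_le zero_le_power2)
  have "barrier (C \<union> nb u) = k' * (pair_sum (C \<union> nb u) + \<psi>m * k'\<^sup>2)"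
    by (simp add: barrier_def k'_def)
  also have "\<dots> \<le> (k + b) * (X * (1 + 2 * \<beta> / k))"
    using Y k' k kk pair_sum_nonneg[of "C \<union> nb u"] C nb_sub[OF u] \<psi>m_pos
    by (intro mult_mono) auto
  also have "\<dots> = k * X * ((1 + b / k) * (1 + 2 * \<beta> / k))" using k by (simp add: field_simps)
  also have "\<dots> \<le> k * X * (1 + growth_const / k)"
  proof (rule mult_left_mono)
    have "b / k * (2 * \<beta> / k) \<le> b * (2 * \<beta>) / k"
      using k mult_left_mono[of "1 / k" 1 "b * (2 * \<beta>) / k"] by (simp add: \<beta>_def)
    then show "(1 + b / k) * (1 + 2 * \<beta> / k) \<le> 1 + growth_const / k"
      by (simp add: growth_const_def \<beta>_def add_divide_distrib algebra_simps)
  qed (use k \<open>X \<ge> 0\<close> in auto)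
  finally show ?thesis by (simp add: barrier_def k_def X_def)
qed

text \<open>An exchange permutes \<open>C\<close> without changing its size, so only
  \<open>pair_sum\<close> changes, and each ordered pair moves as two exchanged sites do:
  \<open>\<psi>_super\<close> applies to every pair, and the unit losses add up to
  \<open>near C\<close>.\<close>

lemma barrier_swaps:
  assumes C: "C \<subseteq> \<Lambda>"
  shows "(\<Sum>(p, q)\<in>E. \<kappa> * (barrier (sw p q ` C) - barrier C)) \<le> 16 * barrier C - card C * near C"
proof -
  have fin: "finite C" using C finite_\<Lambda> finite_subset by blast
  have ps: "pair_sum (sw p q ` C) = (\<Sum>u\<in>C. \<Sum>v\<in>C - {u}. \<psi> (sw p q u) (sw p q v))" for p q
  proof -
    have "sw p q ` C - {sw p q u} = sw p q ` (C - {u})" for u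
      using inj_sw[of p q] by (auto simp: inj_def)
    then show ?thesis unfolding pair_sum_def
      using inj_on_subset[OF inj_sw[of p q]] by (simp add: sum.reindex)
  qed
  have card: "card (sw p q ` C) = card C" for p q
    using inj_on_subset[OF inj_sw[of p q]] by (intro card_image) auto
  define Z where "Z = (\<Sum>u\<in>C. \<Sum>v\<in>C - {u}. \<kappa> * (\<Sum>(p, q)\<in>E. \<psi> (sw p q u) (sw p q v) - \<psi> u v))"
  have Z: "Z = (\<Sum>(p, q)\<in>E. \<kappa> * (pair_sum (sw p q ` C) - pair_sum C))"
    unfolding Z_def ps unfolding pair_sum_def split_def sum_distrib_left sum_subtractf[symmetric] sum.swap[of _ _ E] ..
  have "(\<Sum>(p, q)\<in>E. \<kappa> * (barrier (sw p q ` C) - barrier C)) = card C * Z"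
    unfolding Z sum_distrib_left by (intro sum.cong) (auto simp: barrier_def card algebra_simps)
  also have "\<dots> \<le> card C * (16 * (pair_sum C + \<psi>m * (card C)\<^sup>2) - near C)"
  proof (rule mult_left_mono)
    have "Z \<le> (\<Sum>u\<in>C. \<Sum>v\<in>C - {u}. 16 * \<psi>m - (if v \<in> nb u then 1 else 0))"
      unfolding Z_def using C by (intro sum_mono \<psi>_super) auto
    also have "\<dots> = (\<Sum>u\<in>C. \<Sum>v\<in>C - {u}. 16 * \<psi>m) - near C"
      unfolding near_def sum_subtractf ..
    also have "(\<Sum>u\<in>C. \<Sum>v\<in>C - {u}. 16 * \<psi>m) \<le> (\<Sum>u\<in>C. \<Sum>v\<in>C. 16 * \<psi>m)"
      using fin \<psi>m_pos by (intro sum_mono sum_mono2) auto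
    also have "(\<Sum>u\<in>C. \<Sum>v\<in>C. 16 * \<psi>m) \<le> 16 * (pair_sum C + \<psi>m * (card C)\<^sup>2)"
      using pair_sum_nonneg[OF C] by (simp add: power2_eq_square algebra_simps)
    finally show "Z \<le> 16 * (pair_sum C + \<psi>m * (card C)\<^sup>2) - near C" by simp
  qed simp
  finally show ?thesis by (simp add: barrier_def right_diff_distrib mult_ac)
qed

lemma barrier_generator:
  assumes C: "C \<subseteq> \<Lambda>" "C \<noteq> {}"
  shows "(\<Sum>e\<in>events. rate e * (barrier (grow e C) - barrier C)) \<le>
    (16 + 2 * cm * growth_const) * barrier C - card C * near C"
proof -
  have fin: "finite C" using C finite_\<Lambda> finite_subset by blast
  then have k: "card C > 0" using C by (simp add: card_gt_0_iff)
  have gc: "growth_const \<ge> 0" by (simp add: growth_const_def)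
  have "(\<Sum>u\<in>\<Lambda>. \<Sum>i\<in>UNIV \<times> V. rate (Inr (u, i)) * (barrier (grow (Inr (u, i)) C) - barrier C)) \<le>
      (\<Sum>u\<in>\<Lambda>. if u \<in> C then 2 * cm * (barrier C * (growth_const / card C)) else 0)"
  proof (rule sum_mono)
    fix u assume u: "u \<in> \<Lambda>"
    show "(\<Sum>i\<in>UNIV \<times> V. rate (Inr (u, i)) * (barrier (grow (Inr (u, i)) C) - barrier C)) \<le>
      (if u \<in> C then 2 * cm * (barrier C * (growth_const / card C)) else 0)"
    proof (cases "u \<in> C")
      case True
      have "(\<Sum>i\<in>UNIV \<times> V. rate (Inr (u, i)) * (barrier (grow (Inr (u, i)) C) - barrier C)) =
          2 * cm * (barrier (C \<union> nb u) - barrier C)"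
        using True rate_update_sum[of u] by (simp add: sum_distrib_right[symmetric])
      also have "\<dots> \<le> 2 * cm * (barrier C * (growth_const / card C))"
        using barrier_nb[OF C u] cm_nonneg by (intro mult_left_mono) (auto simp: algebra_simps)
      finally show ?thesis using True by simp
    qed simp
  qed
  also have "\<dots> = (\<Sum>u\<in>C. 2 * cm * (barrier C * (growth_const / card C)))"
    using C finite_\<Lambda> by (simp add: sum.If_cases Int_absorb1)
  also have "\<dots> = 2 * cm * growth_const * barrier C" using k by (simp add: field_simps)
  finally have "(\<Sum>u\<in>\<Lambda>. \<Sum>i\<in>UNIV \<times> V. rate (Inr (u, i)) * (barrier (grow (Inr (u, i)) C) - barrier C)) \<le>
      2 * cm * growth_const * barrier C" .
  moreover have "(\<Sum>pq\<in>E. rate (Inl pq) * (barrier (grow (Inl pq) C) - barrier C)) =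
      (\<Sum>(p, q)\<in>E. \<kappa> * (barrier (sw p q ` C) - barrier C))"
    by (intro sum.cong) auto
  ultimately show ?thesis unfolding sum_events using barrier_swaps[OF C(1)] by (simp add: algebra_simps)
qed

text \<open>The drift can only push a spin away from the value it has, so pointwise it lies between
  \<open>- cm * (1 + x u)\<close> and \<open>cm * (1 - x u)\<close>. The one-sided bounds keep the
  Euler scheme for the density inside [-1,1].\<close>

lemma R_bounds:
  assumes "\<rho> \<in> {-1..1}"
  shows "R \<rho> \<le> cm * (1 - \<rho>)" "- cm * (1 + \<rho>) \<le> R \<rho>" "\<bar>R \<rho>\<bar> \<le> 2 * cm"
proof -
  obtain u where u: "u \<in> \<Lambda>" using \<Lambda>_nonempty by blast
  have m: "spin_mean \<Lambda> \<rho> (\<lambda>x. cm * (1 - of_int (x u))) = cm * (1 - \<rho>)"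
    "spin_mean \<Lambda> \<rho> (\<lambda>x. - cm * (1 + of_int (x u))) = - cm * (1 + \<rho>)"
    using u finite_\<Lambda> by (simp_all only: spin_mean_cmult spin_mean_diff spin_mean_add spin_mean_const spin_mean_component)
  have b: "- 2 * of_int (x u) * c u x \<le> cm * (1 - of_int (x u)) \<and> - cm * (1 + of_int (x u)) \<le> - 2 * of_int (x u) * c u x"
    if "x \<in> spins" for x
    using PiE_spin_cases[OF that u] c_bounds[OF u that] by auto
  show 1: "R \<rho> \<le> cm * (1 - \<rho>)" "- cm * (1 + \<rho>) \<le> R \<rho>"
    unfolding R[OF u, symmetric] m[symmetric] using b by (auto intro!: spin_mean_mono[OF assms])
  have "cm * (1 - \<rho>) \<le> cm * 2" "cm * (1 + \<rho>) \<le> cm * 2"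
    using assms cm_nonneg by (auto intro!: mult_left_mono)
  then show "\<bar>R \<rho>\<bar> \<le> 2 * cm" using 1 by auto
qed

end

section \<open>Propagation of the product structure\<close>

context glauber_exclusion
begin

text \<open>Three contributions: the 16 of \<open>barrier_generator\<close> plus one for the time
  discretisation, the growth of dependence sets, and \<open>2 * cm * b\<close> so that the growth of
  \<open>discs\<close> is dominated.\<close>

definition decor_rate :: real where
  "decor_rate = 17 + 2 * cm * growth_const + 2 * cm * b"

text \<open>The first summand absorbs the coefficient in \<open>decorrelation_update\<close>, the 1
  absorbs the discretisation error.\<close>

definition decor_const :: real where
  "decor_const = 8 * cm * (1 + b) + 1"

lemma decor_rate_ge: "decor_rate \<ge> 2 * cm * b" "decor_rate \<ge> 0"
  using cm_nonneg by (auto simp: decor_rate_def growth_const_def)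

lemma decor_const_ge: "decor_const \<ge> 1" "decor_const \<ge> 8 * cm * (1 + b)"
  using cm_nonneg by (auto simp: decor_const_def)

end

section \<open>Observables and their backward dependence sets\<close>

context glauber_exclusion_chain
begin

text \<open>The last clause makes \<open>F\<close> at most the number of discrepancies in
  \<open>A\<close>, so that its expectations are bounded by multiples of \<open>discs\<close>. The
  class is closed under the dynamics, with \<open>A\<close> replaced by
  \<open>grow e A\<close>.\<close>

definition pair_observable :: "'a set \<Rightarrow> ((nat \<Rightarrow> 'a \<Rightarrow> int) \<Rightarrow> real) \<Rightarrow> bool" where
  "pair_observable A F \<longleftrightarrow>
    (\<forall>s s'. (\<forall>a\<in>A. s 0 a = s' 0 a \<and> s 1 a = s' 1 a) \<longrightarrow> F s = F s') \<and>
    (\<forall>s. good s \<longrightarrow> \<bar>F s\<bar> \<le> 1) \<and>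
    (\<forall>s. (\<forall>a\<in>A. s 0 a = s 1 a) \<longrightarrow> F s = 0)"

definition observable :: "'a set \<Rightarrow> (('a \<Rightarrow> int) \<Rightarrow> real) \<Rightarrow> bool" where
  "observable A g \<longleftrightarrow> depends_on A g \<and> (\<forall>x\<in>spins. \<bar>g x\<bar> \<le> 1)"

text \<open>Euler scheme for \<open>\<rho>' = R \<rho>\<close> with the time step of the chain, so
  that both advance together.\<close>

definition dens :: "real \<Rightarrow> nat \<Rightarrow> real" where
  "dens r n = ((\<lambda>\<rho>. \<rho> + h * R \<rho>) ^^ n) r"

lemma dens_0: "dens r 0 = r" by (simp add: dens_def)
lemma dens_Suc: "dens r (Suc n) = dens r n + h * R (dens r n)" by (simp add: dens_def)

lemma h_cm: "h * (2 * cm) \<le> 1"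
proof -
  obtain a where a: "a \<in> \<Lambda>" using \<Lambda>_nonempty by blast
  have "total_rate = (\<Sum>pq\<in>E. rate (Inl pq)) + (\<Sum>u\<in>\<Lambda>. 2 * cm)"
    unfolding total_rate_def sum_events rate_update_sum ..
  moreover have "(\<Sum>pq\<in>E. rate (Inl pq)) \<ge> 0" using \<kappa>_nonneg by (intro sum_nonneg) auto
  moreover have "2 * cm \<le> (\<Sum>u\<in>\<Lambda>. 2 * cm)"
    using member_le_sum[OF a, of "\<lambda>_. 2 * cm"] cm_nonneg finite_\<Lambda> by simp
  ultimately have "2 * cm \<le> total_rate" by linarith
  then have "h * (2 * cm) \<le> h * total_rate" using h_pos by (intro mult_left_mono) auto
  thus ?thesis using h_rate by linarith
qed

text \<open>Since \<open>h * cm \<le> 1\<close>, a step towards an endpoint covers at most the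
  remaining distance.\<close>

lemma dens_range: "r \<in> {-1..1} \<Longrightarrow> dens r n \<in> {-1..1}"
proof (induction n)
  case (Suc n)
  then have IH: "dens r n \<in> {-1..1}" by simp
  let ?x = "dens r n"
  have hc: "h * cm \<le> 1" "h \<ge> 0" using h_cm cm_nonneg h_pos mult_nonneg_nonneg[of h cm] by auto
  have "h * R ?x \<le> h * (cm * (1 - ?x))" "h * (- cm * (1 + ?x)) \<le> h * R ?x"
    using R_bounds[OF IH] hc(2) by (intro mult_left_mono; simp)+
  moreover have "(h * cm) * (1 - ?x) \<le> 1 * (1 - ?x)" "(h * cm) * (1 + ?x) \<le> 1 * (1 + ?x)"
    using IH hc(1) by (intro mult_right_mono; simp)+
  ultimately show ?case by (auto simp: dens_Suc mult.assoc)
qed (simp add: dens_0)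

lemma pair_observable_bound:
  assumes "pair_observable A F" "A \<subseteq> \<Lambda>" "good s"
  shows "\<bar>F s\<bar> \<le> (\<Sum>a\<in>A. disc a s)"
proof (cases "\<forall>a\<in>A. s 0 a = s 1 a")
  case True
  then have "F s = 0" using assms(1) by (auto simp: pair_observable_def)
  thus ?thesis using disc_bounds[OF assms(3)] assms(2) by (auto intro!: sum_nonneg)
next
  case False
  then obtain a where a: "a \<in> A" "s 0 a \<noteq> s 1 a" by blast
  have "finite A" using assms(2) finite_\<Lambda> by (rule finite_subset)
  then have "disc a s \<le> (\<Sum>a\<in>A. disc a s)"
    using disc_bounds[OF assms(3)] assms(2) by (intro member_le_sum a(1)) auto
  moreover have "disc a s = 1" using disc_eq_1[OF assms(3)] a assms(2) by auto
  moreover have "\<bar>F s\<bar> \<le> 1" using assms by (auto simp: pair_observable_def)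
  ultimately show ?thesis by linarith
qed

lemma pair_observable_mono: "pair_observable A F \<Longrightarrow> A \<subseteq> B \<Longrightarrow> pair_observable B F"
  unfolding pair_observable_def by (meson subsetD)

lemma S_pair_observable:
  assumes "pair_observable A F" "A \<subseteq> \<Lambda>"
  shows "\<bar>S n F\<bar> \<le> card A * discs n"
  using S_disc_bound[OF assms(2), of F 1 n] pair_observable_bound[OF assms] by simp

lemma S_pair_observable_mult:
  assumes F: "pair_observable A F" "A \<subseteq> \<Lambda>" and g: "\<And>x. x \<in> spins \<Longrightarrow> \<bar>g x\<bar> \<le> 1"
  shows "\<bar>S n (\<lambda>s. F s * g (s j))\<bar> \<le> card A * discs n"
proof -
  have "\<bar>F s * g (s j)\<bar> \<le> 1 * (\<Sum>a\<in>A. disc a s)" if s: "good s" for s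
  proof -
    have "\<bar>F s\<bar> * \<bar>g (s j)\<bar> \<le> (\<Sum>a\<in>A. disc a s) * 1"
      using s pair_observable_bound[OF F s] g[of "s j"] by (intro mult_mono) (auto simp: good_def)
    thus ?thesis by (simp add: abs_mult)
  qed
  from S_disc_bound[OF F(2) this, of n] show ?thesis by simp
qed

lemma acts_agree:
  assumes "e \<in> events" "a \<in> A" "\<And>v. v \<in> grow e A \<Longrightarrow> x v = y v"
  shows "act e x a = act e y a"
proof (cases e)
  case (Inl pq)
  then show ?thesis using assms(2,3) by (cases pq) auto
next
  case (Inr t)
  obtain u up \<theta> where t: "t = (u, up, \<theta>)" by (metis prod.exhaust)
  then have u: "u \<in> \<Lambda>" using assms(1) Inr by (auto simp: events_def)
  show ?thesis
  proof (cases "u \<in> A")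
    case True
    then have "c u x = c u y" using assms(3) Inr t
      by (intro depends_onD[OF c_local[OF u], of x y]) auto
    then show ?thesis using assms(2,3) Inr t True by auto
  next
    case False
    then have "a \<noteq> u" using assms(2) by blast
    then show ?thesis using assms(2,3) Inr t False by auto
  qed
qed

lemma pair_observable_acts:
  assumes F: "pair_observable A F" and e: "e \<in> events"
  shows "pair_observable (grow e A) (\<lambda>s. F (acts e s))"
  unfolding pair_observable_def
proof (intro conjI allI impI)
  fix s s' :: "nat \<Rightarrow> 'a \<Rightarrow> int"
  assume "\<forall>a\<in>grow e A. s 0 a = s' 0 a \<and> s 1 a = s' 1 a"
  then have "\<forall>a\<in>A. acts e s 0 a = acts e s' 0 a \<and> acts e s 1 a = acts e s' 1 a"
    unfolding acts_def using acts_agree[OF e] by blast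
  then show "F (acts e s) = F (acts e s')" using F unfolding pair_observable_def by blast
next
  fix s :: "nat \<Rightarrow> 'a \<Rightarrow> int"
  assume "\<forall>a\<in>grow e A. s 0 a = s 1 a"
  then have "\<forall>a\<in>A. acts e s 0 a = acts e s 1 a"
    unfolding acts_def using acts_agree[OF e] by blast
  then show "F (acts e s) = 0" using F unfolding pair_observable_def by blast
next
  fix s assume "good s"
  then show "\<bar>F (acts e s)\<bar> \<le> 1" using F acts_good[OF e] unfolding pair_observable_def by blast
qed

lemma observable_acts:
  assumes g: "observable A g" and e: "e \<in> events"
  shows "observable (grow e A) (\<lambda>x. g (act e x))"
  unfolding observable_def depends_on_def
proof (intro conjI allI impI ballI)
  fix x y :: "'a \<Rightarrow> int" assume "\<forall>u\<in>grow e A. x u = y u"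
  then have "\<forall>u\<in>A. act e x u = act e y u" using acts_agree[OF e] by blast
  then show "g (act e x) = g (act e y)" using g unfolding observable_def depends_on_def by blast
next
  fix x assume "x \<in> spins"
  then show "\<bar>g (act e x)\<bar> \<le> 1" using g act_spins[OF e] unfolding observable_def by blast
qed

lemma spin_mean_swap:
  assumes "(p, q) \<in> E"
  shows "spin_mean \<Lambda> \<rho> (\<lambda>x. g (act (Inl (p, q)) x)) = spin_mean \<Lambda> \<rho> g"
proof -
  have pq: "p \<in> \<Lambda>" "q \<in> \<Lambda>" using assms E_sub by auto
  have "bij_betw (sw p q) \<Lambda> \<Lambda>"
    by (rule bij_betw_byWitness[where f' = "sw p q"]) (use sw_in[OF pq] in auto)
  from spin_mean_bij[OF this finite_\<Lambda>, of \<rho> g] 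
  have "spin_mean \<Lambda> \<rho> g = spin_mean \<Lambda> \<rho> (\<lambda>x. g (restrict (x \<circ> sw p q) \<Lambda>))" .
  also have "\<dots> = spin_mean \<Lambda> \<rho> (\<lambda>x. g (act (Inl (p, q)) x))"
  proof (rule spin_mean_cong)
    fix x assume "x \<in> spins"
    then have "restrict (x \<circ> sw p q) \<Lambda> = x \<circ> sw p q"
      using sw_in[OF pq] by (auto simp: fun_eq_iff PiE_iff extensional_def restrict_def)
    thus "g (restrict (x \<circ> sw p q) \<Lambda>) = g (act (Inl (p, q)) x)" by simp
  qed
  finally show ?thesis ..
qed

text \<open>A flip changes the spin by \<open>- 2 * x u\<close> and \<open>g\<close> by its slope
  times that, so each flip term is the drift times the half difference.\<close>

lemma spin_mean_update:
  assumes u: "u \<in> \<Lambda>"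
  shows "(\<Sum>i\<in>UNIV \<times> V. rate (Inr (u, i)) * (spin_mean \<Lambda> \<rho> (\<lambda>x. g (act (Inr (u, i)) x)) - spin_mean \<Lambda> \<rho> g)) =
    spin_mean \<Lambda> \<rho> (\<lambda>x. net_rate u x * half_diff u g x)"
proof -
  have "(\<Sum>i\<in>UNIV \<times> V. rate (Inr (u, i)) * (spin_mean \<Lambda> \<rho> (\<lambda>x. g (act (Inr (u, i)) x)) - spin_mean \<Lambda> \<rho> g)) =
      spin_mean \<Lambda> \<rho> (\<lambda>x. \<Sum>i\<in>UNIV \<times> V. rate (Inr (u, i)) *\<^sub>R (g (act (Inr (u, i)) x) - g x))"
    unfolding spin_mean_sum real_scaleR_def spin_mean_cmult spin_mean_diff ..
  also have "\<dots> = spin_mean \<Lambda> \<rho> (\<lambda>x. net_rate u x * half_diff u g x)"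
  proof (rule spin_mean_cong)
    fix x assume x: "x \<in> spins"
    have "c u x * (g (x(u := - x u)) - g x) = net_rate u x * half_diff u g x"
    proof (cases "x u = 1")
      case True
      then have "x(u := 1) = x" by auto
      then show ?thesis using True by (simp add: net_rate_def half_diff_def algebra_simps)
    next
      case False
      then have 1: "x u = -1" using PiE_spin_cases[OF x u] by auto
      then have "x(u := -1) = x" by auto
      then show ?thesis using 1 by (simp add: net_rate_def half_diff_def algebra_simps)
    qed
    thus "(\<Sum>i\<in>UNIV \<times> V. rate (Inr (u, i)) *\<^sub>R (g (act (Inr (u, i)) x) - g x)) =
        net_rate u x * half_diff u g x"
      unfolding act_update_sum[OF u x, of g] by simp
  qed
  finally show ?thesis .
qed

definition decor :: "nat \<Rightarrow> real" where
  "decor n = decor_const * discs 0 * (1 + h * decor_rate) ^ n"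

text \<open>The second-order error of one step divided by \<open>h^2 * discs n\<close>: the cubic
  term is the Taylor remainder of the density change, the other one is the change of
  \<open>S n F\<close> within the step times the Lipschitz bound for the density change.\<close>

definition step_const :: real where
  "step_const = 4 * cm\<^sup>2 * real (card \<Lambda>) ^ 3 + 4 * cm * total_rate * real (card \<Lambda>) ^ 2"

lemma decor_nonneg: "decor n \<ge> 0"
  unfolding decor_def using decor_const_ge discs_nonneg[of 0] h_pos decor_rate_ge
  by (intro mult_nonneg_nonneg zero_le_power) auto

lemma decor_ge_discs: "decor n \<ge> decor_const * discs n"
proof -
  have "discs n \<le> (1 + h * (2 * cm * b)) ^ n * discs 0" by (rule discs_growth)
  also have "\<dots> \<le> (1 + h * decor_rate) ^ n * discs 0"
    using h_pos decor_rate_ge cm_nonneg discs_nonneg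
    by (intro mult_right_mono power_mono add_left_mono mult_left_mono) auto
  finally show ?thesis unfolding decor_def using decor_const_ge
    by (simp add: mult.assoc mult.commute[of "discs 0"])
qed

text \<open>
  If no dependence set reaches another site of \<open>A \<union> A'\<close>, the product structure is propagated exactly;
  the remaining sites are counted by \<open>near\<close>.
\<close>

lemma decorrelation_update:
  assumes IH: "\<And>A A' F g. A \<subseteq> \<Lambda> \<Longrightarrow> A' \<subseteq> \<Lambda> \<Longrightarrow> A \<inter> A' = {} \<Longrightarrow> pair_observable A F \<Longrightarrow> observable A' g \<Longrightarrow>
      \<bar>S n (\<lambda>s. F s * g (s j)) - S n F * spin_mean \<Lambda> \<rho> g\<bar> \<le> D * barrier (A \<union> A')"
    and A: "A \<subseteq> \<Lambda>" "A' \<subseteq> \<Lambda>" "A \<inter> A' = {}" "A \<noteq> {}"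
    and F: "pair_observable A F" and g: "observable A' g"
    and \<rho>: "\<rho> \<in> {-1..1}" and u: "u \<in> \<Lambda>" and D: "D \<ge> 0"
  shows "\<bar>(\<Sum>i\<in>UNIV \<times> V. rate (Inr (u, i)) *
        (S n (\<lambda>s. F (acts (Inr (u, i)) s) * g (act (Inr (u, i)) (s j)))
          - S n (\<lambda>s. F (acts (Inr (u, i)) s)) * spin_mean \<Lambda> \<rho> g))
      - S n F * R \<rho> * spin_mean \<Lambda> \<rho> (half_diff u g)\<bar>
    \<le> (\<Sum>i\<in>UNIV \<times> V. rate (Inr (u, i)) * (D * barrier (grow (Inr (u, i)) (A \<union> A'))))
      + 8 * cm * (1 + b) * card (A \<union> A') * discs n *
        (if u \<in> A \<union> A' then \<Sum>v\<in>A \<union> A' - {u}. if v \<in> nb u then 1 else 0 else 0)"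
    (is "\<bar>?L\<bar> \<le> ?Rhs")
proof -
  let ?C = "A \<union> A'" and ?I = "UNIV \<times> V :: (bool \<times> real) set"
  let ?\<nu> = "spin_mean \<Lambda> \<rho>"
  let ?bad = "\<Sum>v\<in>?C - {u}. if v \<in> nb u then 1 else 0 :: real"
  have fin: "finite A" "finite A'" "finite ?C"
    using finite_subset[OF A(1) finite_\<Lambda>] finite_subset[OF A(2) finite_\<Lambda>] by auto
  have CL: "?C \<subseteq> \<Lambda>" using A by blast
  have kA: "card A \<le> card ?C" using fin by (intro card_mono) auto
  have k1: "real (card ?C) \<ge> 1" using fin A(4) by (simp add: Suc_le_eq card_gt_0_iff)
  have iev: "Inr (u, i) \<in> events" if "i \<in> ?I" for i using that u by (auto simp: events_def)
  have rate0: "rate (Inr (u, i)) \<ge> 0" if "i \<in> ?I" for i using rate_nonneg iev[OF that] by blast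
  have gb: "\<bar>g x\<bar> \<le> 1" if "x \<in> spins" for x using g that by (auto simp: observable_def)
  have \<nu>g: "\<bar>?\<nu> g\<bar> \<le> 1" by (rule spin_mean_abs_le[OF finite_\<Lambda> \<rho> gb])
  have gd: "depends_on A' g" using g by (simp add: observable_def)
  have bad1: "?bad \<ge> 1" if "v \<in> ?C" "v \<noteq> u" "v \<in> nb u" for v
    using member_le_sum[of v "?C - {u}" "\<lambda>v. if v \<in> nb u then 1 else 0 :: real"] that fin by auto
  have bad0: "?bad \<ge> 0" by (intro sum_nonneg) auto
  have sumle: "\<bar>\<Sum>i\<in>?I. rate (Inr (u, i)) * f i\<bar> \<le> (\<Sum>i\<in>?I. rate (Inr (u, i)) * f' i)"
    if "\<And>i. i \<in> ?I \<Longrightarrow> \<bar>f i\<bar> \<le> f' i" for f f' :: "bool \<times> real \<Rightarrow> real"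
  proof -
    have "\<bar>\<Sum>i\<in>?I. rate (Inr (u, i)) * f i\<bar> \<le> (\<Sum>i\<in>?I. \<bar>rate (Inr (u, i)) * f i\<bar>)" by (rule sum_abs)
    also have "\<dots> \<le> (\<Sum>i\<in>?I. rate (Inr (u, i)) * f' i)"
      using that rate0 by (intro sum_mono) (auto simp: abs_mult intro!: mult_left_mono)
    finally show ?thesis .
  qed
  have barr0: "(\<Sum>i\<in>?I. rate (Inr (u, i)) * (D * barrier (grow (Inr (u, i)) ?C))) \<ge> 0"
    using rate0 D barrier_nonneg grow_subset[OF iev CL] by (intro sum_nonneg mult_nonneg_nonneg) auto
  have cst: "(\<Sum>i\<in>?I. rate (Inr (u, i)) * a) = 2 * cm * a" for a
    by (simp only: sum_distrib_right[symmetric] rate_update_sum)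
  have bnd: "X \<le> 8 * cm * (1 + b) * card ?C * discs n * ?bad"
    if "X \<le> 8 * cm * (1 + b) * card ?C * discs n" "?bad \<ge> 1" for X :: real
  proof -
    have "8 * cm * (1 + b) * card ?C * discs n * 1 \<le> 8 * cm * (1 + b) * card ?C * discs n * ?bad"
      using that(2) cm_nonneg discs_nonneg by (intro mult_left_mono) auto
    thus ?thesis using that(1) by linarith
  qed
  \<comment> \<open>Outside \<open>?C\<close> nothing observed changes; in \<open>A\<close> only
    \<open>F\<close> changes; in \<open>A'\<close> only \<open>g\<close>, and there the change has
    to match the motion of the density.\<close>
  consider "u \<notin> ?C" | "u \<in> A" "u \<notin> A'" | "u \<in> A'" "u \<notin> A" using A(3) by blast
  then show ?thesis
  proof cases
    case 1
    have "half_diff u g x = 0" for x using 1 gd by (intro half_diff_eq_0) auto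
    then have "?\<nu> (half_diff u g) = 0" by (simp add: spin_mean_def)
    moreover have "F (acts (Inr (u, i)) s) = F s" for i s
    proof -
      have "\<forall>a\<in>A. acts (Inr (u, i)) s 0 a = s 0 a \<and> acts (Inr (u, i)) s 1 a = s 1 a"
        using 1 by (cases i) (auto simp: acts_def)
      thus ?thesis using F unfolding pair_observable_def by blast
    qed
    moreover have "g (act (Inr (u, i)) x) = g x" for i x
      using 1 by (cases i) (auto intro!: depends_onD[OF gd, of _ x])
    ultimately have "\<bar>?L\<bar> = \<bar>\<Sum>i\<in>?I. rate (Inr (u, i)) * (S n (\<lambda>s. F s * g (s j)) - S n F * ?\<nu> g)\<bar>" by simp
    also have "\<dots> \<le> (\<Sum>i\<in>?I. rate (Inr (u, i)) * (D * barrier ?C))"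
      by (rule sumle) (rule IH[OF A(1-3) F g])
    finally show ?thesis using 1 by simp
  next
    case 2
    have "half_diff u g x = 0" for x using 2 gd by (intro half_diff_eq_0) auto
    then have z: "?\<nu> (half_diff u g) = 0" by (simp add: spin_mean_def)
    have gi: "g (act (Inr (u, i)) x) = g x" for i x
      using 2 by (cases i) (auto intro!: depends_onD[OF gd, of _ x])
    have Fi: "pair_observable (A \<union> nb u) (\<lambda>s. F (acts (Inr (u, i)) s))" if "i \<in> ?I" for i
      using pair_observable_acts[OF F iev[OF that]] 2 by simp
    have sub: "A \<union> nb u \<subseteq> \<Lambda>" using A nb_sub[OF u] by blast
    have L: "\<bar>?L\<bar> = \<bar>\<Sum>i\<in>?I. rate (Inr (u, i)) * (S n (\<lambda>s. F (acts (Inr (u, i)) s) * g (s j))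
          - S n (\<lambda>s. F (acts (Inr (u, i)) s)) * ?\<nu> g)\<bar>" using z gi by simp
    show ?thesis
    \<comment> \<open>Without contact the enlarged set is still disjoint from \<open>A'\<close> and
      \<open>IH\<close> applies; with contact each term is bounded crudely and charged to
      \<open>?bad\<close>, which is then at least 1.\<close>
    proof (cases "nb u \<inter> A' = {}")
      case True
      have "\<bar>?L\<bar> \<le> (\<Sum>i\<in>?I. rate (Inr (u, i)) * (D * barrier ((A \<union> nb u) \<union> A')))"
        unfolding L by (rule sumle, rule IH) (use sub A True Fi g in auto)
      also have "(A \<union> nb u) \<union> A' = ?C \<union> nb u" by blast
      also have "(\<Sum>i\<in>?I. rate (Inr (u, i)) * (D * barrier (?C \<union> nb u))) \<le> ?Rhs"
        using 2 cm_nonneg discs_nonneg bad0 by simp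
      finally show ?thesis .
    next
      case False
      then obtain v where v: "v \<in> nb u" "v \<in> A'" by blast
      then have bad: "?bad \<ge> 1" using 2 by (intro bad1[of v]) auto
      have "\<bar>S n (\<lambda>s. F (acts (Inr (u, i)) s) * g (s j)) - S n (\<lambda>s. F (acts (Inr (u, i)) s)) * ?\<nu> g\<bar>
          \<le> 2 * ((1 + b) * card ?C * discs n)" if i: "i \<in> ?I" for i
      proof -
        have "card (A \<union> nb u) \<le> card ?C + b"
          using card_Un_le[of A "nb u"] kA card_nb[OF u] by linarith
        also have "\<dots> \<le> (1 + b) * card ?C" using k1 by (simp add: algebra_simps)
        finally have "real (card (A \<union> nb u)) \<le> real ((1 + b) * card ?C)" by (rule of_nat_mono)
        then have K: "card (A \<union> nb u) * discs n \<le> (1 + b) * card ?C * discs n"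
          using discs_nonneg[of n] by (intro mult_right_mono) auto
        have "\<bar>S n (\<lambda>s. F (acts (Inr (u, i)) s)) * ?\<nu> g\<bar> \<le> card (A \<union> nb u) * discs n * 1"
          unfolding abs_mult using S_pair_observable[OF Fi[OF i] sub] \<nu>g discs_nonneg
          by (intro mult_mono) auto
        moreover have "\<bar>S n (\<lambda>s. F (acts (Inr (u, i)) s) * g (s j))\<bar> \<le> card (A \<union> nb u) * discs n"
          by (rule S_pair_observable_mult[OF Fi[OF i] sub gb])
        ultimately show ?thesis using K by linarith
      qed
      then have "\<bar>?L\<bar> \<le> (\<Sum>i\<in>?I. rate (Inr (u, i)) * (2 * ((1 + b) * card ?C * discs n)))"
        unfolding L by (rule sumle)
      also have "\<dots> \<le> 8 * cm * (1 + b) * card ?C * discs n"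
      proof -
        have "0 \<le> cm * ((1 + b) * card ?C * discs n)" using cm_nonneg discs_nonneg by simp
        thus ?thesis unfolding cst by (simp add: algebra_simps)
      qed
      finally have "\<bar>?L\<bar> \<le> 8 * cm * (1 + b) * card ?C * discs n * ?bad" using bad by (rule bnd)
      thus ?thesis using barr0 2 by simp
    qed
  next
    case 3
    have Fi: "F (acts (Inr (u, i)) s) = F s" for i s
    proof -
      have "\<forall>a\<in>A. acts (Inr (u, i)) s 0 a = s 0 a \<and> acts (Inr (u, i)) s 1 a = s 1 a"
        using 3 by (cases i) (auto simp: acts_def)
      thus ?thesis using F unfolding pair_observable_def by blast
    qed
    define gi where "gi i x = g (act (Inr (u, i)) x)" for i x
    have gi: "observable (A' \<union> nb u) (gi i)" if "i \<in> ?I" for i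
      using observable_acts[OF g iev[OF that]] 3 by (simp add: gi_def[abs_def])
    have sub: "A' \<union> nb u \<subseteq> \<Lambda>" using A nb_sub[OF u] by blast
    define B where "B = ?\<nu> (\<lambda>x. net_rate u x * half_diff u g x) - R \<rho> * ?\<nu> (half_diff u g)"
    \<comment> \<open>Inserting the Bernoulli average of the updated \<open>g\<close>: the first sum
      consists of decorrelation errors again, and \<open>B\<close> measures how far drift and slope
      are from being uncorrelated.\<close>
    have "?L = (\<Sum>i\<in>?I. rate (Inr (u, i)) * (S n (\<lambda>s. F s * gi i (s j)) - S n F * ?\<nu> (gi i))) +
        S n F * (\<Sum>i\<in>?I. rate (Inr (u, i)) * (?\<nu> (gi i) - ?\<nu> g)) - S n F * R \<rho> * ?\<nu> (half_diff u g)"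
      unfolding sum_distrib_left sum.distrib[symmetric] Fi gi_def
      by (simp add: algebra_simps)
    also have "(\<Sum>i\<in>?I. rate (Inr (u, i)) * (?\<nu> (gi i) - ?\<nu> g)) = ?\<nu> (\<lambda>x. net_rate u x * half_diff u g x)"
      unfolding gi_def by (rule spin_mean_update[OF u])
    finally have L: "?L = (\<Sum>i\<in>?I. rate (Inr (u, i)) * (S n (\<lambda>s. F s * gi i (s j)) - S n F * ?\<nu> (gi i))) +
        S n F * B" by (simp add: B_def algebra_simps)
    show ?thesis
    proof (cases "nb u \<inter> (?C - {u}) = {}")
      case True
      \<comment> \<open>The drift reads \<open>nb u\<close> and the slope reads
        \<open>A' - {u}\<close>. These are disjoint here, so the average factorises into
        \<open>R \<rho>\<close> times the mean slope and \<open>B\<close> vanishes.\<close>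
      have "?\<nu> (\<lambda>x. net_rate u x * half_diff u g x) = ?\<nu> (net_rate u) * ?\<nu> (half_diff u g)"
        using True A nb_sub[OF u]
        by (intro spin_mean_indep[where A = "nb u" and B = "A' - {u}"] finite_\<Lambda> net_rate_local[OF u]
            depends_on_half_diff gd) auto
      then have "B = 0" using R[OF u, of \<rho>] by (simp add: B_def net_rate_def[abs_def])
      then have "\<bar>?L\<bar> \<le> (\<Sum>i\<in>?I. rate (Inr (u, i)) * (D * barrier (A \<union> (A' \<union> nb u))))"
        unfolding L using 3 by (simp, intro sumle IH) (use sub A True F gi in auto)
      also have "A \<union> (A' \<union> nb u) = ?C \<union> nb u" by blast
      also have "(\<Sum>i\<in>?I. rate (Inr (u, i)) * (D * barrier (?C \<union> nb u))) \<le> ?Rhs"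
        using 3 cm_nonneg discs_nonneg bad0 by simp
      finally show ?thesis .
    next
      case False
      then obtain v where v: "v \<in> nb u" "v \<in> ?C" "v \<noteq> u" by blast
      then have bad: "?bad \<ge> 1" by (intro bad1[of v]) auto
      have KF: "\<bar>S n F\<bar> \<le> card ?C * discs n"
        using S_pair_observable[OF F A(1), of n] kA discs_nonneg[of n]
        by (meson mult_right_mono of_nat_mono order.trans)
      have "\<bar>S n (\<lambda>s. F s * gi i (s j)) - S n F * ?\<nu> (gi i)\<bar> \<le> 2 * (card ?C * discs n)" if i: "i \<in> ?I" for i
      proof -
        have gib: "\<bar>gi i x\<bar> \<le> 1" if "x \<in> spins" for x using gi[OF i] that by (auto simp: observable_def)
        have "\<bar>S n F * ?\<nu> (gi i)\<bar> \<le> card ?C * discs n * 1"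
          unfolding abs_mult using KF spin_mean_abs_le[OF finite_\<Lambda> \<rho> gib] discs_nonneg
          by (intro mult_mono) auto
        moreover have "\<bar>S n (\<lambda>s. F s * gi i (s j))\<bar> \<le> card A * discs n"
          by (rule S_pair_observable_mult[OF F A(1) gib])
        moreover have "card A * discs n \<le> card ?C * discs n"
          using kA discs_nonneg by (intro mult_right_mono) auto
        ultimately show ?thesis by linarith
      qed
      then have 1: "\<bar>\<Sum>i\<in>?I. rate (Inr (u, i)) * (S n (\<lambda>s. F s * gi i (s j)) - S n F * ?\<nu> (gi i))\<bar>
          \<le> (\<Sum>i\<in>?I. rate (Inr (u, i)) * (2 * (card ?C * discs n)))"
        by (rule sumle)
      have hb: "\<bar>half_diff u g x\<bar> \<le> 1" if "x \<in> spins" for x by (rule half_diff_bound[OF gb u that])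
      have "\<bar>?\<nu> (\<lambda>x. net_rate u x * half_diff u g x)\<bar> \<le> 2 * cm * 1"
      proof (rule spin_mean_abs_le[OF finite_\<Lambda> \<rho>])
        fix x assume "x \<in> spins"
        then show "\<bar>net_rate u x * half_diff u g x\<bar> \<le> 2 * cm * 1"
          unfolding abs_mult using net_rate_bound[OF u] hb cm_nonneg by (intro mult_mono) auto
      qed
      moreover have "\<bar>R \<rho> * ?\<nu> (half_diff u g)\<bar> \<le> 2 * cm * 1"
        unfolding abs_mult using R_bounds(3)[OF \<rho>] spin_mean_abs_le[OF finite_\<Lambda> \<rho> hb] cm_nonneg
        by (intro mult_mono) auto
      ultimately have "\<bar>B\<bar> \<le> 4 * cm" unfolding B_def by linarith
      then have 2: "\<bar>S n F * B\<bar> \<le> card ?C * discs n * (4 * cm)"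
        unfolding abs_mult using KF discs_nonneg by (intro mult_mono) auto
      have "\<bar>?L\<bar> \<le> 8 * cm * (card ?C * discs n)"
        unfolding L using 1 2 unfolding cst by (auto simp: algebra_simps)
      also have "\<dots> \<le> 8 * cm * ((1 + b) * (card ?C * discs n))"
        using cm_nonneg discs_nonneg[of n] by (intro mult_left_mono) (auto simp: algebra_simps)
      finally have "\<bar>?L\<bar> \<le> 8 * cm * (1 + b) * card ?C * discs n" by (simp add: mult.assoc)
      then have "\<bar>?L\<bar> \<le> 8 * cm * (1 + b) * card ?C * discs n * ?bad" using bad by (rule bnd)
      thus ?thesis using barr0 3 by simp
    qed
  qed
qed

text \<open>Induction over all observables at once, since a step backwards turns
  \<open>(A, A')\<close> into \<open>(grow e A, grow e A')\<close>. The start is exact. In each step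
  the failure at encounters costs a multiple of \<open>near\<close>, which is what the negative term
  in \<open>barrier_generator\<close> pays for; the rest multiplies the bound by at most
  \<open>1 + h * decor_rate\<close>.\<close>

theorem decorrelation:
  assumes h_small: "h * step_const \<le> \<psi>m"
    and j: "j = 2 \<and> r = 1 \<or> j = 3 \<and> r = -1"
  shows "A \<subseteq> \<Lambda> \<Longrightarrow> A' \<subseteq> \<Lambda> \<Longrightarrow> A \<inter> A' = {} \<Longrightarrow> pair_observable A F \<Longrightarrow> observable A' g \<Longrightarrow>
    \<bar>S n (\<lambda>s. F s * g (s j)) - S n F * spin_mean \<Lambda> (dens r n) g\<bar> \<le> decor n * barrier (A \<union> A')"
proof (induction n arbitrary: A A' F g)
  case 0
  define b0 :: int where "b0 = (if j = 2 then 1 else -1)"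
  have b0: "b0 = -1 \<or> b0 = 1" "r = of_int b0" using j by (auto simp: b0_def)
  have "s0 j = (\<lambda>u\<in>\<Lambda>. b0)" using j s0_top s0_bot by (auto simp: b0_def)
  \<comment> \<open>A constant configuration is the same after every translation, so
    \<open>g\<close> factors out of the sum over \<open>G\<close>.\<close>
  then have "shift a s0 j = (\<lambda>u\<in>\<Lambda>. b0)" if "a \<in> G" for a
    using tr_in[OF that] by (auto simp: shift_def fun_eq_iff restrict_def)
  then have "S 0 (\<lambda>s. F s * g (s j)) = S 0 F * g (\<lambda>u\<in>\<Lambda>. b0)"
    unfolding S_def by (simp add: sum_distrib_right)
  moreover have "spin_mean \<Lambda> (dens r 0) g = g (\<lambda>u\<in>\<Lambda>. b0)"
    unfolding dens_0 b0(2) by (rule spin_mean_extreme[OF finite_\<Lambda> b0(1)])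
  moreover have "barrier (A \<union> A') \<ge> 0" using 0 by (intro barrier_nonneg) auto
  ultimately show ?case using decor_nonneg by simp
next
  case (Suc n)
  note A = Suc.prems(1-3) and F = Suc.prems(4) and g = Suc.prems(5)
  let ?C = "A \<union> A'" and ?\<rho> = "dens r n" and ?I = "UNIV \<times> V :: (bool \<times> real) set"
  let ?\<nu> = "spin_mean \<Lambda> ?\<rho>"
  have CL: "?C \<subseteq> \<Lambda>" using A by blast
  show ?case
  proof (cases "A = {}")
    case True
    then have "F s = 0" for s using F by (simp add: pair_observable_def)
    then have "S (Suc n) F = 0" "S (Suc n) (\<lambda>s. F s * g (s j)) = 0"
      using S_zero[of "Suc n"] by (simp_all add: fun_eq_iff[THEN iffD2, of F "\<lambda>_. 0"])
    then show ?thesis using decor_nonneg barrier_nonneg[OF CL] by simp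
  next
    case False
    then have Cne: "?C \<noteq> {}" by blast
    have rr: "r \<in> {-1..1}" using j by auto
    have \<rho>: "?\<rho> \<in> {-1..1}" and \<rho>': "dens r (Suc n) \<in> {-1..1}" using dens_range[OF rr] by auto
    have gb: "\<bar>g x\<bar> \<le> 1" if "x \<in> spins" for x using g that by (auto simp: observable_def)
    define X where "X = S n (\<lambda>s. F s * g (s j)) - S n F * ?\<nu> g"
    define D where "D e = S n (\<lambda>s. F (acts e s) * g (act e (s j))) - S n (\<lambda>s. F (acts e s)) * ?\<nu> g" for e
    define \<Delta> where "\<Delta> = (\<Sum>u\<in>\<Lambda>. ?\<nu> (half_diff u g))"
    define \<delta> where "\<delta> = spin_mean \<Lambda> (dens r (Suc n)) g - ?\<nu> g"
    define P where "P = (\<Sum>e\<in>events. rate e * D e) - S n F * R ?\<rho> * \<Delta>"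
    define err where "err = S n (T F) * \<delta> - h * (S n F * R ?\<rho> * \<Delta>)"
    define N where "N = real (card \<Lambda>)"
    have X: "\<bar>X\<bar> \<le> decor n * barrier ?C" unfolding X_def by (rule Suc.IH[OF A F g])
    have aj: "acts e s j = act e (s j)" for e s by (simp add: acts_def)
    have "S (Suc n) (\<lambda>s. F s * g (s j)) - S (Suc n) F * ?\<nu> g =
        (1 - h * total_rate) * X + h * (\<Sum>e\<in>events. rate e * D e)"
      unfolding S_Suc S_T aj X_def D_def
      by (simp add: algebra_simps sum_distrib_left sum_distrib_right sum_subtractf)
    \<comment> \<open>\<open>P\<close> compares the generator with the first-order motion of the
      density; \<open>err\<close> is what the actual Euler step of the density adds beyond first
      order.\<close>
    then have step: "S (Suc n) (\<lambda>s. F s * g (s j)) - S (Suc n) F * spin_mean \<Lambda> (dens r (Suc n)) g =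
        (1 - h * total_rate) * X + h * P - err"
      by (simp add: P_def err_def \<delta>_def S_Suc algebra_simps)
    have P: "\<bar>P\<bar> \<le> (\<Sum>e\<in>events. rate e * (decor n * barrier (grow e ?C))) +
        8 * cm * (1 + b) * card ?C * discs n * near ?C"
    proof -
      define Q where "Q u = (\<Sum>i\<in>?I. rate (Inr (u, i)) * D (Inr (u, i))) - S n F * R ?\<rho> * ?\<nu> (half_diff u g)" for u
      define bad where "bad u = (if u \<in> ?C then \<Sum>v\<in>?C - {u}. if v \<in> nb u then 1 else 0 :: real else 0)" for u
      have split: "P = (\<Sum>pq\<in>E. rate (Inl pq) * D (Inl pq)) + (\<Sum>u\<in>\<Lambda>. Q u)"
        unfolding P_def \<Delta>_def Q_def sum_events sum_subtractf sum_distrib_left by simp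
      have "\<bar>\<Sum>pq\<in>E. rate (Inl pq) * D (Inl pq)\<bar> \<le> (\<Sum>pq\<in>E. \<bar>rate (Inl pq) * D (Inl pq)\<bar>)" by (rule sum_abs)
      also have "\<dots> \<le> (\<Sum>pq\<in>E. rate (Inl pq) * (decor n * barrier (grow (Inl pq) ?C)))"
      proof (rule sum_mono)
        fix pq assume pq: "pq \<in> E"
        then have e: "Inl pq \<in> events" by (auto simp: events_def)
        obtain p q where pqd: "pq = (p, q)" by force
        \<comment> \<open>Exchanges keep the two sets disjoint and leave Bernoulli measures
          invariant, so they create no defect.\<close>
        have "grow (Inl pq) A \<inter> grow (Inl pq) A' = {}"
          using A(3) inj_sw[of p q] by (auto simp: pqd inj_def)
        then have "\<bar>S n (\<lambda>s. F (acts (Inl pq) s) * g (act (Inl pq) (s j))) -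
            S n (\<lambda>s. F (acts (Inl pq) s)) * ?\<nu> (\<lambda>x. g (act (Inl pq) x))\<bar> \<le>
            decor n * barrier (grow (Inl pq) A \<union> grow (Inl pq) A')"
          by (intro Suc.IH grow_subset[OF e] A pair_observable_acts[OF F e] observable_acts[OF g e])
        moreover have "grow (Inl pq) A \<union> grow (Inl pq) A' = grow (Inl pq) ?C" by (auto simp: pqd)
        moreover have "?\<nu> (\<lambda>x. g (act (Inl pq) x)) = ?\<nu> g" using spin_mean_swap pq unfolding pqd by blast
        ultimately have "\<bar>D (Inl pq)\<bar> \<le> decor n * barrier (grow (Inl pq) ?C)" unfolding D_def by simp
        then show "\<bar>rate (Inl pq) * D (Inl pq)\<bar> \<le> rate (Inl pq) * (decor n * barrier (grow (Inl pq) ?C))"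
          unfolding abs_mult using rate_nonneg[OF e] by (simp add: mult_left_mono)
      qed
      finally have 1: "\<bar>\<Sum>pq\<in>E. rate (Inl pq) * D (Inl pq)\<bar> \<le> (\<Sum>pq\<in>E. rate (Inl pq) * (decor n * barrier (grow (Inl pq) ?C)))" .
      have "\<bar>\<Sum>u\<in>\<Lambda>. Q u\<bar> \<le> (\<Sum>u\<in>\<Lambda>. \<bar>Q u\<bar>)" by (rule sum_abs)
      also have "\<dots> \<le> (\<Sum>u\<in>\<Lambda>. (\<Sum>i\<in>?I. rate (Inr (u, i)) * (decor n * barrier (grow (Inr (u, i)) ?C))) +
          8 * cm * (1 + b) * card ?C * discs n * bad u)"
        unfolding Q_def D_def bad_def
        by (intro sum_mono decorrelation_update Suc.IH A F g \<rho> False decor_nonneg) auto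
      also have "\<dots> = (\<Sum>u\<in>\<Lambda>. \<Sum>i\<in>?I. rate (Inr (u, i)) * (decor n * barrier (grow (Inr (u, i)) ?C))) +
          8 * cm * (1 + b) * card ?C * discs n * (\<Sum>u\<in>\<Lambda>. bad u)"
        by (simp only: sum.distrib sum_distrib_left)
      also have "(\<Sum>u\<in>\<Lambda>. bad u) = near ?C"
        unfolding bad_def near_def sum.inter_restrict[OF finite_\<Lambda>, symmetric] Int_absorb1[OF CL] ..
      finally have "\<bar>\<Sum>u\<in>\<Lambda>. Q u\<bar> \<le> (\<Sum>u\<in>\<Lambda>. \<Sum>i\<in>?I. rate (Inr (u, i)) * (decor n * barrier (grow (Inr (u, i)) ?C))) +
          8 * cm * (1 + b) * card ?C * discs n * near ?C" .
      with 1 show ?thesis unfolding split sum_events by linarith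
    qed
    have N0: "N \<ge> 0" by (simp add: N_def)
    have err: "\<bar>err\<bar> \<le> h * \<psi>m * discs n"
    proof -
      have h0: "h \<ge> 0" using h_pos by simp
      have dd: "dens r (Suc n) - ?\<rho> = h * R ?\<rho>" by (simp add: dens_Suc)
      have hR: "\<bar>h * R ?\<rho>\<bar> \<le> h * (2 * cm)"
        unfolding abs_mult using R_bounds(3)[OF \<rho>] h0 by (simp add: mult_left_mono)
      have "\<bar>\<delta>\<bar> \<le> N * \<bar>h * R ?\<rho>\<bar>"
        using spin_mean_lipschitz[OF finite_\<Lambda> \<rho> \<rho>' gb] unfolding dd \<delta>_def N_def .
      also have "\<dots> \<le> N * (h * (2 * cm))" using hR N0 by (rule mult_left_mono)
      finally have \<delta>: "\<bar>\<delta>\<bar> \<le> N * (h * (2 * cm))" .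
      have "\<bar>\<delta> - h * R ?\<rho> * \<Delta>\<bar> \<le> N\<^sup>2 * (h * R ?\<rho>)\<^sup>2"
        using spin_mean_taylor[OF finite_\<Lambda> \<rho> \<rho>' gb] unfolding dd \<delta>_def \<Delta>_def N_def by simp
      also have "\<dots> \<le> N\<^sup>2 * (h * (2 * cm))\<^sup>2"
        using hR N0 by (intro mult_left_mono) (auto simp: abs_le_square_iff[symmetric])
      finally have \<delta>2: "\<bar>\<delta> - h * R ?\<rho> * \<Delta>\<bar> \<le> N\<^sup>2 * (h * (2 * cm))\<^sup>2" .
      have SF: "\<bar>S n F\<bar> \<le> N * discs n" unfolding N_def
        by (rule S_pair_observable[OF pair_observable_mono[OF F A(1)]]) simp
      have "\<bar>S n (\<lambda>s. F (acts e s)) - S n F\<bar> \<le> 2 * (N * discs n)" if e: "e \<in> events" for e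
      proof -
        have "pair_observable \<Lambda> (\<lambda>s. F (acts e s))"
          by (rule pair_observable_mono[OF pair_observable_acts[OF F e] grow_subset[OF e A(1)]])
        then have "\<bar>S n (\<lambda>s. F (acts e s))\<bar> \<le> N * discs n" unfolding N_def
          by (rule S_pair_observable) simp
        with SF show ?thesis by linarith
      qed
      then have "\<bar>\<Sum>e\<in>events. rate e * (S n (\<lambda>s. F (acts e s)) - S n F)\<bar> \<le> (\<Sum>e\<in>events. rate e * (2 * (N * discs n)))"
        using rate_nonneg by (intro order.trans[OF sum_abs] sum_mono) (auto simp: abs_mult intro!: mult_left_mono)
      also have "\<dots> = total_rate * (2 * (N * discs n))" by (simp add: total_rate_def sum_distrib_right)
      finally have "\<bar>S n (T F) - S n F\<bar> \<le> h * (total_rate * (2 * (N * discs n)))"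
        unfolding S_T' using h0 by (simp add: abs_mult mult_left_mono)
      then have 1: "\<bar>(S n (T F) - S n F) * \<delta>\<bar> \<le> h * (total_rate * (2 * (N * discs n))) * (N * (h * (2 * cm)))"
        unfolding abs_mult using \<delta> N0 h0 total_rate_nonneg discs_nonneg[of n] by (intro mult_mono) auto
      have 2: "\<bar>S n F * (\<delta> - h * R ?\<rho> * \<Delta>)\<bar> \<le> N * discs n * (N\<^sup>2 * (h * (2 * cm))\<^sup>2)"
        unfolding abs_mult using \<delta>2 SF by (intro mult_mono) auto
      have "err = (S n (T F) - S n F) * \<delta> + S n F * (\<delta> - h * R ?\<rho> * \<Delta>)"
        by (simp add: err_def algebra_simps)
      then have "\<bar>err\<bar> \<le> h * (total_rate * (2 * (N * discs n))) * (N * (h * (2 * cm))) +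
          N * discs n * (N\<^sup>2 * (h * (2 * cm))\<^sup>2)" using 1 2 by linarith
      also have "\<dots> = h * (h * step_const) * discs n"
        by (simp add: step_const_def N_def power2_eq_square power3_eq_cube algebra_simps)
      also have "\<dots> \<le> h * \<psi>m * discs n"
        using h_small h0 discs_nonneg by (intro mult_right_mono mult_left_mono) auto
      finally show ?thesis .
    qed
    have hr: "1 - h * total_rate \<ge> 0" using h_rate by simp
    define Y where "Y = (\<Sum>e\<in>events. rate e * barrier (grow e ?C))"
    have "Y - total_rate * barrier ?C \<le> (16 + 2 * cm * growth_const) * barrier ?C - card ?C * near ?C"
      using barrier_generator[OF CL Cne]
      by (simp add: Y_def total_rate_def right_diff_distrib sum_subtractf sum_distrib_right)
    then have Y: "decor n * (Y - total_rate * barrier ?C) \<le>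
        decor n * ((16 + 2 * cm * growth_const) * barrier ?C - card ?C * near ?C)"
      by (rule mult_left_mono[OF _ decor_nonneg])
    have near0: "near ?C \<ge> 0" unfolding near_def by (intro sum_nonneg) auto
    have "8 * cm * (1 + b) * discs n \<le> decor_const * discs n"
      using decor_const_ge(2) discs_nonneg by (intro mult_right_mono) auto
    then have "8 * cm * (1 + b) * discs n * (card ?C * near ?C) \<le> decor n * (card ?C * near ?C)"
      using decor_ge_discs[of n] near0 by (intro mult_right_mono) auto
    then have nr: "8 * cm * (1 + b) * card ?C * discs n * near ?C \<le> decor n * (card ?C * near ?C)"
      by (simp add: mult_ac)
    \<comment> \<open>Since \<open>barrier\<close> is at least \<open>\<psi>m\<close> on a nonempty
      set, the step error becomes one more unit in the growth rate, the 17th.\<close>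
    have "discs n \<le> decor_const * discs n"
      using decor_const_ge(1) discs_nonneg[of n] by (simp add: mult_le_cancel_right1)
    then have "\<psi>m * discs n \<le> barrier ?C * decor n"
      using barrier_ge[OF CL Cne] decor_ge_discs[of n] \<psi>m_pos discs_nonneg[of n] by (intro mult_mono) auto
    then have er: "h * \<psi>m * discs n \<le> h * (decor n * barrier ?C)"
      using h_pos by (simp add: mult_ac)
    have "\<bar>(1 - h * total_rate) * X\<bar> \<le> (1 - h * total_rate) * (decor n * barrier ?C)"
      unfolding abs_mult using hr X by (simp add: mult_left_mono)
    moreover have "\<bar>h * P\<bar> \<le> h * (decor n * Y + 8 * cm * (1 + b) * card ?C * discs n * near ?C)"
    proof -
      have "(\<Sum>e\<in>events. rate e * (decor n * barrier (grow e ?C))) = decor n * Y"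
        by (simp add: Y_def sum_distrib_left mult_ac)
      thus ?thesis using P h_pos unfolding abs_mult by (simp add: mult_left_mono)
    qed
    ultimately have "\<bar>(1 - h * total_rate) * X + h * P - err\<bar> \<le>
        (1 - h * total_rate) * (decor n * barrier ?C) +
        h * (decor n * Y + 8 * cm * (1 + b) * card ?C * discs n * near ?C) + h * (decor n * barrier ?C)"
      using err er by linarith
    also have "\<dots> = decor n * barrier ?C + h * (decor n * (Y - total_rate * barrier ?C) +
        8 * cm * (1 + b) * card ?C * discs n * near ?C + decor n * barrier ?C)"
      by (simp add: algebra_simps)
    \<comment> \<open>The gain \<open>- card ?C * near ?C\<close> now cancels the cost of
      encounters.\<close>
    also have "\<dots> \<le> decor n * barrier ?C + h * (decor n * ((16 + 2 * cm * growth_const) * barrier ?C - card ?C * near ?C) +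
        decor n * (card ?C * near ?C) + decor n * barrier ?C)"
    proof (intro add_left_mono mult_left_mono)
      show "decor n * (Y - total_rate * barrier ?C) + 8 * cm * (1 + b) * card ?C * discs n * near ?C +
          decor n * barrier ?C \<le> decor n * ((16 + 2 * cm * growth_const) * barrier ?C - card ?C * near ?C) +
          decor n * (card ?C * near ?C) + decor n * barrier ?C"
        using Y nr by linarith
    qed (use h_pos in simp)
    also have "\<dots> = decor n * barrier ?C * (1 + h * (17 + 2 * cm * growth_const))"
      by (simp add: algebra_simps)
    also have "\<dots> \<le> decor n * barrier ?C * (1 + h * decor_rate)"
      using h_pos cm_nonneg decor_nonneg barrier_nonneg[OF CL]
      by (intro mult_left_mono add_left_mono) (auto simp: decor_rate_def)
    also have "\<dots> = decor (Suc n) * barrier ?C" by (simp add: decor_def)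
    finally show ?thesis unfolding step .
  qed
qed

end

section \<open>Growth of the number of discrepancies\<close>

text \<open>Farther than \<open>\<delta>\<close> from the root every step gains at least
  \<open>\<kappa> * h\<close> and cannot overshoot, being at most \<open>\<delta>\<close> long;
  within \<open>\<delta>\<close> a step towards the root cannot leave. The 2 is the diameter of
  [-1,1].\<close>

lemma discrete_flow_near_root:
  fixes R :: "real \<Rightarrow> real" and x :: "nat \<Rightarrow> real"
  assumes step: "\<And>n. x (Suc n) = x n + h * R (x n)" and range: "\<And>n. x n \<in> {-1..1}"
    and bound: "\<And>\<rho>. \<rho> \<in> {-1..1} \<Longrightarrow> \<bar>R \<rho>\<bar> \<le> M" and h: "h > 0" "h * M \<le> \<delta>"
    and above: "\<And>\<rho>. \<rho> \<in> {-1..1} \<Longrightarrow> \<rho> \<ge> r \<Longrightarrow> R \<rho> \<le> 0"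
    and below: "\<And>\<rho>. \<rho> \<in> {-1..1} \<Longrightarrow> \<rho> \<le> r \<Longrightarrow> R \<rho> \<ge> 0"
    and far: "\<And>\<rho>. \<rho> \<in> {-1..1} \<Longrightarrow> \<bar>\<rho> - r\<bar> \<ge> \<delta> \<Longrightarrow> \<bar>R \<rho>\<bar> \<ge> \<kappa>"
    and r: "r \<in> {-1..1}" and "\<delta> > 0" and "\<kappa> \<ge> 0"
  shows "\<bar>x n - r\<bar> \<le> max \<delta> (2 - \<kappa> * (h * n))"
proof (induction n)
  case 0
  then show ?case using range[of 0] r by auto
next
  case (Suc n)
  have hR: "\<bar>h * R (x n)\<bar> \<le> \<delta>"
  proof -
    have "h * \<bar>R (x n)\<bar> \<le> h * M" using h by (intro mult_left_mono bound range) auto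
    then have "h * \<bar>R (x n)\<bar> \<le> \<delta>" using h(2) by linarith
    then show ?thesis unfolding abs_mult using h(1) by simp
  qed
  have dec: "2 - \<kappa> * (h * Suc n) = 2 - \<kappa> * (h * n) - \<kappa> * h" by (simp add: algebra_simps)
  show ?case
  proof (cases "\<bar>x n - r\<bar> \<ge> \<delta>")
    case True
    then have k: "h * \<bar>R (x n)\<bar> \<ge> h * \<kappa>" using far[OF range] h by (intro mult_left_mono) auto
    have "\<bar>x (Suc n) - r\<bar> \<le> \<bar>x n - r\<bar> - h * \<kappa>"
    proof (cases "x n \<ge> r")
      case rx: True
      then have "R (x n) \<le> 0" by (rule above[OF range])
      then have "h * R (x n) = - (h * \<bar>R (x n)\<bar>)" by simp
      then show ?thesis using k True rx hR unfolding step by linarith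
    next
      case rx: False
      then have "R (x n) \<ge> 0" by (intro below[OF range]) auto
      then have "h * R (x n) = h * \<bar>R (x n)\<bar>" by simp
      then show ?thesis using k True rx hR unfolding step by linarith
    qed
    moreover have "h * \<kappa> \<ge> 0" using h \<open>\<kappa> \<ge> 0\<close> by simp
    ultimately have "\<bar>x (Suc n) - r\<bar> \<le> max \<delta> (2 - \<kappa> * (h * n) - h * \<kappa>)" using Suc.IH by linarith
    then show ?thesis unfolding dec by (simp only: mult.commute)
  next
    case False
    have "\<bar>x (Suc n) - r\<bar> \<le> \<delta>"
    proof (cases "x n \<ge> r")
      case rx: True
      then have "h * R (x n) \<le> 0" using above[OF range] h by (simp add: mult_nonneg_nonpos)
      then show ?thesis using hR False rx unfolding step by linarith
    next
      case rx: False
      then have "h * R (x n) \<ge> 0" using below[OF range] h by simp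
      then show ?thesis using hR False rx unfolding step by linarith
    qed
    then show ?thesis by (simp add: max_def)
  qed
qed

section \<open>Linearising the drift of the discrepancies\<close>

context glauber_exclusion
begin

lemma half_diff_local_0: "depends_on A g \<Longrightarrow> u \<notin> A \<Longrightarrow> spin_mean \<Lambda> \<rho> (half_diff u g) = 0"
  using half_diff_eq_0[of A g u] by (simp add: spin_mean_def)

text \<open>Russo's formula for the mean drift; sites outside \<open>nb a\<close> have no influence
  on it. The same sum is the mean net reproduction rate of a discrepancy in a Bernoulli environment,
  which is how the derivative of \<open>R\<close> enters the decay rate.\<close>

lemma R_deriv:
  assumes a: "a \<in> \<Lambda>"
  shows "(R has_real_derivative (\<Sum>v\<in>nb a. spin_mean \<Lambda> \<rho> (half_diff v (net_rate a)))) (at \<rho>)"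
proof -
  have "R = (\<lambda>\<rho>. spin_mean \<Lambda> \<rho> (net_rate a))"
    using R[OF a] by (simp add: net_rate_def[abs_def] fun_eq_iff)
  moreover have "(\<Sum>u\<in>\<Lambda>. spin_mean \<Lambda> \<rho> (half_diff u (net_rate a))) =
      (\<Sum>v\<in>nb a. spin_mean \<Lambda> \<rho> (half_diff v (net_rate a)))"
    using half_diff_local_0[OF net_rate_local[OF a]] nb_sub[OF a] finite_\<Lambda>
    by (intro sum.mono_neutral_right) auto
  ultimately show ?thesis using spin_mean_deriv[OF finite_\<Lambda>, of "net_rate a" \<rho>] by simp
qed

definition gap_at :: "'a \<Rightarrow> (nat \<Rightarrow> 'a \<Rightarrow> int) \<Rightarrow> real" where
  "gap_at w s = (of_int (s 2 w) - of_int (s 3 w)) / 2"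

text \<open>\<open>s 0\<close> is changed into \<open>s 1\<close> on \<open>B\<close> one site at a
  time: each discrepancy contributes its half difference at a mixed configuration. Replacing that
  configuration by \<open>s 2\<close> is wrong only if they differ elsewhere in \<open>B\<close>,
  and then the sandwich forces the extremal copies to differ there.\<close>

lemma discrepancy_linearization:
  assumes s: "good s" and B: "B \<subseteq> \<Lambda>" and f: "depends_on B f" "\<And>x. x \<in> spins \<Longrightarrow> \<bar>f x\<bar> \<le> K" and K: "K \<ge> 0"
  defines "d v \<equiv> (of_int (s 1 v) - of_int (s 0 v)) / 2 :: real"
  shows "\<bar>f (s 1) - f (s 0) - (\<Sum>v\<in>B. 2 * (d v * half_diff v f (s 2)))\<bar> \<le>
    4 * K * (\<Sum>v\<in>B. \<Sum>w\<in>B - {v}. d v * gap_at w s)"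
proof -
  have fin: "finite B" using B finite_\<Lambda> by (rule finite_subset)
  have sp: "s i \<in> spins" for i using s by (auto simp: good_def)
  have ord: "s 3 u \<le> s 0 u" "s 0 u \<le> s 1 u" "s 1 u \<le> s 2 u" if "u \<in> \<Lambda>" for u
    using s that by (auto simp: good_def)
  have gap0: "gap_at w s \<ge> 0" if "w \<in> \<Lambda>" for w using ord[OF that] by (simp add: gap_at_def)
  define mix where "mix S = (\<lambda>v. if v \<in> S then s 1 v else s 0 v)" for S
  have main: "\<bar>f (mix S) - f (s 0) - (\<Sum>v\<in>S. 2 * (d v * half_diff v f (s 2)))\<bar> \<le>
      4 * K * (\<Sum>v\<in>S. \<Sum>w\<in>B - {v}. d v * gap_at w s)" if "finite S" "S \<subseteq> B" for S
    using that
  proof (induction S rule: finite_induct)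
    case empty
    then show ?case by (simp add: mix_def)
  next
    case (insert v S)
    then have v: "v \<in> \<Lambda>" "v \<in> B" "v \<notin> S" and SB: "S \<subseteq> B" using B by auto
    have IH: "\<bar>f (mix S) - f (s 0) - (\<Sum>v\<in>S. 2 * (d v * half_diff v f (s 2)))\<bar> \<le>
      4 * K * (\<Sum>v\<in>S. \<Sum>w\<in>B - {v}. d v * gap_at w s)" using insert.IH SB by simp
    have mix_sp: "mix S \<in> spins" using sp[of 0] sp[of 1] SB B by (auto simp: mix_def PiE_iff extensional_def)
    have ins: "mix (insert v S) = (mix S)(v := s 1 v)" by (auto simp: mix_def)
    have mv: "mix S v = s 0 v" using v by (simp add: mix_def)
    have "\<bar>f (mix (insert v S)) - f (mix S) - 2 * (d v * half_diff v f (s 2))\<bar> \<le>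
        4 * K * (\<Sum>w\<in>B - {v}. d v * gap_at w s)"
    proof (cases "s 0 v = s 1 v")
      case True
      then have "mix (insert v S) = mix S" unfolding ins using mv by auto
      then show ?thesis using True by (simp add: d_def)
    next
      case False
      then have 01: "s 0 v = -1" "s 1 v = 1"
        using PiE_spin_cases[OF sp v(1), of 0] PiE_spin_cases[OF sp v(1), of 1] ord(2)[OF v(1)] by linarith+
      have "(mix S)(v := -1) = mix S" using mv 01 by auto
      then have "f (mix (insert v S)) - f (mix S) = 2 * half_diff v f (mix S)"
        unfolding ins 01 by (simp add: half_diff_def)
      moreover have d1: "d v = 1" unfolding d_def 01 by simp
      moreover have "\<bar>2 * half_diff v f (mix S) - 2 * half_diff v f (s 2)\<bar> \<le> 4 * K * (\<Sum>w\<in>B - {v}. gap_at w s)"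
      proof (cases "\<forall>w\<in>B - {v}. mix S w = s 2 w")
        case True
        then have "half_diff v f (mix S) = half_diff v f (s 2)"
          using depends_on_half_diff[OF f(1), of v] by (auto simp: depends_on_def)
        moreover have "(\<Sum>w\<in>B - {v}. gap_at w s) \<ge> 0" using gap0 B by (intro sum_nonneg) auto
        ultimately show ?thesis using K by simp
      next
        case False
        then obtain w where w: "w \<in> B - {v}" "mix S w \<noteq> s 2 w" by blast
        then have wL: "w \<in> \<Lambda>" using B by auto
        have "s 3 w \<noteq> s 2 w" using ord[OF wL] w(2) by (auto simp: mix_def split: if_splits)
        then have "gap_at w s = 1" using PiE_spin_cases[OF sp wL, of 2] PiE_spin_cases[OF sp wL, of 3] ord[OF wL]
          by (auto simp: gap_at_def)
        moreover have "gap_at w s \<le> (\<Sum>w\<in>B - {v}. gap_at w s)"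
          using gap0 B fin by (intro member_le_sum w(1)) auto
        ultimately have "4 * K * 1 \<le> 4 * K * (\<Sum>w\<in>B - {v}. gap_at w s)"
          using K by (intro mult_left_mono) auto
        moreover have "\<bar>half_diff v f x\<bar> \<le> K" if "x \<in> spins" for x
          by (rule half_diff_bound[OF f(2) v(1) that])
        then have "\<bar>half_diff v f (mix S)\<bar> \<le> K" "\<bar>half_diff v f (s 2)\<bar> \<le> K" using mix_sp sp by auto
        ultimately show ?thesis by linarith
      qed
      ultimately show ?thesis by simp
    qed
    with IH show ?case using insert.hyps by (simp add: algebra_simps)
  qed
  have "f (mix B) = f (s 1)" using f(1) by (auto simp: depends_on_def mix_def)
  with main[OF fin order.refl] show ?thesis by simp
qed

text \<open>Half of \<open>2 * b * K * \<beta> + 8 * cm * b^2 * \<beta>\<close> with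
  \<open>K = 2 * cm + 1\<close> and \<open>\<beta> = decor n * (2 * \<psi>m * b^3)\<close>, divided
  by \<open>decor n * \<psi>m\<close>.\<close>

definition recursion_const :: real where
  "recursion_const = 2 * (2 * cm + 1) * b ^ 4 + 8 * cm * b ^ 5"

end

context glauber_exclusion_chain
begin

lemma pair_observable_disc:
  assumes "a \<in> \<Lambda>"
  shows "pair_observable {a} (disc a)"
  using disc_bounds assms by (auto simp: pair_observable_def disc_def abs_le_iff dest: order.trans[rotated])

text \<open>Up to an error of order \<open>\<psi>m\<close>, decorrelation replaces the environment
  of a discrepancy by the Bernoulli measure of density \<open>dens 1 n\<close>. Using copy 2 instead
  of the true pair is paid by the difference of the two extremal densities, which is small after the
  burn-in.\<close>

lemma discs_recursion:
  assumes h_small: "h * step_const \<le> \<psi>m"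
  shows "discs (Suc n) \<le> discs n * (1 + h * (deriv R (dens 1 n) + 2 * cm * b\<^sup>2 * \<bar>dens 1 n - dens (-1) n\<bar>)) +
    h * (decor n * \<psi>m * recursion_const)"
proof -
  obtain a where a: "a \<in> \<Lambda>" using \<Lambda>_nonempty by blast
  let ?B = "nb a" and ?f = "net_rate a"
  define \<beta> where "\<beta> = decor n * (2 * \<psi>m * real b ^ 3)"
  \<comment> \<open>Bounds the half differences; the added 1 keeps it positive when
    \<open>cm\<close> is 0, so that dividing by it yields an \<open>observable\<close>.\<close>
  define K where "K = 2 * cm + 1"
  have K: "K > 0" using cm_nonneg by (simp add: K_def)
  have B: "?B \<subseteq> \<Lambda>" by (rule nb_sub[OF a])
  have finB: "finite ?B" by (rule finite_nb[OF a])
  have b: "real (card ?B) \<le> real b" using card_nb[OF a] by simp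
  have \<beta>0: "\<beta> \<ge> 0" using decor_nonneg \<psi>m_pos by (simp add: \<beta>_def)
  have bar: "decor n * barrier C \<le> \<beta>" if "C \<subseteq> ?B" for C
  proof -
    have "card C \<le> b" using card_mono[OF finB that] card_nb[OF a] by linarith
    then have "real (card C) ^ 3 \<le> real b ^ 3" by (intro power_mono) auto
    then have "2 * \<psi>m * real (card C) ^ 3 \<le> 2 * \<psi>m * real b ^ 3" using \<psi>m_pos by simp
    then have "barrier C \<le> 2 * \<psi>m * real b ^ 3" using barrier_le[of C] that B by fastforce
    then show ?thesis unfolding \<beta>_def using decor_nonneg by (intro mult_left_mono) auto
  qed
  have main: "S n (\<lambda>s. disc v s * half_diff v ?f (s 2)) \<le> discs n * spin_mean \<Lambda> (dens 1 n) (half_diff v ?f) + K * \<beta>"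
    if v: "v \<in> ?B" for v
  proof -
    have vL: "v \<in> \<Lambda>" using v B by auto
    define g where "g x = half_diff v ?f x / K" for x
    have "\<bar>g x\<bar> \<le> 1" if "x \<in> spins" for x
    proof -
      have "\<bar>half_diff v ?f x\<bar> \<le> K"
        using half_diff_bound[of \<Lambda> "net_rate a" "2 * cm" v x] net_rate_bound[OF a] vL that
        unfolding K_def by fastforce
      then show ?thesis using K by (simp add: g_def)
    qed
    moreover have "depends_on (?B - {v}) g"
      using depends_on_half_diff[OF net_rate_local[OF a], of v] unfolding depends_on_def g_def by metis
    ultimately have "observable (?B - {v}) g" by (simp add: observable_def)
    then have "\<bar>S n (\<lambda>s. disc v s * g (s 2)) - S n (disc v) * spin_mean \<Lambda> (dens 1 n) g\<bar> \<le>
        decor n * barrier ({v} \<union> (?B - {v}))"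
      using vL B by (intro decorrelation[OF h_small] pair_observable_disc) auto
    moreover have "{v} \<union> (?B - {v}) = ?B" using v by auto
    ultimately have 1: "S n (\<lambda>s. disc v s * g (s 2)) \<le> discs n * spin_mean \<Lambda> (dens 1 n) g + \<beta>"
      using bar[OF order.refl] unfolding S_disc[OF vL] by (simp only: abs_le_iff) linarith
    have Kg: "half_diff v ?f x = K * g x" for x using K by (simp add: g_def)
    have "S n (\<lambda>s. disc v s * half_diff v ?f (s 2)) = K * S n (\<lambda>s. disc v s * g (s 2))"
      unfolding S_cmult[symmetric] Kg by (simp only: mult.left_commute)
    also have "\<dots> \<le> K * (discs n * spin_mean \<Lambda> (dens 1 n) g + \<beta>)"
      using 1 K by (intro mult_left_mono) auto
    also have "\<dots> = discs n * (K * spin_mean \<Lambda> (dens 1 n) g) + K * \<beta>" by (simp add: algebra_simps)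
    also have "K * spin_mean \<Lambda> (dens 1 n) g = spin_mean \<Lambda> (dens 1 n) (half_diff v ?f)"
      unfolding spin_mean_cmult[symmetric] Kg ..
    finally show ?thesis .
  qed
  have gap: "S n (\<lambda>s. disc v s * gap_at w s) \<le> discs n * (\<bar>dens 1 n - dens (-1) n\<bar> / 2) + \<beta>"
    if v: "v \<in> ?B" and w: "w \<in> ?B - {v}" for v w
  proof -
    have vL: "v \<in> \<Lambda>" and wL: "w \<in> \<Lambda>" using v w B by auto
    have ob: "observable {w} (\<lambda>x. of_int (x w))"
      unfolding observable_def depends_on_def
    proof (intro conjI ballI)
      fix x assume "x \<in> spins"
      then have "x w = -1 \<or> x w = 1" using wL by (rule PiE_spin_cases)
      then show "\<bar>real_of_int (x w)\<bar> \<le> 1" by auto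
    qed auto
    have "{v} \<union> {w} \<subseteq> ?B" using v w by auto
    note br = bar[OF this]
    have sm: "S n (disc v) * spin_mean \<Lambda> \<rho> (\<lambda>x. of_int (x w)) = discs n * \<rho>" for \<rho>
      unfolding S_disc[OF vL] spin_mean_component[OF finite_\<Lambda> wL] ..
    have up: "\<bar>S n (\<lambda>s. disc v s * of_int (s 2 w)) - discs n * dens 1 n\<bar> \<le> \<beta>"
    proof (rule order.trans[OF _ br])
      show "\<bar>S n (\<lambda>s. disc v s * of_int (s 2 w)) - discs n * dens 1 n\<bar> \<le> decor n * barrier ({v} \<union> {w})"
        unfolding sm[symmetric] using vL wL w
        by (intro decorrelation[OF h_small _ _ _ _ pair_observable_disc ob]) auto
    qed
    have down: "\<bar>S n (\<lambda>s. disc v s * of_int (s 3 w)) - discs n * dens (-1) n\<bar> \<le> \<beta>"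
    proof (rule order.trans[OF _ br])
      show "\<bar>S n (\<lambda>s. disc v s * of_int (s 3 w)) - discs n * dens (-1) n\<bar> \<le> decor n * barrier ({v} \<union> {w})"
        unfolding sm[symmetric] using vL wL w
        by (intro decorrelation[OF h_small _ _ _ _ pair_observable_disc ob]) auto
    qed
    have arith: "x = (1 / 2) * (y - z) \<Longrightarrow> \<bar>y - y'\<bar> \<le> \<beta> \<Longrightarrow> \<bar>z - z'\<bar> \<le> \<beta> \<Longrightarrow> x \<le> (1 / 2) * (y' - z') + \<beta>"
      for x y z y' z' :: real by (simp add: abs_le_iff field_simps)
    have "S n (\<lambda>s. disc v s * gap_at w s) =
        (1 / 2) * (S n (\<lambda>s. disc v s * of_int (s 2 w)) - S n (\<lambda>s. disc v s * of_int (s 3 w)))"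
      unfolding S_diff[symmetric] S_cmult[symmetric] gap_at_def
      by (rule S_cong) (simp add: right_diff_distrib diff_divide_distrib)
    then have "S n (\<lambda>s. disc v s * gap_at w s) \<le> (1 / 2) * (discs n * dens 1 n - discs n * dens (-1) n) + \<beta>"
      using up down by (rule arith)
    also have "(1 / 2) * (discs n * dens 1 n - discs n * dens (-1) n) = discs n * ((dens 1 n - dens (-1) n) / 2)"
      by (simp add: algebra_simps)
    also have "\<dots> \<le> discs n * (\<bar>dens 1 n - dens (-1) n\<bar> / 2)"
      using discs_nonneg by (intro mult_left_mono divide_right_mono abs_ge_self) auto
    finally show ?thesis by simp
  qed
  define X where "X = discs n * (\<bar>dens 1 n - dens (-1) n\<bar> / 2) + \<beta>"
  have X0: "X \<ge> 0" unfolding X_def using \<beta>0 discs_nonneg by simp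
  have R': "(\<Sum>v\<in>?B. spin_mean \<Lambda> (dens 1 n) (half_diff v ?f)) = deriv R (dens 1 n)"
    using DERIV_imp_deriv[OF R_deriv[OF a]] by simp
  have "S n (\<lambda>s. ?f (s 1) - ?f (s 0)) \<le>
      S n (\<lambda>s. (\<Sum>v\<in>?B. 2 * (disc v s * half_diff v ?f (s 2))) +
        8 * cm * (\<Sum>v\<in>?B. \<Sum>w\<in>?B - {v}. disc v s * gap_at w s))"
  proof (rule S_mono)
    fix s assume s: "good s"
    from discrepancy_linearization[OF s B net_rate_local[OF a] net_rate_bound[OF a]] cm_nonneg
    show "?f (s 1) - ?f (s 0) \<le> (\<Sum>v\<in>?B. 2 * (disc v s * half_diff v ?f (s 2))) +
        8 * cm * (\<Sum>v\<in>?B. \<Sum>w\<in>?B - {v}. disc v s * gap_at w s)"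
      unfolding disc_def by (simp add: abs_le_iff) 
  qed
  also have "\<dots> = (\<Sum>v\<in>?B. 2 * S n (\<lambda>s. disc v s * half_diff v ?f (s 2))) +
      8 * cm * (\<Sum>v\<in>?B. \<Sum>w\<in>?B - {v}. S n (\<lambda>s. disc v s * gap_at w s))"
    using finB by (simp add: S_add S_cmult S_sum)
  also have "\<dots> \<le> (\<Sum>v\<in>?B. 2 * (discs n * spin_mean \<Lambda> (dens 1 n) (half_diff v ?f) + K * \<beta>)) +
      8 * cm * (\<Sum>v\<in>?B. \<Sum>w\<in>?B - {v}. X)"
    unfolding X_def using cm_nonneg by (intro add_mono sum_mono mult_left_mono main gap) auto
  also have "(\<Sum>v\<in>?B. \<Sum>w\<in>?B - {v}. X) \<le> (\<Sum>v\<in>?B. \<Sum>w\<in>?B. X)"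
    using finB X0 by (intro sum_mono sum_mono2) auto
  also have "(\<Sum>v\<in>?B. \<Sum>w\<in>?B. X) = real (card ?B) * real (card ?B) * X" by simp
  also have "\<dots> \<le> real b * real b * X" using b X0 by (intro mult_right_mono mult_mono) auto
  also have "(\<Sum>v\<in>?B. 2 * (discs n * spin_mean \<Lambda> (dens 1 n) (half_diff v ?f) + K * \<beta>)) =
      2 * discs n * deriv R (dens 1 n) + 2 * real (card ?B) * (K * \<beta>)"
    unfolding R'[symmetric] by (simp add: sum.distrib sum_distrib_left algebra_simps)
  also have "2 * real (card ?B) * (K * \<beta>) \<le> 2 * real b * (K * \<beta>)"
    using b K \<beta>0 by (intro mult_right_mono) auto
  finally have "S n (\<lambda>s. ?f (s 1) - ?f (s 0)) \<le>
      2 * discs n * deriv R (dens 1 n) + 2 * real b * (K * \<beta>) + 8 * cm * (real b * real b * X)"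
    using cm_nonneg by (simp add: mult_left_mono)
  then have le: "h * ((1 / 2) * S n (\<lambda>s. ?f (s 1) - ?f (s 0))) \<le>
      h * ((1 / 2) * (2 * discs n * deriv R (dens 1 n) + 2 * real b * (K * \<beta>) + 8 * cm * (real b * real b * X)))"
    using h_pos by (intro mult_left_mono) auto
  have half: "S n (\<lambda>s. (?f (s 1) - ?f (s 0)) / 2) = (1 / 2) * S n (\<lambda>s. ?f (s 1) - ?f (s 0))"
    unfolding S_cmult[symmetric] by simp
  have "discs (Suc n) \<le> discs n +
      h * ((1 / 2) * (2 * discs n * deriv R (dens 1 n) + 2 * real b * (K * \<beta>) + 8 * cm * (real b * real b * X)))"
    unfolding discs_Suc[OF a] half using le by (rule add_left_mono)
  also have "\<dots> = discs n * (1 + h * (deriv R (dens 1 n) + 2 * cm * b\<^sup>2 * \<bar>dens 1 n - dens (-1) n\<bar>)) +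
      h * (decor n * \<psi>m * recursion_const)"
    by (simp add: X_def \<beta>_def K_def recursion_const_def algebra_simps power2_eq_square power3_eq_cube eval_nat_numeral)
  finally show ?thesis .
qed

text \<open>Crude growth until \<open>n0\<close>, contraction by \<open>1 - h * l\<close>
  afterwards. The level \<open>\<eta> * discs 0\<close> reproduces itself, as
  \<open>(1 - h * l) * \<eta> + h * l * \<eta> = \<eta>\<close>, so the errors do not
  accumulate.\<close>

lemma discs_decay:
  assumes h_small: "h * step_const \<le> \<psi>m" and l: "l > 0" "h * l \<le> 1"
    and contract: "\<And>n. n \<ge> n0 \<Longrightarrow> deriv R (dens 1 n) + 2 * cm * b\<^sup>2 * \<bar>dens 1 n - dens (-1) n\<bar> \<le> - l"
    and N: "n0 \<le> N"
    and err: "decor_const * exp (decor_rate * (h * N)) * \<psi>m * recursion_const \<le> l * \<eta>"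
  shows "discs N \<le> (exp ((2 * cm * b) * (h * n0)) * exp (- l * (h * (N - n0))) + \<eta>) * discs 0"
proof -
  have ex: "(1 + h * a) ^ n \<le> exp (a * (h * n))" if "a \<ge> 0" for a n
  proof -
    have "(1 + h * a) ^ n \<le> exp (h * a) ^ n"
      using that h_pos by (intro power_mono) (auto simp: add.commute exp_ge_add_one_self)
    also have "\<dots> = exp (a * (h * n))" by (simp add: exp_of_nat_mult[symmetric] mult_ac)
    finally show ?thesis .
  qed
  have decN: "decor n * \<psi>m * recursion_const \<le> l * \<eta> * discs 0" if "n \<le> N" for n
  proof -
    have rc: "recursion_const \<ge> 0" using cm_nonneg by (simp add: recursion_const_def)
    have "(1 + h * decor_rate) ^ n \<le> exp (decor_rate * (h * n))" by (rule ex) (rule decor_rate_ge)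
    also have "\<dots> \<le> exp (decor_rate * (h * N))"
      using that h_pos decor_rate_ge by (auto intro!: mult_left_mono)
    finally have "decor n \<le> decor_const * discs 0 * exp (decor_rate * (h * N))"
      unfolding decor_def using decor_const_ge discs_nonneg[of 0] by (intro mult_left_mono) auto
    then have "decor n * (\<psi>m * recursion_const) \<le> decor_const * discs 0 * exp (decor_rate * (h * N)) * (\<psi>m * recursion_const)"
      using rc \<psi>m_pos by (intro mult_right_mono) auto
    also have "\<dots> = (decor_const * exp (decor_rate * (h * N)) * \<psi>m * recursion_const) * discs 0"
      by (simp add: mult_ac)
    also have "\<dots> \<le> (l * \<eta>) * discs 0" using err discs_nonneg by (intro mult_right_mono) auto
    finally show ?thesis by (simp add: mult_ac)
  qed
  have "n0 + k \<le> N \<Longrightarrow> discs (n0 + k) \<le> (1 - h * l) ^ k * discs n0 + \<eta> * discs 0" for k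
  proof (induction k)
    case 0
    have "0 \<le> decor 0 * \<psi>m * recursion_const"
      using decor_nonneg[of 0] \<psi>m_pos cm_nonneg by (simp add: recursion_const_def)
    also have "\<dots> \<le> l * \<eta> * discs 0" by (rule decN) simp
    finally have "\<eta> * discs 0 \<ge> 0" using l by (simp add: mult.assoc zero_le_mult_iff)
    then show ?case by simp
  next
    case (Suc k)
    let ?n = "n0 + k"
    have IH: "discs ?n \<le> (1 - h * l) ^ k * discs n0 + \<eta> * discs 0" using Suc by simp
    have "discs (Suc ?n) \<le> discs ?n * (1 + h * (deriv R (dens 1 ?n) + 2 * cm * b\<^sup>2 * \<bar>dens 1 ?n - dens (-1) ?n\<bar>)) +
        h * (decor ?n * \<psi>m * recursion_const)" by (rule discs_recursion[OF h_small])
    also have "\<dots> \<le> discs ?n * (1 + h * (- l)) + h * (l * \<eta> * discs 0)"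
      using contract[of ?n] decN[of ?n] Suc.prems h_pos discs_nonneg
      by (intro add_mono mult_left_mono) auto
    also have "discs ?n * (1 + h * (- l)) \<le> ((1 - h * l) ^ k * discs n0 + \<eta> * discs 0) * (1 + h * (- l))"
      using IH l by (intro mult_right_mono) auto
    finally show ?case by (simp add: algebra_simps)
  qed
  from this[of "N - n0"] N have "discs N \<le> (1 - h * l) ^ (N - n0) * discs n0 + \<eta> * discs 0" by simp
  also have "(1 - h * l) ^ (N - n0) * discs n0 \<le> exp (- l * (h * (N - n0))) * (exp ((2 * cm * b) * (h * n0)) * discs 0)"
  proof (rule mult_mono)
    have "(1 - h * l) ^ (N - n0) \<le> exp (- (h * l)) ^ (N - n0)"
      using l exp_ge_add_one_self[of "- (h * l)"] by (intro power_mono) auto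
    then show "(1 - h * l) ^ (N - n0) \<le> exp (- l * (h * (N - n0)))"
      by (simp add: exp_of_nat_mult[symmetric] mult_ac)
    have "discs n0 \<le> (1 + h * (2 * cm * b)) ^ n0 * discs 0" by (rule discs_growth)
    also have "\<dots> \<le> exp ((2 * cm * b) * (h * n0)) * discs 0"
      using cm_nonneg discs_nonneg by (intro mult_right_mono ex) auto
    finally show "discs n0 \<le> exp ((2 * cm * b) * (h * n0)) * discs 0" .
  qed (use discs_nonneg in auto)
  finally show ?thesis by (simp add: algebra_simps)
qed

end

section \<open>Eigenfunctions along the coupling\<close>

context glauber_exclusion_chain
begin

lemma T_funpow_sum: "finite I \<Longrightarrow> (T ^^ n) (\<lambda>s. \<Sum>i\<in>I. F i s) s = (\<Sum>i\<in>I. (T ^^ n) (F i) s)"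
proof (induction I arbitrary: s rule: finite_induct)
  case empty
  show ?case using T_funpow_cmult[of n 0 "\<lambda>s. 0"] by (simp add: fun_eq_iff)
next
  case (insert i I)
  then show ?case using T_funpow_add[of n "F i" "\<lambda>s. \<Sum>i\<in>I. F i s"] by simp
qed

text \<open>One time step maps the increment \<open>\<phi> (s 1) - \<phi> (s 0)\<close> to
  \<open>1 - h * z\<close> times itself. As the step is a convex combination, the triangle
  inequality lets the bound by \<open>disc\<close> be iterated.\<close>

lemma eigenfunction_discrepancy:
  fixes \<phi> :: "('a \<Rightarrow> int) \<Rightarrow> complex" and z :: complex
  assumes eig: "\<And>x. x \<in> spins \<Longrightarrow> (\<Sum>e\<in>events. rate e *\<^sub>R (\<phi> (act e x) - \<phi> x)) = - z * \<phi> x"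
    and M: "\<And>s. good s \<Longrightarrow> cmod (\<phi> (s 1) - \<phi> (s 0)) \<le> M * (\<Sum>a\<in>\<Lambda>. disc a s)"
  shows "good s \<Longrightarrow> cmod (1 - h * z) ^ n * cmod (\<phi> (s 1) - \<phi> (s 0)) \<le> M * (T ^^ n) (\<lambda>s. \<Sum>a\<in>\<Lambda>. disc a s) s"
proof (induction n arbitrary: s)
  case 0
  then show ?case using M by simp
next
  case (Suc n)
  let ?D = "\<lambda>s. \<phi> (s 1) - \<phi> (s 0)" and ?F = "\<lambda>s. \<Sum>a\<in>\<Lambda>. disc a s"
  have s: "s 0 \<in> spins" "s 1 \<in> spins" using Suc.prems by (auto simp: good_def)
  have "of_real h * (\<Sum>e\<in>events. rate e *\<^sub>R (?D (acts e s) - ?D s)) =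
      of_real h * ((\<Sum>e\<in>events. rate e *\<^sub>R (\<phi> (act e (s 1)) - \<phi> (s 1))) -
        (\<Sum>e\<in>events. rate e *\<^sub>R (\<phi> (act e (s 0)) - \<phi> (s 0))))"
    unfolding sum_subtractf[symmetric] acts_def by (simp add: algebra_simps)
  also have "\<dots> = - (h * z) * ?D s"
    unfolding eig[OF s(1)] eig[OF s(2)] by (simp add: algebra_simps)
  finally have "(1 - h * z) * ?D s = ?D s + of_real h * (\<Sum>e\<in>events. rate e *\<^sub>R (?D (acts e s) - ?D s))"
    by (simp add: algebra_simps)
  also have "\<dots> = of_real (1 - h * total_rate) * ?D s + of_real h * (\<Sum>e\<in>events. rate e *\<^sub>R ?D (acts e s))"
  proof -
    have "(\<Sum>e\<in>events. rate e *\<^sub>R (?D (acts e s) - ?D s)) =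
        (\<Sum>e\<in>events. rate e *\<^sub>R ?D (acts e s)) - total_rate *\<^sub>R ?D s"
      unfolding scaleR_diff_right sum_subtractf total_rate_def scaleR_left.sum ..
    moreover have "d + of_real h * (A - total_rate *\<^sub>R d) = of_real (1 - h * total_rate) * d + of_real h * A"
      for d A :: complex by (simp add: scaleR_conv_of_real algebra_simps)
    ultimately show ?thesis by (simp only:)
  qed
  finally have eq: "(1 - h * z) * ?D s =
      of_real (1 - h * total_rate) * ?D s + of_real h * (\<Sum>e\<in>events. rate e *\<^sub>R ?D (acts e s))" .
  have "cmod (1 - h * z) * cmod (?D s) = cmod (of_real (1 - h * total_rate) * ?D s +
      of_real h * (\<Sum>e\<in>events. rate e *\<^sub>R ?D (acts e s)))"
    unfolding eq[symmetric] by (rule norm_mult[symmetric])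
  also have "\<dots> \<le> cmod (of_real (1 - h * total_rate) * ?D s) + cmod (of_real h * (\<Sum>e\<in>events. rate e *\<^sub>R ?D (acts e s)))"
    by (rule norm_triangle_ineq)
  also have "cmod (of_real (1 - h * total_rate) * ?D s) = (1 - h * total_rate) * cmod (?D s)"
    unfolding norm_mult norm_of_real using h_rate by simp
  also have "cmod (of_real h * (\<Sum>e\<in>events. rate e *\<^sub>R ?D (acts e s))) = h * cmod (\<Sum>e\<in>events. rate e *\<^sub>R ?D (acts e s))"
    unfolding norm_mult norm_of_real using h_pos by simp
  also have "cmod (\<Sum>e\<in>events. rate e *\<^sub>R ?D (acts e s)) \<le> (\<Sum>e\<in>events. rate e * cmod (?D (acts e s)))"
    by (rule sum_norm_le) (use rate_nonneg in auto)
  finally have "cmod (1 - h * z) * cmod (?D s) \<le>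
      (1 - h * total_rate) * cmod (?D s) + h * (\<Sum>e\<in>events. rate e * cmod (?D (acts e s)))"
    using h_pos by (simp add: mult_left_mono)
  then have "cmod (1 - h * z) ^ n * (cmod (1 - h * z) * cmod (?D s)) \<le> cmod (1 - h * z) ^ n *
      ((1 - h * total_rate) * cmod (?D s) + h * (\<Sum>e\<in>events. rate e * cmod (?D (acts e s))))"
    by (intro mult_left_mono) auto
  also have "\<dots> = (1 - h * total_rate) * (cmod (1 - h * z) ^ n * cmod (?D s)) +
      h * (\<Sum>e\<in>events. rate e * (cmod (1 - h * z) ^ n * cmod (?D (acts e s))))"
    by (simp add: algebra_simps sum_distrib_left)
  also have "\<dots> \<le> (1 - h * total_rate) * (M * (T ^^ n) ?F s) + h * (\<Sum>e\<in>events. rate e * (M * (T ^^ n) ?F (acts e s)))"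
    using Suc.IH Suc.prems acts_good h_pos h_rate
    by (intro add_mono mult_left_mono sum_mono rate_nonneg) auto
  also have "\<dots> = M * T ((T ^^ n) ?F) s"
    unfolding T_eq by (simp add: algebra_simps sum_distrib_left)
  finally show ?case by (simp add: mult_ac)
qed

lemma eigenvalue_discs:
  fixes \<phi> :: "('a \<Rightarrow> int) \<Rightarrow> complex" and z :: complex
  assumes "\<And>x. x \<in> spins \<Longrightarrow> (\<Sum>e\<in>events. rate e *\<^sub>R (\<phi> (act e x) - \<phi> x)) = - z * \<phi> x"
    and "\<And>s. good s \<Longrightarrow> cmod (\<phi> (s 1) - \<phi> (s 0)) \<le> M * (\<Sum>a\<in>\<Lambda>. disc a s)"
  shows "cmod (1 - h * z) ^ n * cmod (\<phi> (s0 1) - \<phi> (s0 0)) \<le> M * discs n"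
  using eigenfunction_discrepancy[OF assms s0_good, of n] by (simp add: discs_def T_funpow_sum finite_\<Lambda>)

end

context glauber_exclusion
begin

text \<open>The chain starts from an ordered pair at which \<open>\<phi>\<close> attains its largest
  increment per discrepancy. The bound with \<open>M\<close> then holds along the chain and is an
  equality at the start, so \<open>M\<close> cancels and \<open>cmod (1 - h * z) ^ N \<le> q\<close>
  remains; letting the step go to 0 turns this into an exponential.\<close>

lemma eigenvalue_bound:
  fixes \<phi> :: "('a \<Rightarrow> int) \<Rightarrow> complex" and z :: complex
  assumes eig: "\<And>x. x \<in> spins \<Longrightarrow> (\<Sum>e\<in>events. rate e *\<^sub>R (\<phi> (act e x) - \<phi> x)) = - z * \<phi> x"
    and nonconst: "x1 \<in> spins" "y1 \<in> spins" "\<phi> x1 \<noteq> \<phi> y1"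
    and above: "\<And>\<rho>. \<rho> \<in> {-1..1} \<Longrightarrow> \<rho> \<ge> r \<Longrightarrow> R \<rho> \<le> 0"
    and below: "\<And>\<rho>. \<rho> \<in> {-1..1} \<Longrightarrow> \<rho> \<le> r \<Longrightarrow> R \<rho> \<ge> 0"
    and far: "\<And>\<rho>. \<rho> \<in> {-1..1} \<Longrightarrow> \<bar>\<rho> - r\<bar> \<ge> \<delta> \<Longrightarrow> \<bar>R \<rho>\<bar> \<ge> \<mu>"
    and r: "r \<in> {-1..1}" and \<delta>: "\<delta> > 0" and \<mu>: "\<mu> > 0" and l: "l > 0"
    and contract: "\<And>\<rho>1 \<rho>2. \<rho>1 \<in> {-1..1} \<Longrightarrow> \<rho>2 \<in> {-1..1} \<Longrightarrow> \<bar>\<rho>1 - r\<bar> \<le> \<delta> \<Longrightarrow> \<bar>\<rho>2 - r\<bar> \<le> \<delta> \<Longrightarrow>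
      deriv R \<rho>1 + 2 * cm * b\<^sup>2 * \<bar>\<rho>1 - \<rho>2\<bar> \<le> - l"
    and t: "2 / \<mu> + 1 \<le> t"
    and err: "decor_const * exp (decor_rate * t) * \<psi>m * recursion_const \<le> l * exp (- l * t)"
  shows "exp (- Re z * t) \<le> (exp ((2 * cm * b + l) * (2 / \<mu> + 1)) + 1) * exp (- l * t)"
proof -
  define top where "top = (\<lambda>u\<in>\<Lambda>. 1 :: int)"
  define bot where "bot = (\<lambda>u\<in>\<Lambda>. -1 :: int)"
  have tb: "top \<in> spins" "bot \<in> spins" by (auto simp: top_def bot_def)
  have ext: "\<exists>u\<in>\<Lambda>. x u \<noteq> y u" if "x \<in> spins" "y \<in> spins" "x \<noteq> y" for x y
    using that by (metis PiE_ext)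
  define P where "P = {p \<in> spins \<times> spins. fst p \<noteq> snd p \<and> (\<forall>u\<in>\<Lambda>. fst p u \<le> snd p u)}"
  define dist where "dist p = (\<Sum>u\<in>\<Lambda>. (of_int (snd p u) - of_int (fst p u)) / 2 :: real)" for p :: "('a \<Rightarrow> int) \<times> ('a \<Rightarrow> int)"
  define f where "f p = cmod (\<phi> (snd p) - \<phi> (fst p)) / dist p" for p
  have dist_pos: "dist p > 0" if p: "p \<in> P" for p
  proof -
    obtain u where u: "u \<in> \<Lambda>" "fst p u \<noteq> snd p u" using p ext[of "fst p" "snd p"] by (auto simp: P_def)
    show ?thesis unfolding dist_def
    proof (rule sum_pos2[OF finite_\<Lambda> u(1)])
      show "0 < (of_int (snd p u) - of_int (fst p u)) / (2 :: real)"
        using p u by (auto simp: P_def order_le_less)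
    qed (use p in \<open>auto simp: P_def\<close>)
  qed
  have finP: "finite P" unfolding P_def by (rule finite_subset[of _ "spins \<times> spins"]) (auto intro: finite_spins finite_\<Lambda>)
  \<comment> \<open>If all values agreed with the one at \<open>top\<close>, \<open>\<phi>\<close>
    would be constant. Every configuration lies below \<open>top\<close>, so this gives an ordered
    pair with different values.\<close>
  obtain x2 where x2: "x2 \<in> spins" "\<phi> x2 \<noteq> \<phi> top" using nonconst by metis
  have le_top: "x u \<le> top u" "bot u \<le> x u" if "x \<in> spins" "u \<in> \<Lambda>" for x u
    using PiE_spin_cases[OF that] that by (auto simp: top_def bot_def)
  have p2: "(x2, top) \<in> P" using x2 tb le_top by (auto simp: P_def)
  define M where "M = Max (f ` P)"
  have "M \<in> f ` P" unfolding M_def using finP p2 by (intro Max_in) auto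
  then obtain p where p: "p \<in> P" "f p = M" by auto
  have fM: "f q \<le> M" if "q \<in> P" for q unfolding M_def using finP that by simp
  have "f (x2, top) > 0" using x2 dist_pos[OF p2] by (simp add: f_def)
  then have M_pos: "M > 0" using fM[OF p2] by simp
  define x y where "x = fst p" and "y = snd p"
  have xy: "x \<in> spins" "y \<in> spins" "\<And>u. u \<in> \<Lambda> \<Longrightarrow> x u \<le> y u" using p by (auto simp: P_def x_def y_def)
  define s0 where "s0 i = (if i = 1 then y else if i = 2 then top else if i = 3 then bot else x)" for i :: nat
  have s0: "s0 0 = x" "s0 1 = y" "s0 2 = top" "s0 3 = bot" by (simp_all add: s0_def)
  have s0_good: "good s0" unfolding good_def s0
  proof (intro conjI allI ballI)
    show "s0 i \<in> spins" for i using xy tb by (simp add: s0_def)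
  qed (use xy le_top in auto)
  define q where "q = (exp ((2 * cm * b + l) * (2 / \<mu> + 1)) + 1) * exp (- l * t)"
  have t_pos: "t > 0" using t \<mu> by (smt (verit) divide_pos_pos)
  \<comment> \<open>With \<open>N \<ge> C + t * stc / \<psi>m\<close>, all smallness conditions on
    \<open>h = t / N\<close> hold at once; each summand serves one of them.\<close>
  define C where "C = 1 + t * total_rate + t * (2 * cm) / \<delta> + t * \<bar>Re z\<bar> + t * l + t"
  define stc where "stc = 4 * cm\<^sup>2 * real (card \<Lambda>) ^ 3 + 4 * cm * total_rate * real (card \<Lambda>) ^ 2"
  have main: "(1 + (- Re z * t) / N) ^ N \<le> q" if N: "real N \<ge> C + t * stc / \<psi>m" for N :: nat
  proof -
    define h where "h = t / N"
    have nn: "t * total_rate \<ge> 0" "t * (2 * cm) / \<delta> \<ge> 0" "t * \<bar>Re z\<bar> \<ge> 0" "t * l \<ge> 0" "t * stc / \<psi>m \<ge> 0"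
      using t_pos total_rate_nonneg cm_nonneg \<delta> l \<psi>m_pos by (auto simp: stc_def)
    have N_ge: "real N \<ge> 1" "real N \<ge> t * total_rate" "real N \<ge> t * (2 * cm) / \<delta>" "real N \<ge> t * \<bar>Re z\<bar>"
      "real N \<ge> t * l" "real N \<ge> t" "real N \<ge> t * stc / \<psi>m"
      using N nn t_pos unfolding C_def by linarith+
    then have N0: "real N > 0" by linarith
    have h: "h > 0" "h * total_rate \<le> 1" "h * (2 * cm) \<le> \<delta>" "h * \<bar>Re z\<bar> \<le> 1" "h * l \<le> 1" "h \<le> 1" "h * stc \<le> \<psi>m"
      using N_ge N0 t_pos \<delta> \<psi>m_pos unfolding h_def by (auto simp: divide_simps mult.commute)
    have hN: "h * N = t" using N0 by (simp add: h_def)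
    interpret ch: glauber_exclusion_chain \<Lambda> E \<kappa> nb c R V wt cm b \<psi> \<psi>m G tr h s0
      by unfold_locales (use h s0_good s0 in \<open>auto simp: top_def bot_def\<close>)
    \<comment> \<open>Burn-in: the densities approach the root at speed at least
      \<open>\<mu>\<close> until they are within \<open>\<delta>\<close>, so time
      \<open>2 / \<mu>\<close> suffices. Rounding up costs at most one step, hence the
      \<open>+ 1\<close> in the final constant.\<close>
    define n0 where "n0 = nat \<lceil>(2 / \<mu>) / h\<rceil>"
    have n0: "real n0 \<ge> (2 / \<mu>) / h" "real n0 \<le> (2 / \<mu>) / h + 1"
      unfolding n0_def using h \<mu> by (auto simp: of_nat_nat intro: less_imp_le) 
    have hn0: "2 / \<mu> \<le> h * n0" "h * n0 \<le> 2 / \<mu> + 1"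
    proof -
      have "h * ((2 / \<mu>) / h) \<le> h * n0" "h * n0 \<le> h * ((2 / \<mu>) / h + 1)"
        using mult_left_mono[OF n0(1), of h] mult_left_mono[OF n0(2), of h] h(1) by linarith+
      moreover have "h * ((2 / \<mu>) / h) = 2 / \<mu>" using h by simp
      ultimately show "2 / \<mu> \<le> h * n0" "h * n0 \<le> 2 / \<mu> + 1" using h(6) by (simp_all add: distrib_left)
    qed
    have "h * n0 \<le> h * N" using hn0(2) t hN by linarith
    then have n0N: "n0 \<le> N" using h by simp
    have near: "\<bar>ch.dens s n - r\<bar> \<le> \<delta>" "ch.dens s n \<in> {-1..1}" if "n \<ge> n0" and s: "s = 1 \<or> s = -1" for s n
    proof -
      have sr: "s \<in> {-1..1}" using s by auto
      show "ch.dens s n \<in> {-1..1}" using ch.dens_range[OF sr] .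
      have "\<bar>ch.dens s n - r\<bar> \<le> max \<delta> (2 - \<mu> * (h * n))"
      proof (rule discrete_flow_near_root[where R = R and M = "2 * cm"])
        show "ch.dens s (Suc n) = ch.dens s n + h * R (ch.dens s n)" for n by (rule ch.dens_Suc)
        show "ch.dens s n \<in> {-1..1}" for n using ch.dens_range[OF sr] .
        show "\<bar>R \<rho>\<bar> \<le> 2 * cm" if "\<rho> \<in> {-1..1}" for \<rho> by (rule R_bounds(3)[OF that])
      qed (use h above below far r \<delta> \<mu> in auto)
      moreover have "2 \<le> \<mu> * (h * n)"
      proof -
        have "2 = \<mu> * (2 / \<mu>)" using \<mu> by simp
        also have "\<dots> \<le> \<mu> * (h * n0)" using hn0 \<mu> by (intro mult_left_mono) auto
        also have "\<dots> \<le> \<mu> * (h * n)" using that \<mu> h by (intro mult_left_mono) auto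
        finally show ?thesis .
      qed
      ultimately show "\<bar>ch.dens s n - r\<bar> \<le> \<delta>" using \<delta> by (auto simp: max_def split: if_splits)
    qed
    have "ch.discs N \<le> (exp ((2 * cm * b) * (h * n0)) * exp (- l * (h * (N - n0))) + exp (- l * t)) * ch.discs 0"
    proof (rule ch.discs_decay)
      show "h * ch.step_const \<le> \<psi>m" using h(7) by (simp add: ch.step_const_def stc_def)
      show "deriv R (ch.dens 1 n) + 2 * cm * b\<^sup>2 * \<bar>ch.dens 1 n - ch.dens (-1) n\<bar> \<le> - l" if "n \<ge> n0" for n
        by (intro contract near that) auto
      show "decor_const * exp (decor_rate * (h * N)) * \<psi>m * recursion_const \<le> l * exp (- l * t)"
        using err unfolding hN .
    qed (use l h n0N in auto)
    also have "\<dots> \<le> q * ch.discs 0"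
    proof (rule mult_right_mono[OF _ ch.discs_nonneg])
      have "exp ((2 * cm * b) * (h * n0)) \<le> exp ((2 * cm * b) * (2 / \<mu> + 1))"
        using hn0 cm_nonneg by (auto intro!: mult_left_mono)
      moreover have "exp (- l * (h * (N - n0))) \<le> exp (l * (2 / \<mu> + 1)) * exp (- l * t)"
      proof -
        have "h * (N - n0) = t - h * n0" using n0N hN by (simp add: of_nat_diff right_diff_distrib)
        then have "l * (h * (N - n0)) \<ge> l * (t - (2 / \<mu> + 1))" using hn0 l by (intro mult_left_mono) auto
        then show ?thesis unfolding exp_add[symmetric] by (simp add: algebra_simps)
      qed
      ultimately have "exp ((2 * cm * b) * (h * n0)) * exp (- l * (h * (N - n0))) \<le>
          exp ((2 * cm * b) * (2 / \<mu> + 1)) * (exp (l * (2 / \<mu> + 1)) * exp (- l * t))"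
        by (intro mult_mono) auto
      also have "\<dots> = exp ((2 * cm * b + l) * (2 / \<mu> + 1)) * exp (- l * t)"
        by (simp add: distrib_right exp_add mult.assoc)
      finally show "exp ((2 * cm * b) * (h * n0)) * exp (- l * (h * (N - n0))) + exp (- l * t) \<le> q"
        by (simp add: q_def algebra_simps)
    qed
    finally have dN: "ch.discs N \<le> q * ch.discs 0" .
    have d0: "ch.discs 0 = dist p"
      unfolding ch.discs_def funpow_0 ch.disc_def dist_def s0 x_def y_def ..
    have Mb: "cmod (\<phi> (s 1) - \<phi> (s 0)) \<le> M * (\<Sum>a\<in>\<Lambda>. ch.disc a s)" if s: "good s" for s
    proof (cases "s 0 = s 1")
      case True
      then show ?thesis using M_pos ch.disc_bounds[OF s] by (auto intro!: mult_nonneg_nonneg sum_nonneg)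
    next
      case False
      then have sP: "(s 0, s 1) \<in> P" using s by (auto simp: P_def good_def)
      have "(\<Sum>a\<in>\<Lambda>. ch.disc a s) = dist (s 0, s 1)" by (simp add: ch.disc_def dist_def)
      moreover have "f (s 0, s 1) * dist (s 0, s 1) \<le> M * dist (s 0, s 1)"
        using fM[OF sP] dist_pos[OF sP] by (intro mult_right_mono) auto
      ultimately show ?thesis using dist_pos[OF sP] by (simp add: f_def)
    qed
    have "cmod (1 - h * z) ^ N * cmod (\<phi> (s0 1) - \<phi> (s0 0)) \<le> M * ch.discs N"
      by (rule ch.eigenvalue_discs[OF eig Mb])
    also have "\<dots> \<le> M * (q * dist p)" using dN M_pos unfolding d0 by (intro mult_left_mono) auto
    also have "\<dots> = q * cmod (\<phi> y - \<phi> x)"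
      unfolding p(2)[symmetric] f_def x_def y_def using dist_pos[OF p(1)] by simp
    finally have "cmod (1 - h * z) ^ N * cmod (\<phi> y - \<phi> x) \<le> q * cmod (\<phi> y - \<phi> x)" unfolding s0 .
    moreover have "cmod (\<phi> y - \<phi> x) > 0"
    proof -
      have "f p > 0" using p M_pos by simp
      then show ?thesis using dist_pos[OF p(1)] by (simp add: f_def x_def y_def zero_less_divide_iff)
    qed
    ultimately have cq: "cmod (1 - h * z) ^ N \<le> q" by simp
    \<comment> \<open>The real part bounds the modulus from below and is nonnegative for small
      \<open>h\<close>, so the powers compare too.\<close>
    have "1 + (- Re z * t) / N = Re (1 - h * z)" by (simp add: h_def)
    then have le: "1 + (- Re z * t) / N \<le> cmod (1 - h * z)" using complex_Re_le_cmod by metis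
    have "h * Re z \<le> 1" using h(1,4) by (smt (verit) mult_left_mono)
    then have "1 + (- Re z * t) / N \<ge> 0" by (simp add: h_def mult.commute)
    then have "(1 + (- Re z * t) / N) ^ N \<le> cmod (1 - h * z) ^ N" by (rule power_mono[OF le])
    with cq show ?thesis by linarith
  qed
  have "(\<lambda>N. (1 + (- Re z * t) / N) ^ N) \<longlonglongrightarrow> exp (- Re z * t)"
    by (rule tendsto_exp_limit_sequentially)
  moreover have "\<exists>N0. \<forall>N\<ge>N0. (1 + (- Re z * t) / N) ^ N \<le> q"
  proof -
    obtain N0 :: nat where "real N0 \<ge> C + t * stc / \<psi>m" using real_arch_simple by blast
    then have "(1 + (- Re z * t) / N) ^ N \<le> q" if "N \<ge> N0" for N
      using that by (intro main) (meson of_nat_mono order.trans)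
    then show ?thesis by blast
  qed
  ultimately show ?thesis unfolding q_def[symmetric] by (rule LIMSEQ_le_const2)
qed

end

section \<open>Finiteness of the spectrum\<close>

text \<open>Transport along an enumeration of \<open>I\<close>, so that spectral theory of
  number-indexed matrices applies.\<close>

lemma finite_index_matrix:
  fixes M :: "'a \<Rightarrow> 'a \<Rightarrow> complex"
  assumes "finite I"
  obtains A where "A \<in> carrier_mat (card I) (card I)"
    and "spectrum A = {z. \<exists>\<phi>. (\<exists>x\<in>I. \<phi> x \<noteq> 0) \<and> (\<forall>x\<in>I. (\<Sum>y\<in>I. M x y * \<phi> y) = z * \<phi> x)}"
proof -
  define n where "n = card I"
  obtain f where f: "bij_betw f {0..<n} I"
    using ex_bij_betw_nat_finite[OF assms] n_def by blast
  define g where "g = the_inv_into {0..<n} f"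
  have g: "bij_betw g I {0..<n}" unfolding g_def by (rule bij_betw_the_inv_into[OF f])
  have fg: "f (g x) = x" if "x \<in> I" for x
    unfolding g_def using f that by (metis bij_betw_def f_the_inv_into_f)
  have gf: "g (f i) = i" if "i < n" for i
    unfolding g_def using f that by (simp add: bij_betw_def the_inv_into_f_f)
  have fI: "f i \<in> I" if "i < n" for i using f that by (auto simp: bij_betw_def)
  have gI: "g x < n" if "x \<in> I" for x using g that by (auto simp: bij_betw_def)
  define A where "A = mat n n (\<lambda>(i, j). M (f i) (f j))"
  have A: "A \<in> carrier_mat n n" by (simp add: A_def)
  have row: "(\<Sum>y\<in>I. M (f i) y * \<phi> y) = (\<Sum>j<n. M (f i) (f j) * \<phi> (f j))" for i \<phi>
    using sum.reindex_bij_betw[OF f, of "\<lambda>y. M (f i) y * \<phi> y"] by (simp add: atLeast0LessThan)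
  have mv: "vec_index (A *\<^sub>v v) i = (\<Sum>j<n. M (f i) (f j) * vec_index v j)"
    if "v \<in> carrier_vec n" "i < n" for v i
    using that by (simp add: A_def scalar_prod_def atLeast0LessThan)
  have "spectrum A = {z. \<exists>\<phi>. (\<exists>x\<in>I. \<phi> x \<noteq> 0) \<and> (\<forall>x\<in>I. (\<Sum>y\<in>I. M x y * \<phi> y) = z * \<phi> x)}"
  proof (intro equalityI subsetI CollectI)
    fix z assume "z \<in> spectrum A"
    then obtain v where v: "v \<in> carrier_vec n" "v \<noteq> 0\<^sub>v n" "A *\<^sub>v v = z \<cdot>\<^sub>v v"
      using A by (auto simp: spectrum_def eigenvalue_def eigenvector_def)
    define \<phi> where "\<phi> x = vec_index v (g x)" for x
    have "\<exists>i<n. vec_index v i \<noteq> 0" using v(1,2) by (auto simp: vec_eq_iff)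
    then obtain i where i: "i < n" "vec_index v i \<noteq> 0" by blast
    have "\<phi> (f i) \<noteq> 0" using i by (simp add: \<phi>_def gf)
    moreover have "(\<Sum>y\<in>I. M x y * \<phi> y) = z * \<phi> x" if x: "x \<in> I" for x
    proof -
      have "(\<Sum>y\<in>I. M x y * \<phi> y) = (\<Sum>j<n. M (f (g x)) (f j) * vec_index v j)"
        using row[of "g x" \<phi>] fg[OF x] by (simp add: \<phi>_def gf)
      also have "\<dots> = vec_index (A *\<^sub>v v) (g x)" using mv[OF v(1) gI[OF x]] by simp
      also have "\<dots> = z * \<phi> x" using v gI[OF x] by (simp add: \<phi>_def)
      finally show ?thesis .
    qed
    ultimately show "\<exists>\<phi>. (\<exists>x\<in>I. \<phi> x \<noteq> 0) \<and> (\<forall>x\<in>I. (\<Sum>y\<in>I. M x y * \<phi> y) = z * \<phi> x)"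
      using fI[OF i(1)] by blast
  next
    fix z assume "z \<in> {z. \<exists>\<phi>. (\<exists>x\<in>I. \<phi> x \<noteq> 0) \<and> (\<forall>x\<in>I. (\<Sum>y\<in>I. M x y * \<phi> y) = z * \<phi> x)}"
    then obtain \<phi> x where \<phi>: "x \<in> I" "\<phi> x \<noteq> 0" "\<And>x. x \<in> I \<Longrightarrow> (\<Sum>y\<in>I. M x y * \<phi> y) = z * \<phi> x"
      by blast
    define v where "v = vec n (\<lambda>i. \<phi> (f i))"
    have v: "v \<in> carrier_vec n" by (simp add: v_def)
    have "vec_index v (g x) \<noteq> 0" using \<phi> gI fg by (simp add: v_def)
    hence "v \<noteq> 0\<^sub>v n" using gI[OF \<phi>(1)] by auto
    moreover have "A *\<^sub>v v = z \<cdot>\<^sub>v v"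
    proof (rule eq_vecI)
      fix i assume "i < dim_vec (z \<cdot>\<^sub>v v)"
      hence i: "i < n" by (simp add: v_def)
      have "vec_index (A *\<^sub>v v) i = (\<Sum>j<n. M (f i) (f j) * \<phi> (f j))"
        unfolding mv[OF v i] by (simp add: v_def)
      also have "\<dots> = z * \<phi> (f i)" using \<phi>(3)[OF fI[OF i]] row by simp
      finally show "vec_index (A *\<^sub>v v) i = vec_index (z \<cdot>\<^sub>v v) i" using i by (simp add: v_def)
    qed (use A in \<open>simp add: v_def\<close>)
    ultimately show "z \<in> spectrum A" using A v
      by (auto simp: spectrum_def eigenvalue_def eigenvector_def)
  qed
  then show thesis using A that n_def by blast
qed

lemma finite_spectrum_indexed:
  fixes M :: "'a \<Rightarrow> 'a \<Rightarrow> complex"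
  assumes "finite I"
  shows "finite {z. \<exists>\<phi>. (\<exists>x\<in>I. \<phi> x \<noteq> 0) \<and> (\<forall>x\<in>I. (\<Sum>y\<in>I. M x y * \<phi> y) = z * \<phi> x)}"
proof -
  obtain A where "A \<in> carrier_mat (card I) (card I)"
    "spectrum A = {z. \<exists>\<phi>. (\<exists>x\<in>I. \<phi> x \<noteq> 0) \<and> (\<forall>x\<in>I. (\<Sum>y\<in>I. M x y * \<phi> y) = z * \<phi> x)}"
    by (rule finite_index_matrix[OF assms])
  thus ?thesis using card_finite_spectrum(1)[of A] by simp
qed

lemma ex_eigenvalue_indexed:
  fixes M :: "'a \<Rightarrow> 'a \<Rightarrow> complex"
  assumes "finite I" "I \<noteq> {}"
  obtains z \<phi> where "\<exists>x\<in>I. \<phi> x \<noteq> 0" "\<And>x. x \<in> I \<Longrightarrow> (\<Sum>y\<in>I. M x y * \<phi> y) = z * \<phi> x"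
proof -
  obtain A where A: "A \<in> carrier_mat (card I) (card I)"
    "spectrum A = {z. \<exists>\<phi>. (\<exists>x\<in>I. \<phi> x \<noteq> 0) \<and> (\<forall>x\<in>I. (\<Sum>y\<in>I. M x y * \<phi> y) = z * \<phi> x)}"
    by (rule finite_index_matrix[OF assms(1)])
  have "spectrum A \<noteq> {}" using spectrum_non_empty[OF A(1)] assms by (simp add: card_gt_0_iff)
  thus thesis using A(2) that by blast
qed

section \<open>The gap as a minimum over a finite nonempty set\<close>

context glauber_exclusion
begin

definition gen :: "(('a \<Rightarrow> int) \<Rightarrow> complex) \<Rightarrow> ('a \<Rightarrow> int) \<Rightarrow> complex" where
  "gen \<phi> x = (\<Sum>e\<in>events. rate e *\<^sub>R (\<phi> (act e x) - \<phi> x))"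

lemma gen_matrix:
  assumes "x \<in> spins"
  shows "gen \<phi> x = (\<Sum>y\<in>spins. gen (\<lambda>w. if w = y then 1 else 0) x * \<phi> y)"
proof -
  have ind: "\<phi> w = (\<Sum>y\<in>spins. (if w = y then 1 else 0) * \<phi> y)" if "w \<in> spins" for w
  proof -
    have "(\<Sum>y\<in>spins. (if w = y then 1 else 0) * \<phi> y) = (\<Sum>y\<in>spins. if w = y then \<phi> y else 0)"
      by (intro sum.cong) auto
    then show ?thesis using that finite_spins[OF finite_\<Lambda>] by simp
  qed
  have "gen \<phi> x = (\<Sum>e\<in>events. \<Sum>y\<in>spins.
      rate e *\<^sub>R ((if act e x = y then 1 else 0) - (if x = y then 1 else 0)) * \<phi> y)"
    unfolding gen_def
  proof (rule sum.cong)
    fix e assume "e \<in> events"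
    then have "\<phi> (act e x) - \<phi> x =
        (\<Sum>y\<in>spins. ((if act e x = y then 1 else 0) - (if x = y then 1 else 0)) * \<phi> y)"
      unfolding left_diff_distrib sum_subtractf
      using ind[of x] ind[of "act e x"] assms act_spins by simp
    then show "rate e *\<^sub>R (\<phi> (act e x) - \<phi> x) = (\<Sum>y\<in>spins.
        rate e *\<^sub>R ((if act e x = y then 1 else 0) - (if x = y then 1 else 0)) * \<phi> y)"
      by (simp only: scaleR_sum_right mult_scaleR_left)
  qed simp
  also have "\<dots> = (\<Sum>y\<in>spins. gen (\<lambda>w. if w = y then 1 else 0) x * \<phi> y)"
    unfolding gen_def sum_distrib_right by (rule sum.swap)
  finally show ?thesis .
qed

lemma gen_add_const: "gen (\<lambda>x. \<phi> x + a) x = gen \<phi> x"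
  by (simp add: gen_def)

text \<open>Maximum principle: for a real-linear functional \<open>F\<close>,
  \<open>F (gen \<phi> x)\<close> is at most 0 where \<open>F (\<phi> x)\<close> is maximal. Applied
  to plus and minus the real and imaginary parts.\<close>

lemma gen_const_eq_0:
  assumes \<beta>: "\<And>x. x \<in> spins \<Longrightarrow> gen \<phi> x = \<beta>"
  shows "\<beta> = 0"
proof -
  have "(\<lambda>u\<in>\<Lambda>. 1) \<in> spins" by auto
  then have ne: "spins \<noteq> {}" by blast
  have le: "F (gen \<phi> x) \<le> 0" if F: "\<And>a b. F (a - b) = F a - F b" "\<And>r a. F (r *\<^sub>R a) = r * F a"
    "\<And>y. y \<in> spins \<Longrightarrow> F (\<phi> y) \<le> F (\<phi> x)" and x: "x \<in> spins" for F :: "complex \<Rightarrow> real" and x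
  proof -
    have "F (sum f I) = (\<Sum>i\<in>I. F (f i))" if "finite I" for f :: "'a event \<Rightarrow> complex" and I
      using that
    proof (induction I rule: finite_induct)
      case empty
      then show ?case using F(1)[of 0 0] by simp
    next
      case (insert i I)
      have "F (f i + sum f I) = F (f i) + F (sum f I)"
        using F(1)[of "f i" "- sum f I"] F(2)[of "-1" "sum f I"] by simp
      then show ?case using insert by simp
    qed
    then have "F (gen \<phi> x) = (\<Sum>e\<in>events. rate e * (F (\<phi> (act e x)) - F (\<phi> x)))"
      unfolding gen_def by (simp add: finite_events F(1,2))
    also have "\<dots> \<le> 0"
      using rate_nonneg F(3) act_spins x by (intro sum_nonpos mult_nonneg_nonpos) auto
    finally show ?thesis .
  qed
  have F0: "F \<beta> \<le> 0" if F: "\<And>a b. F (a - b) = F a - F b" "\<And>r a. F (r *\<^sub>R a) = r * F a"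
    for F :: "complex \<Rightarrow> real"
  proof -
    have fin: "finite ((\<lambda>y. F (\<phi> y)) ` spins)" "(\<lambda>y. F (\<phi> y)) ` spins \<noteq> {}"
      using finite_spins[OF finite_\<Lambda>] by (rule finite_imageI) (simp only: image_is_empty ne simp_thms)
    have "Max ((\<lambda>y. F (\<phi> y)) ` spins) \<in> (\<lambda>y. F (\<phi> y)) ` spins" by (rule Max_in[OF fin])
    then obtain x where x: "Max ((\<lambda>y. F (\<phi> y)) ` spins) = F (\<phi> x)" "x \<in> spins" by (rule imageE)
    have top: "F (\<phi> y) \<le> F (\<phi> x)" if "y \<in> spins" for y
      unfolding x(1)[symmetric] using that by (intro Max_ge fin(1)) (rule imageI)
    have "F (gen \<phi> x) \<le> 0"
      by (rule le[OF F top x(2)])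
    then show ?thesis using \<beta>[OF x(2)] by simp
  qed
  have "Re \<beta> = 0" "Im \<beta> = 0"
    using F0[of Re] F0[of "\<lambda>z. - Re z"] F0[of Im] F0[of "\<lambda>z. - Im z"] by (auto simp: algebra_simps)
  then show ?thesis by (simp add: complex_eq_iff)
qed

text \<open>\<open>Min\<close> is meaningful only on a finite nonempty set. Finiteness comes from
  the spectrum of a matrix; the longer part of the proof produces a nonzero eigenvalue.\<close>

lemma spectral_gap_ge:
  assumes g: "g > 0"
    and bound: "\<And>\<phi> z x y. (\<And>x. x \<in> spins \<Longrightarrow> gen \<phi> x = - z * \<phi> x) \<Longrightarrow> x \<in> spins \<Longrightarrow> y \<in> spins \<Longrightarrow>
      \<phi> x \<noteq> \<phi> y \<Longrightarrow> Re z \<ge> g"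
  shows "Min {Re z |z. (\<exists>\<phi>. (\<exists>x\<in>spins. \<phi> x \<noteq> 0) \<and> (\<forall>x\<in>spins. - gen \<phi> x = z * \<phi> x)) \<and> z \<noteq> 0} \<ge> g"
proof -
  let ?Z = "{z. \<exists>\<phi>. (\<exists>x\<in>spins. \<phi> x \<noteq> 0) \<and> (\<forall>x\<in>spins. - gen \<phi> x = z * \<phi> x)}"
  have fs: "finite spins" by (rule finite_spins[OF finite_\<Lambda>])
  have gm: "- gen \<phi> x = z * \<phi> x \<longleftrightarrow>
      (\<Sum>y\<in>spins. - gen (\<lambda>w. if w = y then 1 else 0) x * \<phi> y) = z * \<phi> x" if "x \<in> spins" for \<phi> x z
    by (subst gen_matrix[OF that]) (simp add: sum_negf)
  have "?Z = {z. \<exists>\<phi>. (\<exists>x\<in>spins. \<phi> x \<noteq> 0) \<and>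
      (\<forall>x\<in>spins. (\<Sum>y\<in>spins. - gen (\<lambda>w. if w = y then 1 else 0) x * \<phi> y) = z * \<phi> x)}"
    by (intro Collect_cong ex_cong1 conj_cong ball_cong HOL.refl gm)
  then have finZ: "finite ?Z" by (simp only: finite_spectrum_indexed[OF fs])
  have ge: "Re z \<ge> g" if z: "z \<in> ?Z" "z \<noteq> 0" for z
  proof -
    obtain \<phi> x where \<phi>: "x \<in> spins" "\<phi> x \<noteq> 0" "\<And>x. x \<in> spins \<Longrightarrow> - gen \<phi> x = z * \<phi> x" using z by blast
    have "\<exists>y\<in>spins. \<phi> y \<noteq> \<phi> x"
    proof (rule ccontr)
      assume "\<not> (\<exists>y\<in>spins. \<phi> y \<noteq> \<phi> x)"
      then have "\<phi> (act e x) - \<phi> x = 0" if "e \<in> events" for e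
        using act_spins[OF that \<phi>(1)] by simp
      then have "gen \<phi> x = 0" unfolding gen_def by (intro sum.neutral) simp
      then show False using \<phi>(3)[OF \<phi>(1)] \<phi>(2) z(2) by simp
    qed
    then obtain y where y: "y \<in> spins" "\<phi> y \<noteq> \<phi> x" by blast
    show ?thesis
    proof (rule bound[OF _ y(1) \<phi>(1) y(2)])
      show "gen \<phi> x = - z * \<phi> x" if "x \<in> spins" for x
        using \<phi>(3)[OF that] by (metis minus_equation_iff mult_minus_left)
    qed
  qed
  have ex: "\<exists>z\<in>?Z. z \<noteq> 0"
  proof -
    define x0 :: "'a \<Rightarrow> int" where "x0 = (\<lambda>u\<in>\<Lambda>. 1)"
    define x1 :: "'a \<Rightarrow> int" where "x1 = (\<lambda>u\<in>\<Lambda>. -1)"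
    have x01: "x0 \<in> spins" "x1 \<in> spins" by (auto simp: x0_def x1_def)
    have "x0 \<noteq> x1" using \<Lambda>_nonempty by (auto simp: x0_def x1_def fun_eq_iff restrict_def)
    \<comment> \<open>Working modulo constants: on functions vanishing at \<open>x0\<close>, take
      \<open>gen\<close> and subtract its value at \<open>x0\<close>. This is the matrix
      \<open>A x y - A x0 y\<close> on the remaining configurations, and it has an
      eigenvalue.\<close>
    define I where "I = spins - {x0}"
    define A where "A x y = gen (\<lambda>w. if w = y then 1 else 0) x" for x y
    have I: "finite I" "I \<noteq> {}" using fs x01 \<open>x0 \<noteq> x1\<close> by (auto simp: I_def)
    obtain z \<phi>0 where z: "\<exists>x\<in>I. \<phi>0 x \<noteq> 0"
      "\<And>x. x \<in> I \<Longrightarrow> (\<Sum>y\<in>I. (A x y - A x0 y) * \<phi>0 y) = z * \<phi>0 x"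
    proof (rule ex_eigenvalue_indexed[OF I, of "\<lambda>x y. A x y - A x0 y"])
      fix z \<phi>0
      assume "\<exists>x\<in>I. \<phi>0 x \<noteq> 0" "\<And>x. x \<in> I \<Longrightarrow> (\<Sum>y\<in>I. (A x y - A x0 y) * \<phi>0 y) = z * \<phi>0 x"
      then show thesis by (rule that)
    qed
    define \<phi> where "\<phi> x = (if x = x0 then 0 else \<phi>0 x)" for x
    have gI: "gen \<phi> x = (\<Sum>y\<in>I. A x y * \<phi>0 y)" if "x \<in> spins" for x
    proof -
      have "gen \<phi> x = (\<Sum>y\<in>spins. A x y * \<phi> y)" unfolding A_def by (rule gen_matrix[OF that])
      also have "\<dots> = (\<Sum>y\<in>I. A x y * \<phi> y)"
        unfolding I_def by (rule sum.mono_neutral_right) (use fs in \<open>auto simp: \<phi>_def\<close>)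
      also have "\<dots> = (\<Sum>y\<in>I. A x y * \<phi>0 y)" by (rule sum.cong) (auto simp: \<phi>_def I_def)
      finally show ?thesis .
    qed
    have eig: "gen \<phi> x = z * \<phi> x + gen \<phi> x0" if "x \<in> spins" for x
    proof (cases "x = x0")
      case False
      then have "x \<in> I" using that by (simp add: I_def)
      from z(2)[OF this] show ?thesis
        unfolding gI[OF that] gI[OF x01(1)] using False
        by (simp add: \<phi>_def left_diff_distrib sum_subtractf algebra_simps)
    qed (simp add: \<phi>_def)
    obtain x where "x \<in> I" "\<phi>0 x \<noteq> 0" using z(1) by blast
    then have x: "x \<in> spins" "\<phi> x \<noteq> \<phi> x0" by (auto simp: \<phi>_def I_def)
    \<comment> \<open>Otherwise \<open>gen \<phi>\<close> would be constant, hence 0 by the maximum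
      principle; as \<open>\<phi>\<close> is not constant, \<open>bound\<close> would give
      \<open>0 \<ge> g\<close>.\<close>
    have "z \<noteq> 0"
    proof
      assume "z = 0"
      then have c: "gen \<phi> x = gen \<phi> x0" if "x \<in> spins" for x using eig[OF that] by simp
      then have "gen \<phi> x0 = 0" by (rule gen_const_eq_0)
      then have c0: "gen \<phi> x = - 0 * \<phi> x" if "x \<in> spins" for x using c[OF that] by simp
      have "Re 0 \<ge> g" by (rule bound[OF c0 x(1) x01(1) x(2)])
      then show False using g by simp
    qed
    \<comment> \<open>Adding this constant repairs the eigenvalue equation, which so far holds only
      modulo constants.\<close>
    define \<beta> where "\<beta> = gen \<phi> x0 / z"
    have e: "- gen (\<lambda>x. \<phi> x + \<beta>) x = - z * (\<phi> x + \<beta>)" if "x \<in> spins" for x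
      unfolding gen_add_const eig[OF that] using \<open>z \<noteq> 0\<close> by (simp add: \<beta>_def algebra_simps)
    have ne: "\<exists>x\<in>spins. \<phi> x + \<beta> \<noteq> 0" using x x01 by (metis add_right_cancel)
    have "- z \<in> ?Z"
      by (intro CollectI exI[of _ "\<lambda>x. \<phi> x + \<beta>"] conjI ballI ne e)
    moreover have "- z \<noteq> 0" using \<open>z \<noteq> 0\<close> by simp
    ultimately show ?thesis by (rule rev_bexI)
  qed
  have eq: "{Re z |z. (\<exists>\<phi>. (\<exists>x\<in>spins. \<phi> x \<noteq> 0) \<and> (\<forall>x\<in>spins. - gen \<phi> x = z * \<phi> x)) \<and> z \<noteq> 0} = Re ` (?Z - {0})"
    by auto
  show ?thesis unfolding eq
  proof (rule Min.boundedI)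
    show "finite (Re ` (?Z - {0}))" using finZ by simp
    from ex obtain z where "z \<in> ?Z" "z \<noteq> 0" by (rule bexE)
    then have "z \<in> ?Z - {0}" by (simp only: Diff_iff singleton_iff simp_thms)
    then show "Re ` (?Z - {0}) \<noteq> {}" by (simp only: image_is_empty) (rule notI, simp only: empty_iff)
    fix a assume "a \<in> Re ` (?Z - {0})"
    then obtain z where "a = Re z" "z \<in> ?Z" "z \<noteq> 0" by (auto simp only: image_iff Diff_iff singleton_iff)
    then show "g \<le> a" using ge by (simp only:)
  qed
qed

end

section \<open>The torus\<close>

text \<open>The weight of a threshold is its gap to the next smaller value (to 0 for the smallest),
  so the sum up to \<open>v\<close> telescopes.\<close>

lemma layer_weights:
  fixes V :: "real set"
  assumes "finite V" "\<And>v. v \<in> V \<Longrightarrow> v > 0"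
  obtains wt where "\<And>\<theta>. \<theta> \<in> V \<Longrightarrow> wt \<theta> \<ge> 0"
    and "\<And>v. v \<in> V \<Longrightarrow> (\<Sum>\<theta>\<in>V. if \<theta> \<le> v then wt \<theta> else 0) = (v :: real)"
proof -
  have "\<exists>wt. (\<forall>\<theta>\<in>V. wt \<theta> \<ge> 0) \<and> (\<forall>v\<in>V. (\<Sum>\<theta>\<in>V. if \<theta> \<le> v then wt \<theta> else 0) = v)"
    using assms
  proof (induction V rule: finite_linorder_max_induct)
    case (insert a V)
    have "\<exists>wt. (\<forall>\<theta>\<in>V. wt \<theta> \<ge> 0) \<and> (\<forall>v\<in>V. (\<Sum>\<theta>\<in>V. if \<theta> \<le> v then wt \<theta> else 0) = v)"
      by (rule insert.IH) (use insert.prems in simp)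
    then obtain wt where wt': "\<forall>\<theta>\<in>V. wt \<theta> \<ge> 0"
      "\<forall>v\<in>V. (\<Sum>\<theta>\<in>V. if \<theta> \<le> v then wt \<theta> else 0) = v" by (elim exE conjE)
    have wt: "\<theta> \<in> V \<Longrightarrow> wt \<theta> \<ge> 0" "v \<in> V \<Longrightarrow> (\<Sum>\<theta>\<in>V. if \<theta> \<le> v then wt \<theta> else 0) = v"
      for \<theta> v using wt' by simp_all
    have aV: "a \<notin> V" using insert.hyps by blast
    have tot: "sum wt V \<le> a"
    proof (cases "V = {}")
      case True
      then show ?thesis using insert.prems[of a] by simp
    next
      case False
      define v where "v = Max V"
      have v: "v \<in> V" "\<And>\<theta>. \<theta> \<in> V \<Longrightarrow> \<theta> \<le> v" unfolding v_def using False insert.hyps by auto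
      have "sum wt V = (\<Sum>\<theta>\<in>V. if \<theta> \<le> v then wt \<theta> else 0)" using v by (intro sum.cong) auto
      then show ?thesis using wt(2)[OF v(1)] insert.hyps v(1) by auto
    qed
    define wt' where "wt' = wt(a := a - sum wt V)"
    have s: "(\<Sum>\<theta>\<in>V. if \<theta> \<le> v then wt' \<theta> else 0) = (\<Sum>\<theta>\<in>V. if \<theta> \<le> v then wt \<theta> else 0)" for v
      using aV by (intro sum.cong) (auto simp: wt'_def)
    have "(\<Sum>\<theta>\<in>insert a V. if \<theta> \<le> v then wt' \<theta> else 0) = v" if "v \<in> insert a V" for v
    proof (cases "v = a")
      case True
      have "(\<Sum>\<theta>\<in>V. if \<theta> \<le> a then wt \<theta> else 0) = sum wt V"
        using insert.hyps by (intro sum.cong) auto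
      then show ?thesis using insert.hyps aV True by (simp add: s wt'_def)
    next
      case False
      then have v: "v \<in> V" "\<not> a \<le> v" using that insert.hyps by auto
      then show ?thesis using insert.hyps aV wt(2)[OF v(1)] by (simp add: s)
    qed
    moreover have "wt' \<theta> \<ge> 0" if "\<theta> \<in> insert a V" for \<theta>
      using that wt(1) tot by (auto simp: wt'_def)
    ultimately show ?case by blast
  qed auto
  then show thesis using that by blast
qed

section \<open>Arithmetic on the torus and the ball\<close>

lemma finite_int_box: "finite {u :: int ^ 'd. \<forall>i. l \<le> u $ i \<and> u $ i \<le> k}"
proof (rule finite_subset)
  show "{u :: int ^ 'd. \<forall>i. l \<le> u $ i \<and> u $ i \<le> k} \<subseteq> (\<lambda>f. \<chi> i. f i) ` (UNIV \<rightarrow>\<^sub>E {l..k})"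
  proof
    fix u :: "int ^ 'd" assume "u \<in> {u. \<forall>i. l \<le> u $ i \<and> u $ i \<le> k}"
    then have "(\<lambda>i. u $ i) \<in> UNIV \<rightarrow>\<^sub>E {l..k}" by auto
    moreover have "u = (\<chi> i. u $ i)" by (simp add: Finite_Cartesian_Product.vec_eq_iff)
    ultimately show "u \<in> (\<lambda>f. \<chi> i. f i) ` (UNIV \<rightarrow>\<^sub>E {l..k})" by blast
  qed
  show "finite ((\<lambda>f. \<chi> i. f i) ` (UNIV \<rightarrow>\<^sub>E {l..k}) :: (int ^ 'd) set)"
    by (intro finite_imageI finite_PiE) auto
qed

lemma finite_torus: "finite (torus L :: (int ^ 'd) set)"
  by (rule finite_subset[OF _ finite_int_box[of 0 "int L"]]) (auto simp: torus_def less_imp_le)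

lemma ball0_bound:
  fixes v :: "int ^ 'd"
  assumes "v \<in> ball0 m"
  shows "\<bar>v $ i\<bar> \<le> int m"
proof -
  have "(0, v) \<in> lattice_adj ^^ k \<Longrightarrow> \<bar>v $ i\<bar> \<le> int k" for k and v :: "int ^ 'd"
  proof (induction k arbitrary: v)
    case (Suc k)
    then obtain w where w: "\<bar>w $ i\<bar> \<le> int k" "(w, v) \<in> lattice_adj" by auto
    then obtain j where "v = w + axis j 1 \<or> w = v + axis j 1" by (auto simp: lattice_adj_def)
    then have "\<bar>v $ i - w $ i\<bar> \<le> 1" by (auto simp: axis_def)
    then show ?case using w(1) by simp
  qed auto
  with assms show ?thesis unfolding ball0_def by force
qed

lemma finite_ball0: "finite (ball0 m :: (int ^ 'd) set)"
  by (rule finite_subset[OF _ finite_int_box[of "- int m" "int m"]]) (auto dest: ball0_bound simp: abs_le_iff minus_le_iff)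

lemma zero_in_ball0: "0 \<in> ball0 m"
  by (auto simp: ball0_def intro: exI[of _ 0])

lemma wrap_nth: "wrap L u $ i = u $ i mod int L"
  by (simp add: wrap_def)

lemma wrap_in_torus: "L > 0 \<Longrightarrow> wrap L u \<in> torus L"
  by (simp add: torus_def wrap_nth)

lemma wrap_torus: "u \<in> torus L \<Longrightarrow> wrap L u = u"
  by (simp add: torus_def Finite_Cartesian_Product.vec_eq_iff wrap_nth)

lemma wrap_add_left: "wrap L (wrap L u + v) = wrap L (u + v)"
  by (simp add: Finite_Cartesian_Product.vec_eq_iff wrap_nth mod_simps)

lemma wrap_add_eq_iff: "wrap L (u + w) = wrap L (v + w) \<longleftrightarrow> wrap L u = wrap L v"
proof
  assume "wrap L (u + w) = wrap L (v + w)"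
  then have "wrap L (wrap L (u + w) + - w) = wrap L (wrap L (v + w) + - w)" by simp
  then show "wrap L u = wrap L v" unfolding wrap_add_left by simp
next
  assume "wrap L u = wrap L v"
  then have "wrap L (wrap L u + w) = wrap L (wrap L v + w)" by simp
  then show "wrap L (u + w) = wrap L (v + w)" unfolding wrap_add_left .
qed

lemma bij_wrap:
  assumes "L > 0"
  shows "bij_betw (\<lambda>u. wrap L (u + g)) (torus L) (torus L)"
proof (rule bij_betw_byWitness[where f' = "\<lambda>u. wrap L (u - g)"])
  show "\<forall>u\<in>torus L. wrap L (wrap L (u + g) - g) = u"
    using wrap_add_left[of L "_ + g" "- g"] by (simp add: wrap_torus)
  show "\<forall>u\<in>torus L. wrap L (wrap L (u - g) + g) = u"
    using wrap_add_left[of L "_ - g" g] by (simp add: wrap_torus)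
qed (use wrap_in_torus[OF assms] in auto)

text \<open>Coordinates of two sites of the ball differ by at most \<open>2 * m < L\<close>, so
  congruence modulo \<open>L\<close> is equality.\<close>

lemma inj_on_wrap_ball0:
  fixes u :: "int ^ 'd"
  assumes "2 * m < L"
  shows "inj_on (\<lambda>v. wrap L (u + v)) (ball0 m)"
proof (rule inj_onI)
  fix v w :: "int ^ 'd" assume vw: "v \<in> ball0 m" "w \<in> ball0 m" "wrap L (u + v) = wrap L (u + w)"
  then have "wrap L v = wrap L w" using wrap_add_eq_iff[of L v u w] by (simp add: add.commute)
  then have "v $ i mod int L = w $ i mod int L" for i by (metis wrap_nth)
  then have "int L dvd v $ i - w $ i" for i by (simp add: mod_eq_dvd_iff)
  moreover have "\<bar>v $ i - w $ i\<bar> < int L" for i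
    using ball0_bound[OF vw(1), of i] ball0_bound[OF vw(2), of i] assms by linarith
  ultimately have "v $ i - w $ i = 0" for i by (metis abs_of_nat dvd_imp_le_int linorder_not_le)
  then show "v = w" by (simp add: Finite_Cartesian_Product.vec_eq_iff)
qed

text \<open>
  On the cycle \<open>\<int>/L\<close> the function \<open>(t - L/2)\<^sup>2\<close> has constant Laplacian except for a kink at \<open>0\<close>; averaging
  its translates spreads the kink over \<open>{-m..m}\<close>.
\<close>

definition kink :: "nat \<Rightarrow> int \<Rightarrow> real" where
  "kink L s = (of_int (s mod int L) - L / 2)\<^sup>2"

definition pair_barrier :: "nat \<Rightarrow> nat \<Rightarrow> int \<Rightarrow> real" where
  "pair_barrier m L s = (\<Sum>j\<in>{- int m..int m}. kink L (s - j)) / (4 * real L ^ 3)"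

lemma kink_mod: "kink L (s mod int L - a) = kink L (s - a)" "kink L (a - s mod int L) = kink L (a - s)"
  by (simp_all add: kink_def mod_simps)

lemma kink_minus:
  assumes "L > 0"
  shows "kink L (- s) = kink L s"
proof (cases "s mod int L = 0")
  case True
  then have "(- s) mod int L = 0" by (simp add: zmod_zminus1_eq_if)
  then show ?thesis using True by (simp add: kink_def)
next
  case False
  then have "(- s) mod int L = int L - s mod int L" by (simp add: zmod_zminus1_eq_if)
  then have "real_of_int ((- s) mod int L) = real L - real_of_int (s mod int L)" by simp
  then show ?thesis unfolding kink_def by (simp only:) (simp add: power2_eq_square algebra_simps)
qed

lemma kink_bounds: "L > 0 \<Longrightarrow> 0 \<le> kink L s \<and> kink L s \<le> (L / 2)\<^sup>2"
proof -
  assume L: "L > 0"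
  then have "0 \<le> s mod int L" "s mod int L < int L" by auto
  then have "0 \<le> real_of_int (s mod int L)" "real_of_int (s mod int L) \<le> real L" by linarith+
  then have "\<bar>real_of_int (s mod int L) - real L / 2\<bar> \<le> \<bar>real L / 2\<bar>" by linarith
  then have "(real_of_int (s mod int L) - real L / 2)\<^sup>2 \<le> (real L / 2)\<^sup>2"
    by (simp only: abs_le_square_iff)
  then show ?thesis by (simp add: kink_def)
qed

text \<open>The second difference of the parabola is 2 except at the corner of its periodic
  extension; the loss \<open>2 * L\<close> there offsets the 2 gained at each of the
  \<open>L\<close> sites, as it must on a cycle.\<close>

lemma kink_laplacian:
  assumes "L \<ge> 2"
  shows "kink L (s + 1) + kink L (s - 1) - 2 * kink L s = 2 - (if s mod int L = 0 then 2 * real L else 0)"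
proof -
  define t where "t = s mod int L"
  have t: "0 \<le> t" "t < int L" using assms by (auto simp: t_def)
  have p: "kink L (s + 1) = (of_int t + 1 - L / 2)\<^sup>2"
  proof (cases "t + 1 = int L")
    case True
    have "(s + 1) mod int L = (t + 1) mod int L" by (simp add: t_def mod_simps)
    also have "\<dots> = 0" using True by simp
    finally have "kink L (s + 1) = (real L / 2)\<^sup>2" by (simp add: kink_def power2_eq_square)
    moreover have "real_of_int t + 1 = real L" using True by linarith
    ultimately show ?thesis by simp
  next
    case False
    have "(s + 1) mod int L = (t + 1) mod int L" by (simp add: t_def mod_simps)
    also have "\<dots> = t + 1" using False t by (intro mod_pos_pos_trivial) auto
    finally show ?thesis by (simp add: kink_def)
  qed
  have sm: "(s - 1) mod int L = (t - 1) mod int L" by (simp add: t_def mod_simps)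
  have c: "kink L s = (of_int t - L / 2)\<^sup>2" by (simp add: kink_def t_def)
  show ?thesis
  proof (cases "t = 0")
    case True
    have "(t - 1) mod int L = int L - 1" using True assms by (simp add: zmod_minus1)
    then have "kink L (s - 1) = (real L - 1 - real L / 2)\<^sup>2" using assms by (simp add: kink_def sm)
    then show ?thesis unfolding p c using True by (simp add: t_def[symmetric] power2_eq_square field_simps)
  next
    case False
    have "(t - 1) mod int L = t - 1" using t False by (intro mod_pos_pos_trivial) auto
    then have "kink L (s - 1) = (of_int t - 1 - L / 2)\<^sup>2" by (simp add: kink_def sm)
    then show ?thesis unfolding p c using False by (simp add: t_def[symmetric] power2_eq_square field_simps)
  qed
qed

lemma pair_barrier_mod:
  "pair_barrier m L (s mod int L - a) = pair_barrier m L (s - a)"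
  "pair_barrier m L (a - s mod int L) = pair_barrier m L (a - s)"
proof -
  have "s mod int L - a - j = s mod int L - (a + j)" "a - s mod int L - j = (a - j) - s mod int L"
    "s - a - j = s - (a + j)" "a - s - j = (a - j) - s" for j by auto
  then show "pair_barrier m L (s mod int L - a) = pair_barrier m L (s - a)"
    "pair_barrier m L (a - s mod int L) = pair_barrier m L (a - s)"
    unfolding pair_barrier_def by (simp_all only: kink_mod)
qed

lemma pair_barrier_minus:
  assumes "L > 0"
  shows "pair_barrier m L (- s) = pair_barrier m L s"
proof -
  have "(\<Sum>j\<in>{- int m..int m}. kink L (- s - j)) = (\<Sum>j\<in>{- int m..int m}. kink L (s - j))"
  proof (rule sum.reindex_bij_witness[where i = uminus and j = uminus])
    fix j show "kink L (s - - j) = kink L (- s - j)" using kink_minus[OF assms, of "s + j"] by simp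
  qed auto
  then show ?thesis by (simp add: pair_barrier_def)
qed

lemma pair_barrier_bounds:
  assumes "L > 0"
  shows "0 \<le> pair_barrier m L s \<and> pair_barrier m L s \<le> (2 * real m + 1) / (16 * real L)"
proof -
  have "(\<Sum>j\<in>{- int m..int m}. kink L (s - j)) \<le> (\<Sum>j\<in>{- int m..int m}. (L / 2)\<^sup>2)"
    using kink_bounds[OF assms] by (intro sum_mono) auto
  also have "\<dots> = (2 * real m + 1) * (L / 2)\<^sup>2" by simp
  finally have "pair_barrier m L s \<le> (2 * real m + 1) * (L / 2)\<^sup>2 / (4 * real L ^ 3)"
    unfolding pair_barrier_def by (rule divide_right_mono) simp
  also have "\<dots> = (2 * real m + 1) / (16 * real L)" using assms by (simp add: power2_eq_square power3_eq_cube)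
  finally show ?thesis using kink_bounds[OF assms] by (auto simp: pair_barrier_def intro!: divide_nonneg_nonneg sum_nonneg)
qed

text \<open>The factor \<open>L^2 * 2\<close> is the rate at which the coordinate difference of two
  moving sites jumps in each direction. The normalisation \<open>4 * L^3\<close> turns each kink, of
  size \<open>2 * L\<close>, into a loss of exactly 1 and leaves the constant
  \<open>(2 * m + 1) / L\<close>, which is 16 times the bound on the function itself.\<close>

lemma pair_barrier_laplacian:
  assumes L: "L \<ge> 2"
  shows "real L ^ 2 * 2 * (pair_barrier m L (s + 1) + pair_barrier m L (s - 1) - 2 * pair_barrier m L s) \<le>
    16 * ((2 * real m + 1) / (16 * real L)) - (if \<exists>j\<in>{- int m..int m}. (s - j) mod int L = 0 then 1 else 0)"
proof -
  let ?J = "{- int m..int m}"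
  define K where "K = (\<Sum>j\<in>?J. if (s - j) mod int L = 0 then 1 else 0 :: real)"
  have e: "s + 1 - j = s - j + 1" "s - 1 - j = s - j - 1" for j by auto
  have "(\<Sum>j\<in>?J. kink L (s + 1 - j)) + (\<Sum>j\<in>?J. kink L (s - 1 - j)) - 2 * (\<Sum>j\<in>?J. kink L (s - j)) =
      (\<Sum>j\<in>?J. 2 - (if (s - j) mod int L = 0 then 2 * real L else 0))"
    unfolding e kink_laplacian[OF L, symmetric] by (simp add: sum.distrib sum_subtractf sum_distrib_left)
  also have "\<dots> = (\<Sum>j\<in>?J. 2 - 2 * real L * (if (s - j) mod int L = 0 then 1 else 0))" by (intro sum.cong) auto
  also have "\<dots> = 2 * (2 * real m + 1) - 2 * real L * K"
    unfolding sum_subtractf sum_distrib_left[symmetric] K_def by simp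
  finally have sum: "(\<Sum>j\<in>?J. kink L (s + 1 - j)) + (\<Sum>j\<in>?J. kink L (s - 1 - j)) -
      2 * (\<Sum>j\<in>?J. kink L (s - j)) = 2 * (2 * real m + 1) - 2 * real L * K" .
  have "a / d + b / d - 2 * (c / d) = (a + b - 2 * c) / d" for a b c d :: real
    by (simp add: diff_divide_distrib add_divide_distrib)
  then have "real L ^ 2 * 2 * (pair_barrier m L (s + 1) + pair_barrier m L (s - 1) - 2 * pair_barrier m L s) =
      real L ^ 2 * 2 * ((2 * (2 * real m + 1) - 2 * real L * K) / (4 * real L ^ 3))"
    unfolding pair_barrier_def by (simp only: sum)
  also have "\<dots> = (2 * real m + 1) / real L - K" using L by (simp add: field_simps power2_eq_square power3_eq_cube)
  also have "(2 * real m + 1) / real L = 16 * ((2 * real m + 1) / (16 * real L))" using L by (simp add: field_simps)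
  finally have eq: "real L ^ 2 * 2 * (pair_barrier m L (s + 1) + pair_barrier m L (s - 1) - 2 * pair_barrier m L s) =
      16 * ((2 * real m + 1) / (16 * real L)) - K" .
  have "(if \<exists>j\<in>?J. (s - j) mod int L = 0 then 1 else 0) \<le> K"
  proof (cases "\<exists>j\<in>?J. (s - j) mod int L = 0")
    case True
    then obtain j where j: "j \<in> ?J" "(s - j) mod int L = 0" by (rule bexE)
    have "(\<lambda>j. if (s - j) mod int L = 0 then 1 else 0 :: real) j \<le> K"
      unfolding K_def using j(1) by (rule member_le_sum) simp_all
    then show ?thesis using True j(2) by (simp only: if_True simp_thms)
  next
    case False
    have "K \<ge> 0" unfolding K_def by (rule sum_nonneg) simp
    then show ?thesis using False by (simp only: if_False)
  qed
  then show ?thesis unfolding eq by (rule diff_left_mono)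
qed

text \<open>Shifting the window by one only trades an end term, \<open>kink\<close> at
  \<open>m\<close> for \<open>kink\<close> at \<open>m + 1\<close>, and the parabola decreases on
  the first half of the cycle. This handles neighbouring sites, which exchange with each other
  instead of meeting.\<close>

lemma pair_barrier_0_1:
  assumes "2 * m + 2 \<le> L"
  shows "pair_barrier m L 1 \<le> pair_barrier m L 0"
proof -
  let ?J = "{- int m..int m}"
  have L: "L > 0" using assms by simp
  have "(\<Sum>j\<in>?J. kink L (1 - j)) = (\<Sum>j\<in>{- int m - 1..int m - 1}. kink L (0 - j))"
    by (rule sum.reindex_bij_witness[where i = "\<lambda>j. j + 1" and j = "\<lambda>j. j - 1"]) auto
  also have "{- int m - 1..int m - 1} = insert (- int m - 1) {- int m..int m - 1}" by auto
  also have "(\<Sum>j\<in>insert (- int m - 1) {- int m..int m - 1}. kink L (0 - j)) =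
      kink L (int m + 1) + (\<Sum>j\<in>{- int m..int m - 1}. kink L (0 - j))"
    by (subst sum.insert) (auto simp: add.commute)
  finally have 1: "(\<Sum>j\<in>?J. kink L (1 - j)) = kink L (int m + 1) + (\<Sum>j\<in>{- int m..int m - 1}. kink L (0 - j))" .
  have "?J = insert (int m) {- int m..int m - 1}" by auto
  then have 0: "(\<Sum>j\<in>?J. kink L (0 - j)) = kink L (- int m) + (\<Sum>j\<in>{- int m..int m - 1}. kink L (0 - j))"
    by (simp only:) (subst sum.insert, auto)
  have "int m mod int L = int m" "(int m + 1) mod int L = int m + 1"
    using assms by (auto intro!: mod_pos_pos_trivial)
  then have "kink L (- int m) - kink L (int m + 1) = real L - 2 * real m - 1"
    unfolding kink_minus[OF L] by (simp add: kink_def power2_eq_square field_simps)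
  moreover have "real (2 * m + 2) \<le> real L" using assms by (rule of_nat_mono)
  ultimately have "kink L (int m + 1) \<le> kink L (- int m)" by simp
  then show ?thesis unfolding pair_barrier_def 0 1 by (intro divide_right_mono) auto
qed

section \<open>Neighbours on the torus and the motion of two sites\<close>

lemma torus_adj_sym: "(p, q) \<in> torus_adj L \<Longrightarrow> (q, p) \<in> torus_adj L"
  by (auto simp: torus_adj_def)

lemma torus_adj_cases:
  assumes "(u, w) \<in> torus_adj L"
  obtains i where "w = wrap L (u + axis i 1) \<or> w = wrap L (u - axis i 1)"
proof -
  have w: "w \<in> torus L" using assms by (simp add: torus_adj_def)
  obtain i where "w = wrap L (u + axis i 1) \<or> u = wrap L (w + axis i 1)"
    using assms by (auto simp: torus_adj_def)
  moreover have "w = wrap L (u - axis i 1)" if "u = wrap L (w + axis i 1)"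
    using wrap_add_left[of L "w + axis i 1" "- axis i 1"] that wrap_torus[OF w] by simp
  ultimately show thesis using that by blast
qed

lemma torus_adj_step:
  fixes u :: "int ^ 'd"
  assumes "L \<ge> 2" "u \<in> torus L"
  shows "(u, wrap L (u + axis i 1)) \<in> torus_adj L" "(u, wrap L (u - axis i 1)) \<in> torus_adj L"
proof -
  have ne: "(x + 1) mod int L \<noteq> x" "(x - 1) mod int L \<noteq> x" for x
  proof -
    have "\<not> int L dvd 1" "\<not> int L dvd -1" using assms(1) by auto
    then show "(x + 1) mod int L \<noteq> x" "(x - 1) mod int L \<noteq> x"
      by (metis add_diff_cancel_left' mod_eq_dvd_iff mod_mod_trivial)
        (metis \<open>\<not> int L dvd - 1\<close> add_diff_cancel_left' diff_conv_add_uminus mod_eq_dvd_iff mod_mod_trivial)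
  qed
  have "wrap L (u + axis i 1) $ i \<noteq> u $ i" "wrap L (u - axis i 1) $ i \<noteq> u $ i"
    using ne by (auto simp: wrap_nth axis_def)
  then have "u \<noteq> wrap L (u + axis i 1)" "u \<noteq> wrap L (u - axis i 1)" by metis+
  moreover have "u = wrap L (wrap L (u - axis i 1) + axis i 1)"
    unfolding wrap_add_left using wrap_torus[OF assms(2)] by simp
  ultimately show "(u, wrap L (u + axis i 1)) \<in> torus_adj L" "(u, wrap L (u - axis i 1)) \<in> torus_adj L"
    using assms(2) wrap_in_torus[of L "u + axis i 1"] wrap_in_torus[of L "u - axis i 1"] assms(1)
    unfolding torus_adj_def by auto
qed

text \<open>Only the two neighbours along \<open>i0\<close> alter this coordinate. They are distinct
  because \<open>L \<ge> 3\<close>, so neither is lost in the set of neighbours.\<close>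

lemma torus_adj_coordinate_sum:
  fixes f :: "int \<Rightarrow> real" and u :: "int ^ 'd"
  assumes L: "L \<ge> 3" and u: "u \<in> torus L" and f: "\<And>x. f (x mod int L) = f x"
  shows "(\<Sum>w\<in>{w. (u, w) \<in> torus_adj L}. f (w $ i0) - f (u $ i0)) = f (u $ i0 + 1) + f (u $ i0 - 1) - 2 * f (u $ i0)"
proof -
  define wp where "wp = wrap L (u + axis i0 1)"
  define wm where "wm = wrap L (u - axis i0 1)"
  let ?N = "{w. (u, w) \<in> torus_adj L}"
  have fin: "finite ?N" by (rule finite_subset[OF _ finite_torus]) (auto simp: torus_adj_def)
  have c: "wp $ i0 = (u $ i0 + 1) mod int L" "wm $ i0 = (u $ i0 - 1) mod int L"
    by (simp_all add: wp_def wm_def wrap_nth axis_def)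
  have "(x + 1) mod int L \<noteq> (x - 1) mod int L" for x
  proof
    assume "(x + 1) mod int L = (x - 1) mod int L"
    then have "int L dvd 2" by (simp add: mod_eq_dvd_iff)
    then show False using L zdvd_imp_le[of "int L" 2] by simp
  qed
  then have "wp \<noteq> wm" using c by metis
  have "(\<Sum>w\<in>?N. f (w $ i0) - f (u $ i0)) = (\<Sum>w\<in>{wp, wm}. f (w $ i0) - f (u $ i0))"
  proof (rule sum.mono_neutral_right[OF fin])
    show "{wp, wm} \<subseteq> ?N" using torus_adj_step[of L u i0] L u by (auto simp: wp_def wm_def)
    show "\<forall>w\<in>?N - {wp, wm}. f (w $ i0) - f (u $ i0) = 0"
    proof
      fix w assume w: "w \<in> ?N - {wp, wm}"
      then have "(u, w) \<in> torus_adj L" by simp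
      then obtain i where i: "w = wrap L (u + axis i 1) \<or> w = wrap L (u - axis i 1)" by (rule torus_adj_cases)
      then have "i \<noteq> i0" using w by (auto simp: wp_def wm_def)
      then have "w $ i0 = u $ i0 mod int L" using i by (auto simp: wrap_nth axis_def)
      then show "f (w $ i0) - f (u $ i0) = 0" using f by simp
    qed
  qed
  then show ?thesis using \<open>wp \<noteq> wm\<close> by (simp add: c f)
qed

text \<open>Two sites under exchanges move like independent walks, except when they are exchanged
  with each other: this leaves \<open>\<psi>\<close> unchanged by symmetry, whereas walks would
  meet, which does not lower it (\<open>top\<close>). So independent walks give an upper bound, and
  on one coordinate difference their generator is the Laplacian of a cycle.\<close>

lemma pair_barrier_super:
  fixes u v :: "int ^ 'd" and i0 :: 'd
  assumes L: "L \<ge> 2 * m + 3" and u: "u \<in> torus L" and v: "v \<in> torus L" and uv: "u \<noteq> v"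
  defines "\<psi> \<equiv> \<lambda>u v :: int ^ 'd. pair_barrier m L (u $ i0 - v $ i0)"
  shows "real L ^ 2 / 2 * (\<Sum>(p, q)\<in>torus_adj L. \<psi> (sw p q u) (sw p q v) - \<psi> u v) \<le>
    16 * ((2 * real m + 1) / (16 * real L)) - (if v \<in> (\<lambda>w. wrap L (u + w)) ` ball0 m then 1 else 0)"
proof -
  let ?E = "torus_adj L :: ((int ^ 'd) \<times> (int ^ 'd)) set"
  have L3: "L \<ge> 3" "L > 0" "L \<ge> 2" using L by auto
  have finE: "finite ?E"
    by (rule finite_subset[of _ "torus L \<times> torus L"]) (auto simp: torus_adj_def finite_torus)
  have sym: "\<psi> a a' = \<psi> a' a" for a a'
    using pair_barrier_minus[OF L3(2), of m "a $ i0 - a' $ i0"] by (simp add: \<psi>_def)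
  have top: "\<psi> u v \<le> \<psi> a a" if adj: "(u, v) \<in> ?E" for a
  proof -
    obtain i where i: "v = wrap L (u + axis i 1) \<or> v = wrap L (u - axis i 1)" using adj by (rule torus_adj_cases)
    define e where "e = (axis i 1 :: int ^ 'd) $ i0"
    have e: "e = 0 \<or> e = 1" by (simp add: e_def axis_def)
    have vi: "v $ i0 = (u $ i0 + e) mod int L \<or> v $ i0 = (u $ i0 - e) mod int L"
      using i by (auto simp: wrap_nth e_def)
    have "\<psi> u v = pair_barrier m L e \<or> \<psi> u v = pair_barrier m L (- e)"
      using vi by (auto simp: \<psi>_def pair_barrier_mod)
    then have "\<psi> u v = pair_barrier m L e" using pair_barrier_minus[OF L3(2)] by auto
    then show ?thesis using e pair_barrier_0_1[of m L] L by (auto simp: \<psi>_def)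
  qed
  define d1 where "d1 w = \<psi> w v - \<psi> u v" for w
  define d2 where "d2 w = \<psi> u w - \<psi> u v" for w
  \<comment> \<open>\<open>F a d\<close> charges a pair with first entry \<open>a\<close> for the
    change \<open>d\<close> at its new position; both orders of a pair and both moving sites give
    the four terms in \<open>pt\<close>.\<close>
  define F where "F a d = (\<lambda>(p, q). if p = a then d q else 0 :: real)" for a :: "int ^ 'd" and d :: "int ^ 'd \<Rightarrow> real"
  have pt: "\<psi> (sw p q u) (sw p q v) - \<psi> u v \<le> F u d1 (p, q) + F u d1 (q, p) + F v d2 (p, q) + F v d2 (q, p)"
    if pq: "(p, q) \<in> ?E" for p q
  proof -
    have "p \<noteq> q" using pq by (auto simp: torus_adj_def)
    consider "p = u" "q = v" | "p = v" "q = u" | "\<not> (p = u \<and> q = v)" "\<not> (p = v \<and> q = u)" by blast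
    then show ?thesis
    proof cases
      case 1
      then show ?thesis using uv top[of u] top[of v] pq sym[of v u]
        by (simp add: F_def d1_def d2_def sw_def)
    next
      case 2
      then have "(u, v) \<in> ?E" using pq torus_adj_sym by blast
      then show ?thesis using 2 uv top[of u] top[of v] sym[of v u]
        by (simp add: F_def d1_def d2_def sw_def)
    next
      case 3
      then show ?thesis using uv \<open>p \<noteq> q\<close> by (auto simp: F_def d1_def d2_def sw_def)
    qed
  qed
  have FN: "(\<Sum>pq\<in>?E. F a d pq) = (\<Sum>w\<in>{w. (a, w) \<in> ?E}. d w)" for a d
  proof -
    have "(\<Sum>pq\<in>?E. F a d pq) = (\<Sum>pq\<in>Pair a ` {w. (a, w) \<in> ?E}. F a d pq)"
      by (rule sum.mono_neutral_right[OF finE]) (auto simp: F_def)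
    also have "\<dots> = (\<Sum>w\<in>{w. (a, w) \<in> ?E}. d w)"
      by (subst sum.reindex) (auto simp: inj_on_def F_def)
    finally show ?thesis .
  qed
  have Fs: "(\<Sum>(p, q)\<in>?E. F a d (q, p)) = (\<Sum>pq\<in>?E. F a d pq)" for a d
    by (rule sum.reindex_bij_witness[where i = prod.swap and j = prod.swap]) (auto intro: torus_adj_sym)
  define s where "s = u $ i0 - v $ i0"
  let ?Q = "pair_barrier m L"
  define lap where "lap = ?Q (s + 1) + ?Q (s - 1) - 2 * ?Q s"
  have 1: "(\<Sum>w\<in>{w. (u, w) \<in> ?E}. d1 w) = lap"
    using torus_adj_coordinate_sum[OF L3(1) u, of "\<lambda>x. ?Q (x - v $ i0)" i0]
    by (simp add: d1_def \<psi>_def pair_barrier_mod lap_def s_def algebra_simps)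
  have 2: "(\<Sum>w\<in>{w. (v, w) \<in> ?E}. d2 w) = lap"
    using torus_adj_coordinate_sum[OF L3(1) v, of "\<lambda>x. ?Q (u $ i0 - x)" i0]
    by (simp add: d2_def \<psi>_def pair_barrier_mod lap_def s_def algebra_simps)
  have "(\<Sum>(p, q)\<in>?E. \<psi> (sw p q u) (sw p q v) - \<psi> u v) \<le>
      (\<Sum>(p, q)\<in>?E. F u d1 (p, q) + F u d1 (q, p) + F v d2 (p, q) + F v d2 (q, p))"
    using pt by (intro sum_mono) auto
  also have "\<dots> = (\<Sum>pq\<in>?E. F u d1 pq) + (\<Sum>(p, q)\<in>?E. F u d1 (q, p)) +
      (\<Sum>pq\<in>?E. F v d2 pq) + (\<Sum>(p, q)\<in>?E. F v d2 (q, p))"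
    by (simp add: split_def sum.distrib)
  also have "\<dots> = 4 * lap" unfolding Fs FN 1 2 by simp
  finally have "real L ^ 2 / 2 * (\<Sum>(p, q)\<in>?E. \<psi> (sw p q u) (sw p q v) - \<psi> u v) \<le> real L ^ 2 / 2 * (4 * lap)"
    by (rule mult_left_mono) simp
  also have "\<dots> = real L ^ 2 * 2 * lap" by simp
  also have "\<dots> \<le> 16 * ((2 * real m + 1) / (16 * real L)) -
      (if \<exists>j\<in>{- int m..int m}. (s - j) mod int L = 0 then 1 else 0)"
    unfolding lap_def by (rule pair_barrier_laplacian[OF L3(3)])
  \<comment> \<open>A site in the dependence set is within \<open>m\<close> in the coordinate
    \<open>i0\<close> modulo \<open>L\<close>, which is all that the barrier sees.\<close>
  also have "\<dots> \<le> 16 * ((2 * real m + 1) / (16 * real L)) - (if v \<in> (\<lambda>w. wrap L (u + w)) ` ball0 m then 1 else 0)"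
  proof (cases "v \<in> (\<lambda>w. wrap L (u + w)) ` ball0 m")
    case True
    then obtain w where w: "w \<in> ball0 m" "v = wrap L (u + w)" by blast
    have "s - (- (w $ i0)) = (u $ i0 + w $ i0) - (u $ i0 + w $ i0) mod int L"
      by (simp add: s_def w(2) wrap_nth)
    then have "(s - (- (w $ i0))) mod int L = 0" by (simp only: mod_diff_right_eq) simp
    moreover have "- (w $ i0) \<in> {- int m..int m}" using ball0_bound[OF w(1), of i0] by auto
    ultimately have "\<exists>j\<in>{- int m..int m}. (s - j) mod int L = 0" by (rule bexI)
    then show ?thesis by simp
  qed simp
  finally show ?thesis .
qed

section \<open>The lattice model as an instance\<close>

definition layered_by :: "(real \<Rightarrow> real) \<Rightarrow> real set \<Rightarrow> bool" where
  "layered_by wt V \<longleftrightarrow> (\<forall>\<theta>\<in>V. wt \<theta> \<ge> 0) \<and> (\<forall>v\<in>V. (\<Sum>\<theta>\<in>V. if \<theta> \<le> v then wt \<theta> else 0) = v)"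

lemma restrict_configs:
  fixes x :: "('d::finite) config"
  assumes "x \<in> configs (torus L)" "L > 0"
  shows "restrict (\<lambda>v. x (wrap L (u + v))) (ball0 m) \<in> configs (ball0 m)"
proof -
  have "x (wrap L (u + v)) \<in> {-1, 1}" for v
    using assms wrap_in_torus[of L "u + v"] unfolding configs_def by (auto simp: PiE_iff)
  then show ?thesis unfolding configs_def by (auto simp: PiE_iff)
qed

text \<open>For the reaction function the polynomial \<open>spin_mean\<close> is taken, because the
  locale demands its identity for all real densities. The rate is \<open>L^2 / 2\<close> since
  \<open>torus_adj\<close> holds both orders of each pair; the torus acts on itself by translation.
  The bound \<open>L \<ge> 2 * m + 3\<close> gives an injective ball, two distinct neighbours per
  direction and \<open>pair_barrier_0_1\<close>.\<close>

lemma lattice_glauber_exclusion: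
  fixes c :: "('d::finite) config \<Rightarrow> real"
  assumes L: "L \<ge> 2 * m + 3" and att: "attractive m c"
    and wt: "layered_by wt (c ` configs (ball0 m))"
  shows "glauber_exclusion (torus L) (torus_adj L) (real L ^ 2 / 2)
    (\<lambda>u. (\<lambda>v. wrap L (u + v)) ` ball0 m) (flip_rate m c L)
    (\<lambda>\<rho>. spin_mean (ball0 m) \<rho> (\<lambda>\<xi>. - 2 * of_int (\<xi> 0) * c \<xi>))
    (c ` configs (ball0 m)) wt (sum wt (c ` configs (ball0 m))) (card (ball0 m :: (int ^ 'd) set))
    (\<lambda>u v. pair_barrier m L (u $ i0 - v $ i0)) ((2 * real m + 1) / (16 * real L))
    (torus L) (\<lambda>g u. wrap L (u + g))"
proof
  have L0: "L > 0" "2 * m < L" using L by auto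
  have fb: "finite (ball0 m :: (int ^ 'd) set)" by (rule finite_ball0)
  have z: "0 \<in> (ball0 m :: (int ^ 'd) set)" by (rule zero_in_ball0)
  have dep: "depends_on ((\<lambda>v. wrap L (u + v)) ` ball0 m) (flip_rate m c L u)" for u
    unfolding depends_on_def flip_rate_def by (auto intro!: arg_cong[where f = c] simp: fun_eq_iff restrict_def)
  show "finite (torus L :: (int ^ 'd) set)" by (rule finite_torus)
  show "(torus L :: (int ^ 'd) set) \<noteq> {}" using wrap_in_torus[OF L0(1)] by blast
  show "torus_adj L \<subseteq> (torus L :: (int ^ 'd) set) \<times> torus L" by (auto simp: torus_adj_def)
  show "(\<lambda>v. wrap L (u + v)) ` ball0 m \<subseteq> torus L" for u :: "int ^ 'd" using wrap_in_torus[OF L0(1)] by auto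
  show "u \<in> (\<lambda>v. wrap L (u + v)) ` ball0 m" if "u \<in> torus L" for u :: "int ^ 'd"
    using z wrap_torus[OF that] by (intro image_eqI[of _ _ 0]) auto
  show "card ((\<lambda>v. wrap L (u + v)) ` ball0 m) \<le> card (ball0 m :: (int ^ 'd) set)" for u :: "int ^ 'd"
    using fb by (rule card_image_le)
  show "depends_on ((\<lambda>v. wrap L (u + v)) ` ball0 m) (flip_rate m c L u)" for u by (rule dep)
  show "finite (c ` configs (ball0 m))" unfolding configs_def using finite_spins[OF fb] by blast
  show "wt \<theta> \<ge> 0" if "\<theta> \<in> c ` configs (ball0 m)" for \<theta> using wt that by (simp only: layered_by_def)
  show "(\<Sum>\<theta>\<in>c ` configs (ball0 m). if \<theta> \<le> flip_rate m c L u x then wt \<theta> else 0) = flip_rate m c L u x"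
    if "x \<in> torus L \<rightarrow>\<^sub>E {-1, 1}" for u x
  proof -
    have "flip_rate m c L u x \<in> c ` configs (ball0 m)"
      unfolding flip_rate_def using restrict_configs[of x L u m] that L0 by (auto simp: configs_def)
    then show ?thesis using wt by (simp only: layered_by_def)
  qed
  show "(x u = 1 \<and> y u = 1 \<longrightarrow> flip_rate m c L u y \<le> flip_rate m c L u x) \<and>
      (x u = -1 \<and> y u = -1 \<longrightarrow> flip_rate m c L u x \<le> flip_rate m c L u y)"
    if u: "u \<in> torus L" and x: "x \<in> torus L \<rightarrow>\<^sub>E {-1, 1}" and y: "y \<in> torus L \<rightarrow>\<^sub>E {-1, 1}"
      and le: "\<And>v. v \<in> torus L \<Longrightarrow> x v \<le> y v" for u x y
  proof -
    define x' where "x' = restrict (\<lambda>v. x (wrap L (u + v))) (ball0 m)"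
    define y' where "y' = restrict (\<lambda>v. y (wrap L (u + v))) (ball0 m)"
    have "x' \<in> configs (ball0 m)" "y' \<in> configs (ball0 m)"
      unfolding x'_def y'_def using restrict_configs[OF _ L0(1)] x y by (simp_all only: configs_def)
    moreover have "\<forall>v\<in>ball0 m. x' v \<le> y' v"
      unfolding x'_def y'_def by (intro ballI) (simp, intro le wrap_in_torus L0(1))
    moreover have "x' 0 = x u" "y' 0 = y u" using z wrap_torus[OF u] by (simp_all add: x'_def y'_def)
    ultimately show ?thesis using att unfolding attractive_def flip_rate_def x'_def[symmetric] y'_def[symmetric]
      by metis
  qed
  show "spin_mean (torus L) \<rho> (\<lambda>x. - 2 * of_int (x u) * flip_rate m c L u x) =
      spin_mean (ball0 m) \<rho> (\<lambda>\<xi>. - 2 * of_int (\<xi> 0) * c \<xi>)" if u: "u \<in> torus L" for u \<rho>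
  proof -
    let ?nb = "(\<lambda>v. wrap L (u + v)) ` ball0 m"
    have "u \<in> ?nb" using z wrap_torus[OF u] by (intro image_eqI[of _ _ 0]) auto
    then have "depends_on ?nb (\<lambda>x. - 2 * of_int (x u) * flip_rate m c L u x :: real)"
      using dep[of u] unfolding depends_on_def by metis
    then have "spin_mean (torus L) \<rho> (\<lambda>x. - 2 * of_int (x u) * flip_rate m c L u x) =
        spin_mean ?nb \<rho> (\<lambda>x. - 2 * of_int (x u) * flip_rate m c L u x)"
      using wrap_in_torus[OF L0(1)] by (intro spin_mean_restrict finite_torus) auto
    also have "\<dots> = spin_mean (ball0 m) \<rho> (\<lambda>\<xi>. - 2 * of_int (\<xi> 0) * c \<xi>)"
    proof -
      have "bij_betw (\<lambda>v. wrap L (u + v)) (ball0 m) ?nb"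
        using inj_on_wrap_ball0[OF L0(2)] by (simp add: bij_betw_def)
      from spin_mean_bij[OF this fb, of \<rho> "\<lambda>\<xi>. - 2 * of_int (\<xi> 0) * c \<xi>"]
      show ?thesis using z wrap_torus[OF u] by (simp add: flip_rate_def o_def)
    qed
    finally show ?thesis .
  qed
  show "0 \<le> pair_barrier m L (u $ i0 - v $ i0) \<and> pair_barrier m L (u $ i0 - v $ i0) \<le> (2 * real m + 1) / (16 * real L)"
    for u v :: "int ^ 'd" by (rule pair_barrier_bounds[OF L0(1)])
  show "0 < (2 * real m + 1) / (16 * real L)" using L0 by (intro divide_pos_pos) auto
  show "real L ^ 2 / 2 * (\<Sum>(p, q)\<in>torus_adj L. pair_barrier m L (sw p q u $ i0 - sw p q v $ i0) - pair_barrier m L (u $ i0 - v $ i0)) \<le>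
      16 * ((2 * real m + 1) / (16 * real L)) - (if v \<in> (\<lambda>w. wrap L (u + w)) ` ball0 m then 1 else 0)"
    if "u \<in> torus L" "v \<in> torus L" "u \<noteq> v" for u v :: "int ^ 'd"
    by (rule pair_barrier_super[OF L that])
  show "bij_betw (\<lambda>u. wrap L (u + g)) (torus L) (torus L)" for g :: "int ^ 'd" by (rule bij_wrap[OF L0(1)])
  show "bij_betw (\<lambda>g. wrap L (a + g)) (torus L) (torus L)" for a :: "int ^ 'd"
    using bij_wrap[OF L0(1), of a] by (simp add: add.commute)
  show "(wrap L (u + g), wrap L (v + g)) \<in> torus_adj L" if "(u, v) \<in> torus_adj L" for g u v :: "int ^ 'd"
  proof -
    have uv: "u \<in> torus L" "v \<in> torus L" "u \<noteq> v" using that by (auto simp: torus_adj_def)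
    have "wrap L (u + g) \<noteq> wrap L (v + g)"
      unfolding wrap_add_eq_iff using uv by (simp add: wrap_torus)
    moreover have "wrap L (wrap L (a + e) + g) = wrap L (wrap L (a + g) + e)" for a e :: "int ^ 'd"
      unfolding wrap_add_left by (simp add: ac_simps)
    ultimately show ?thesis using that wrap_in_torus[OF L0(1)] unfolding torus_adj_def by auto
  qed
  show "flip_rate m c L (wrap L (u + g)) x = flip_rate m c L u (x \<circ> (\<lambda>u. wrap L (u + g)))" for g u x
  proof -
    have "wrap L (wrap L (u + g) + v) = wrap L (wrap L (u + v) + g)" for v
      unfolding wrap_add_left by (simp add: ac_simps)
    then show ?thesis by (simp add: flip_rate_def)
  qed
  show "real L ^ 2 / 2 \<ge> 0" by simp
qed simp

section \<open>The reaction function and the choice of constants\<close>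

lemma pmf_spin:
  assumes "\<rho> \<in> {-1..1}" "s = -1 \<or> s = 1"
  shows "pmf (spin_pmf \<rho>) s = (1 + \<rho> * of_int s) / 2"
proof -
  have inj: "inj (\<lambda>b. if b then 1 else -1 :: int)" by (auto simp: inj_def)
  have p: "(1 + \<rho>) / 2 \<in> {0..1}" using assms(1) by auto
  have "pmf (spin_pmf \<rho>) (if b then 1 else -1) = pmf (bernoulli_pmf ((1 + \<rho>) / 2)) b" for b
    unfolding spin_pmf_def using pmf_map_inj'[OF inj, of _ b] by simp
  from this[of True] this[of False] show ?thesis
    using assms(2) p by (auto simp: field_simps)
qed

text \<open>Confined to [-1,1], because outside the Bernoulli parameter is clipped while
  \<open>spin_mean\<close> continues as a polynomial.\<close>

lemma reaction_eq_spin_mean: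
  fixes c :: "('d::finite) config \<Rightarrow> real"
  assumes \<rho>: "\<rho> \<in> {-1..1}"
  shows "reaction m c \<rho> = spin_mean (ball0 m) \<rho> (\<lambda>\<xi>. - 2 * of_int (\<xi> 0) * c \<xi>)"
proof -
  let ?B = "ball0 m :: (int ^ 'd) set" and ?f = "\<lambda>\<xi>. -2 * of_int (\<xi> 0) * c \<xi>"
  have fin: "finite ?B" by (rule finite_ball0)
  have supp: "set_pmf (spin_pmf \<rho>) \<subseteq> {-1, 1}" by (auto simp: spin_pmf_def)
  have "\<xi> \<in> ?B \<rightarrow>\<^sub>E {-1, 1}" if "\<xi> \<in> set_pmf (product_measure m \<rho>)" for \<xi> :: "'d config"
  proof -
    have "\<xi> \<in> PiE_dflt ?B undefined (\<lambda>_. set_pmf (spin_pmf \<rho>))"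
      using that unfolding product_measure_def set_Pi_pmf[OF fin] by (simp add: o_def)
    then show ?thesis using supp by (auto simp: PiE_dflt_def PiE_iff extensional_def)
  qed
  then have "reaction m c \<rho> = (\<Sum>\<xi>\<in>?B \<rightarrow>\<^sub>E {-1, 1}. ?f \<xi> * pmf (product_measure m \<rho>) \<xi>)"
    unfolding reaction_def by (intro integral_measure_pmf_real finite_spins fin) auto
  also have "\<dots> = spin_mean ?B \<rho> ?f" unfolding spin_mean_def
  proof (rule sum.cong)
    fix \<xi> :: "'d config" assume \<xi>: "\<xi> \<in> ?B \<rightarrow>\<^sub>E {-1, 1}"
    have "pmf (product_measure m \<rho>) \<xi> = (\<Prod>v\<in>?B. pmf (spin_pmf \<rho>) (\<xi> v))"
      unfolding product_measure_def using \<xi> by (intro pmf_Pi' fin) (auto simp: PiE_iff extensional_def)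
    also have "\<dots> = spin_weight ?B \<rho> \<xi>" unfolding spin_weight_def
      using PiE_spin_cases[OF \<xi>] by (intro prod.cong pmf_spin[OF \<rho>]) auto
    finally show "?f \<xi> * pmf (product_measure m \<rho>) \<xi> = spin_weight ?B \<rho> \<xi> * ?f \<xi>" by simp
  qed simp
  finally show ?thesis .
qed

text \<open>A wrong sign would, together with the sign at the endpoint on that side, produce another
  root by the intermediate value theorem. Away from the root, compactness bounds the modulus of
  \<open>R\<close> from below.\<close>

lemma high_temperature_flow:
  fixes R :: "real \<Rightarrow> real"
  assumes cont: "continuous_on {-1..1} R" and ends: "R 1 < 0" "R (-1) > 0"
    and root: "{x \<in> {-1..1}. R x = 0} = {r}"
  shows "x \<in> {-1..1} \<Longrightarrow> x \<ge> r \<Longrightarrow> R x \<le> 0" "x \<in> {-1..1} \<Longrightarrow> x \<le> r \<Longrightarrow> R x \<ge> 0"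
    and "\<delta> > 0 \<Longrightarrow> \<exists>\<mu>>0. \<forall>x\<in>{-1..1}. \<bar>x - r\<bar> \<ge> \<delta> \<longrightarrow> \<bar>R x\<bar> \<ge> \<mu>"
proof -
  have uniq: "y = r" if "y \<in> {-1..1}" "R y = 0" for y using root that by blast
  have r: "r \<in> {-1..1}" "R r = 0" using root by blast+
  show "R x \<le> 0" if x: "x \<in> {-1..1}" "x \<ge> r"
  proof (rule ccontr)
    assume neg: "\<not> R x \<le> 0"
    obtain y where y: "x \<le> y" "y \<le> 1" "R y = 0"
      using IVT2'[of R 1 0 x] neg ends x continuous_on_subset[OF cont, of "{x..1}"] by auto
    then have "y = r" using uniq x by auto
    then show False using x y neg r by auto
  qed
  show "R x \<ge> 0" if x: "x \<in> {-1..1}" "x \<le> r"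
  proof (rule ccontr)
    assume neg: "\<not> R x \<ge> 0"
    obtain y where y: "-1 \<le> y" "y \<le> x" "R y = 0"
      using IVT2'[of R x 0 "-1"] neg ends x continuous_on_subset[OF cont, of "{-1..x}"] by auto
    then have "y = r" using uniq x by auto
    then show False using x y neg r by auto
  qed
  show "\<exists>\<mu>>0. \<forall>x\<in>{-1..1}. \<bar>x - r\<bar> \<ge> \<delta> \<longrightarrow> \<bar>R x\<bar> \<ge> \<mu>" if \<delta>: "\<delta> > 0"
  proof -
    define K where "K = {-1..1} \<inter> {x. \<bar>x - r\<bar> \<ge> \<delta>}"
    show ?thesis
    proof (cases "K = {}")
      case True
      then have "\<forall>x\<in>{-1..1}. \<bar>x - r\<bar> \<ge> \<delta> \<longrightarrow> \<bar>R x\<bar> \<ge> 1" by (auto simp: K_def)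
      then show ?thesis by (intro exI[of _ 1] conjI; simp)
    next
      case False
      have "closed {x. \<delta> \<le> \<bar>x - r\<bar>}" by (intro closed_Collect_le continuous_intros)
      then have "compact K" unfolding K_def by (intro compact_Int_closed) auto
      moreover have "continuous_on K (\<lambda>x. \<bar>R x\<bar>)"
        by (intro continuous_intros continuous_on_subset[OF cont]) (auto simp: K_def)
      ultimately obtain y where y: "y \<in> K" "\<And>x. x \<in> K \<Longrightarrow> \<bar>R y\<bar> \<le> \<bar>R x\<bar>"
        using continuous_attains_inf[of K "\<lambda>x. \<bar>R x\<bar>"] False by blast
      have "R y \<noteq> 0" using uniq[of y] y(1) \<delta> by (auto simp: K_def)
      then have "\<bar>R y\<bar> > 0" by simp
      moreover have "\<forall>x\<in>{-1..1}. \<bar>x - r\<bar> \<ge> \<delta> \<longrightarrow> \<bar>R x\<bar> \<ge> \<bar>R y\<bar>" using y(2) by (auto simp: K_def)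
      ultimately show ?thesis by (intro exI[of _ "\<bar>R y\<bar>"] conjI)
    qed
  qed
qed

text \<open>Order of choices: \<open>\<epsilon>\<close>, then \<open>\<delta>\<close> from
  continuity of the derivative, \<open>\<mu>\<close> from the flow, \<open>t\<close> so long that
  the burn-in constant is absorbed, and \<open>L\<close> last, to beat \<open>exp (dr * t)\<close>.
  One \<open>\<epsilon>\<close> is lost in \<open>l\<close>, the other by absorbing
  \<open>K1\<close>.\<close>

lemma eventually_spectral_gap_ge:
  fixes m :: nat and c :: "('d::finite) config \<Rightarrow> real" and \<rho> :: real
  assumes pos: "\<forall>\<xi>\<in>configs (ball0 m). c \<xi> > 0" and att: "attractive m c" and ht: "high_temperature m c \<rho>"
    and \<epsilon>: "\<epsilon> > 0" "2 * \<epsilon> < - deriv (reaction m c) \<rho>"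
  shows "eventually (\<lambda>L. spectral_gap m c L \<ge> - deriv (reaction m c) \<rho> - 2 * \<epsilon>) sequentially"
proof -
  let ?B = "ball0 m :: (int ^ 'd) set"
  define f where "f = (\<lambda>\<xi> :: 'd config. - 2 * of_int (\<xi> 0) * c \<xi>)"
  define R where "R = (\<lambda>\<rho>. spin_mean ?B \<rho> f)"
  define R' where "R' z = (\<Sum>v\<in>?B. spin_mean ?B z (half_diff v f))" for z
  define \<gamma> where "\<gamma> = - deriv (reaction m c) \<rho>"
  define V where "V = c ` configs ?B"
  have fin: "finite ?B" by (rule finite_ball0)
  have zB: "0 \<in> ?B" by (rule zero_in_ball0)
  have DR: "(R has_real_derivative R' z) (at z)" for z
    unfolding R_def R'_def by (rule spin_mean_deriv[OF fin])
  then have dR: "deriv R z = R' z" for z by (rule DERIV_imp_deriv)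
  have "continuous_on {-1..1} R"
    by (rule DERIV_continuous_on) (rule has_field_derivative_at_within[OF DR])
  note cR = this
  have R_eq: "reaction m c z = R z" if "z \<in> {-1..1}" for z
    unfolding R_def f_def by (rule reaction_eq_spin_mean[OF that])
  have const: "(\<lambda>u\<in>?B. b) \<in> configs ?B" if "b = -1 \<or> b = 1" for b using that by (auto simp: configs_def)
  have "R 1 = f (\<lambda>u\<in>?B. 1)" unfolding R_def using spin_mean_extreme[OF fin, of 1 f] by simp
  then have R1: "R 1 < 0" using pos const[of 1] zB by (simp add: f_def)
  have "R (-1) = f (\<lambda>u\<in>?B. -1)" unfolding R_def using spin_mean_extreme[OF fin, of "-1" f] by simp
  then have Rm1: "R (-1) > 0" using pos const[of "-1"] zB by (simp add: f_def)
  have root: "{x \<in> {-1..1}. R x = 0} = {\<rho>}"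
  proof -
    have "{x \<in> {-1..1}. R x = 0} = {x \<in> {-1..1}. reaction m c x = 0}" using R_eq by auto
    then show ?thesis using ht by (simp only: high_temperature_def)
  qed
  then have \<rho>: "\<rho> \<in> {-1..1}" "R \<rho> = 0" by blast+
  then have "\<rho> \<noteq> 1" "\<rho> \<noteq> -1" using R1 Rm1 by auto
  then have \<rho>i: "\<rho> \<in> {-1<..<1}" using \<rho> by auto
  \<comment> \<open>The root is interior, so \<open>reaction\<close> and the polynomial
    \<open>R\<close> agree near it and have the same derivative there.\<close>
  have "eventually (\<lambda>x. x \<in> {-1<..<1}) (nhds \<rho>)" by (rule eventually_nhds_in_open) (use \<rho>i in auto)
  then have "eventually (\<lambda>x. reaction m c x = R x) (nhds \<rho>)"
    by eventually_elim (rule R_eq, auto)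
  then have "deriv (reaction m c) \<rho> = deriv R \<rho>" by (intro deriv_cong_ev) auto
  then have R'\<rho>: "R' \<rho> = - \<gamma>" by (simp add: \<gamma>_def dR)
  have finV: "finite V" unfolding V_def configs_def using finite_spins[OF fin] by blast
  obtain wt where "\<And>\<theta>. \<theta> \<in> V \<Longrightarrow> wt \<theta> \<ge> 0"
    and "\<And>v. v \<in> V \<Longrightarrow> (\<Sum>\<theta>\<in>V. if \<theta> \<le> v then wt \<theta> else 0) = v"
    using layer_weights[OF finV] pos unfolding V_def by blast
  then have wt: "layered_by wt V" by (simp add: layered_by_def)
  define cm where "cm = sum wt V"
  have cm: "cm \<ge> 0" unfolding cm_def using wt by (intro sum_nonneg) (simp add: layered_by_def)
  define b where "b = card ?B"
  define l where "l = \<gamma> - \<epsilon>"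
  have l: "l > 0" using \<epsilon> by (simp add: l_def \<gamma>_def)
  have "isCont R' \<rho>"
    unfolding R'_def by (intro continuous_intros DERIV_isCont[OF spin_mean_deriv[OF fin]])
  then obtain \<delta>1 where \<delta>1: "\<delta>1 > 0" "\<And>x. \<bar>x - \<rho>\<bar> < \<delta>1 \<Longrightarrow> \<bar>R' x - R' \<rho>\<bar> < \<epsilon> / 2"
    unfolding isCont_def LIM_def dist_real_def using \<epsilon>(1)
    by (metis (no_types, opaque_lifting) abs_zero diff_self half_gt_zero)
  \<comment> \<open>Chosen so that \<open>q * \<delta> \<le> \<epsilon>\<close> makes
    \<open>4 * cm * b^2 * \<delta>\<close> at most \<open>\<epsilon> / 2\<close>; the 1 keeps
    \<open>q\<close> positive.\<close>
  define q where "q = 8 * cm * (real b)\<^sup>2 + 1"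
  have q: "q > 0" using cm by (simp add: q_def add_nonneg_pos)
  define \<delta> where "\<delta> = min (\<delta>1 / 2) (\<epsilon> / q)"
  have \<delta>: "\<delta> > 0" "\<delta> < \<delta>1" "q * \<delta> \<le> \<epsilon>"
  proof -
    show "\<delta> > 0" "\<delta> < \<delta>1" using \<delta>1 \<epsilon> q by (auto simp: \<delta>_def)
    have "q * \<delta> \<le> q * (\<epsilon> / q)" using q by (intro mult_left_mono) (auto simp: \<delta>_def)
    then show "q * \<delta> \<le> \<epsilon>" using q by simp
  qed
  have contract: "deriv R \<rho>1 + 2 * cm * b\<^sup>2 * \<bar>\<rho>1 - \<rho>2\<bar> \<le> - l"
    if "\<bar>\<rho>1 - \<rho>\<bar> \<le> \<delta>" "\<bar>\<rho>2 - \<rho>\<bar> \<le> \<delta>" for \<rho>1 \<rho>2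
  proof -
    have "R' \<rho>1 \<le> - \<gamma> + \<epsilon> / 2" using \<delta>1(2)[of \<rho>1] that(1) \<delta>(2) R'\<rho> by linarith
    moreover have "\<bar>\<rho>1 - \<rho>2\<bar> \<le> 2 * \<delta>" using that by linarith
    then have "2 * cm * b\<^sup>2 * \<bar>\<rho>1 - \<rho>2\<bar> \<le> 2 * cm * b\<^sup>2 * (2 * \<delta>)" using cm by (intro mult_left_mono) auto
    moreover have "2 * cm * b\<^sup>2 * (2 * \<delta>) \<le> \<epsilon> / 2" using \<delta> by (simp add: q_def algebra_simps)
    ultimately show ?thesis unfolding dR l_def by linarith
  qed
  note flow = high_temperature_flow[OF cR R1 Rm1 root]
  obtain \<mu> where \<mu>: "\<mu> > 0" "\<forall>x\<in>{-1..1}. \<bar>x - \<rho>\<bar> \<ge> \<delta> \<longrightarrow> \<bar>R x\<bar> \<ge> \<mu>"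
    using flow(3)[OF \<delta>(1)] by (elim exE conjE)
  define K1 where "K1 = exp ((2 * cm * b + l) * (2 / \<mu> + 1)) + 1"
  define t where "t = max (2 / \<mu> + 1) (ln K1 / \<epsilon>)"
  have K1: "K1 > 0" unfolding K1_def by (simp add: add_pos_pos)
  have t: "t \<ge> 2 / \<mu> + 1" by (simp add: t_def)
  have t0: "t > 0" using t \<mu>(1) divide_pos_pos[of 2 \<mu>] by linarith
  have "ln K1 = \<epsilon> * (ln K1 / \<epsilon>)" using \<epsilon> by simp
  also have "\<dots> \<le> \<epsilon> * t" using \<epsilon> by (intro mult_left_mono) (auto simp: t_def)
  finally have "exp (ln K1) \<le> exp (\<epsilon> * t)" by simp
  then have K1t: "K1 \<le> exp (\<epsilon> * t)" using K1 by simp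
  \<comment> \<open>The locale constants written out, since \<open>L\<close> is chosen in terms of
    them before the locale can be interpreted. They do not depend on \<open>L\<close>; only
    \<open>\<psi>m\<close> does.\<close>
  define gc where "gc = b + 2 * (2 * b + b\<^sup>2) + 2 * b * (2 * b + b\<^sup>2)"
  define dr where "dr = 17 + 2 * cm * gc + 2 * cm * b"
  define dc where "dc = 8 * cm * (1 + b) + 1"
  define rc where "rc = 2 * (2 * cm + 1) * b ^ 4 + 8 * cm * b ^ 5"
  have "(\<lambda>L. dc * exp (dr * t) * ((2 * real m + 1) / (16 * real L)) * rc) \<longlonglongrightarrow>
      dc * exp (dr * t) * 0 * rc"
  proof (intro tendsto_intros)
    have "(\<lambda>L. ((2 * real m + 1) / 16) * (1 / real L)) \<longlonglongrightarrow> ((2 * real m + 1) / 16) * 0"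
      by (intro tendsto_intros lim_1_over_n)
    then show "(\<lambda>L. (2 * real m + 1) / (16 * real L)) \<longlonglongrightarrow> 0" by simp
  qed
  moreover have "dc * exp (dr * t) * 0 * rc < l * exp (- l * t)" using l by simp
  ultimately have "eventually (\<lambda>L. dc * exp (dr * t) * ((2 * real m + 1) / (16 * real L)) * rc < l * exp (- l * t)) sequentially"
    by (rule order_tendstoD)
  moreover have "eventually (\<lambda>L. L \<ge> 2 * m + 3) sequentially" by (rule eventually_ge_at_top)
  ultimately show ?thesis
  proof eventually_elim
    case (elim L)
    define \<psi>m where "\<psi>m = (2 * real m + 1) / (16 * real L)"
    \<comment> \<open>Any coordinate will do; the index type is nonempty.\<close>
    define i0 :: 'd where "i0 = undefined"
    interpret ge: glauber_exclusion "torus L" "torus_adj L" "real L ^ 2 / 2"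
      "\<lambda>u. (\<lambda>v. wrap L (u + v)) ` ball0 m" "flip_rate m c L" R V wt cm b
      "\<lambda>u v. pair_barrier m L (u $ i0 - v $ i0)" \<psi>m "torus L" "\<lambda>g u. wrap L (u + g)"
      unfolding R_def f_def V_def cm_def b_def \<psi>m_def
      by (rule lattice_glauber_exclusion[OF elim(2) att wt[unfolded V_def]])
    have gen: "ge_gen m c L \<phi> x = ge.gen \<phi> x" if x: "x \<in> torus L \<rightarrow>\<^sub>E {-1, 1}" for \<phi> and x :: "'d config"
    proof -
      have "(\<Sum>pq\<in>torus_adj L. ge.rate (Inl pq) *\<^sub>R (\<phi> (ge.act (Inl pq) x) - \<phi> x)) =
          of_nat L ^ 2 * exclusion_gen L \<phi> x"
        unfolding exclusion_gen_def sum_distrib_left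
      proof (rule sum.cong)
        fix pq :: "(int ^ 'd) \<times> (int ^ 'd)" assume pq: "pq \<in> torus_adj L"
        obtain p q where pqd: "pq = (p, q)" by force
        then have "p \<noteq> q" using pq by (auto simp: torus_adj_def)
        then have "x \<circ> sw p q = x(p := x q, q := x p)" by (auto simp: sw_def fun_eq_iff)
        then show "ge.rate (Inl pq) *\<^sub>R (\<phi> (ge.act (Inl pq) x) - \<phi> x) =
          of_nat L ^ 2 * (1 / 2 * (case pq of (u, u') \<Rightarrow> \<phi> (x(u := x u', u' := x u)) - \<phi> x))"
          unfolding pqd by (simp add: scaleR_conv_of_real)
      qed simp
      moreover have "(\<Sum>u\<in>torus L. \<Sum>i\<in>UNIV \<times> V. ge.rate (Inr (u, i)) *\<^sub>R (\<phi> (ge.act (Inr (u, i)) x) - \<phi> x)) =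
          glauber_gen m c L \<phi> x"
        unfolding glauber_gen_def
        by (rule sum.cong[OF HOL.refl]) (simp only: ge.act_update_sum[OF _ x, of _ \<phi>], rule scaleR_conv_of_real)
      ultimately show ?thesis unfolding ge_gen_def ge.gen_def ge.sum_events by simp
    qed
    have err: "ge.decor_const * exp (ge.decor_rate * t) * \<psi>m * ge.recursion_const \<le> l * exp (- l * t)"
      using elim(1) unfolding ge.decor_const_def ge.decor_rate_def ge.recursion_const_def ge.growth_const_def
        dc_def dr_def rc_def gc_def \<psi>m_def by simp
    have bound: "Re z \<ge> \<gamma> - 2 * \<epsilon>"
      if eig: "\<And>x. x \<in> torus L \<rightarrow>\<^sub>E {-1, 1} \<Longrightarrow> ge.gen \<phi> x = - z * \<phi> x"
        and xy: "x \<in> torus L \<rightarrow>\<^sub>E {-1, 1}" "y \<in> torus L \<rightarrow>\<^sub>E {-1, 1}" "\<phi> x \<noteq> \<phi> y" for \<phi> z and x y :: "'d config"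
    proof -
      have "exp (- Re z * t) \<le> K1 * exp (- l * t)"
        unfolding K1_def
        by (rule ge.eigenvalue_bound[OF eig[unfolded ge.gen_def] xy flow(1,2) _ \<rho>(1) \<delta>(1) \<mu>(1) l contract t err])
          (use \<mu>(2) in auto)
      also have "\<dots> \<le> exp (\<epsilon> * t) * exp (- l * t)" using K1t by (rule mult_right_mono) simp
      also have "\<dots> = exp ((\<epsilon> - l) * t)" by (simp add: exp_add[symmetric] algebra_simps)
      finally have "- Re z * t \<le> (\<epsilon> - l) * t" by simp
      then have "- Re z \<le> \<epsilon> - l" using t0 by (rule mult_right_le_imp_le)
      then show ?thesis by (simp add: l_def)
    qed
    have "\<gamma> - 2 * \<epsilon> > 0" using \<epsilon> by (simp add: \<gamma>_def)
    from ge.spectral_gap_ge[OF this bound]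
    have "\<gamma> - 2 * \<epsilon> \<le> Min {Re z |z. (\<exists>\<phi> :: 'd config \<Rightarrow> complex. (\<exists>x\<in>torus L \<rightarrow>\<^sub>E {-1, 1}. \<phi> x \<noteq> 0) \<and>
        (\<forall>x\<in>torus L \<rightarrow>\<^sub>E {-1, 1}. - ge.gen \<phi> x = z * \<phi> x)) \<and> z \<noteq> 0}" .
    also have "\<dots> = spectral_gap m c L"
      unfolding spectral_gap_def neg_gen_eigenvalue_def configs_def using gen by (simp cong: ball_cong)
    finally show ?case by (simp add: \<gamma>_def)
  qed
qed

theorem theorem2:
  fixes m :: nat and c :: "('d::finite) config \<Rightarrow> real" and \<rho> :: real
  assumes "\<forall>\<xi>\<in>configs (ball0 m). c \<xi> > 0"
    and "attractive m c"
    and "high_temperature m c \<rho>"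
  shows "liminf (\<lambda>L. ereal (spectral_gap m c L)) \<ge> ereal \<bar>deriv (reaction m c) \<rho>\<bar>"
proof -
  define \<gamma> where "\<gamma> = - deriv (reaction m c) \<rho>"
  have \<gamma>: "\<gamma> > 0" using assms(3) by (simp add: high_temperature_def \<gamma>_def)
  have "ereal \<gamma> \<le> liminf (\<lambda>L. ereal (spectral_gap m c L))"
    unfolding le_Liminf_iff
  proof (intro allI impI)
    fix y assume "y < ereal \<gamma>"
    then obtain r where r: "y < ereal r" "ereal r < ereal \<gamma>" using ereal_dense2 by blast
    \<comment> \<open>The second bound keeps \<open>\<gamma> - 2 * \<epsilon>\<close> positive even
      when \<open>r\<close> lies far below 0.\<close>
    define \<epsilon> where "\<epsilon> = min ((\<gamma> - r) / 3) (\<gamma> / 3)"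
    have \<epsilon>: "\<epsilon> > 0" "2 * \<epsilon> < \<gamma>" "r < \<gamma> - 2 * \<epsilon>" using r \<gamma> by (auto simp: \<epsilon>_def min_def field_simps)
    have "eventually (\<lambda>L. spectral_gap m c L \<ge> \<gamma> - 2 * \<epsilon>) sequentially"
      unfolding \<gamma>_def using \<epsilon> by (intro eventually_spectral_gap_ge assms) (simp_all add: \<gamma>_def)
    then show "eventually (\<lambda>L. y < ereal (spectral_gap m c L)) sequentially"
    proof eventually_elim
      case (elim L)
      then have "ereal r < ereal (spectral_gap m c L)" using \<epsilon>(3) by simp
      with r(1) show ?case by (rule less_trans)
    qed
  qed
  moreover have "\<bar>deriv (reaction m c) \<rho>\<bar> = \<gamma>" using \<gamma> by (simp add: \<gamma>_def)
  ultimately show ?thesis by simp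
qed

end
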